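(* Let $\mathcal I$ be a monomial ideal in $\mathbb C\langle x_1,\dots,x_d\rangle$ of finite type $k$. Then the algebra $C^*(T)/\mathcal K(\mathcal F_X)$ is the universal C*-algebra generated by a row contraction $\underline s=[s_1,\dots,s_d]$ such that (i) $I=\sum_{i=1}^ds_is_i^*$; (ii) $p(\underline s)=0$ for all $p\in\mathcal I$; (iii) $s_i^*s_i=\sum_{\mu\in E_i^k}s_\mu s_\mu^*$ for all $i=1,\dots,d$, where $E_i^k=\{\mu\in\Lambda^*:|\mu|=k,\ i\mu\in\Lambda^*\}$.
   Context: $\mathbb F_+^d$ is the free monoid of words in $\{1,\dots,d\}$, $|\mu|$ is the length of $\mu$; for $\mu=\mu_1\cdots\mu_n$ put $x^\mu=x_{\mu_1}\cdots x_{\mu_n}$ in the ring $\mathbb C\langle x_1,\dots,x_d\rangle$ of polynomials in noncommuting variables, and $s_\mu=s_{\mu_1}\cdots s_{\mu_n}$. A monomial ideal is a two-sided ideal generated by monomials; throughout, monomial ideals are generated by monomials of degree at least 2. It is of finite type $k$ if it is generated by a set $S$ of monomials whose maximal degree is $k+1$ and every generating set of monomials has maximal degree at least $k+1$. Put $\Lambda^*=\{\mu: x^\mu\notin\mathcal I\}$. $\mathcal F_X$ is the Hilbert space with orthonormal basis $\{e_\mu:\mu\in\Lambda^*\}$, and $T_i\in B(\mathcal F_X)$: $T_ie_\nu=e_{i\nu}$ if $i\nu\in\Lambda^*$, $T_ie_\nu=0$ otherwise. $C^*(T)$ is the C*-algebra generated by $I,T_1,\dots,T_d$; it contains the compacts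 $\mathcal K(\mathcal F_X)$. The universal generator $s_i$ corresponds to the image of $T_i$ in the quotient: that is, the images of $T_1,\dots,T_d$ satisfy (i)–(iii), and any $d$-tuple of operators satisfying (i)–(iii) is the image of this tuple under a $*$-homomorphism of $C^*(T)/\mathcal K(\mathcal F_X)$. *)

theory Defs
  imports
    "HOL-Analysis.Analysis"
    "HOL-Library.Poly_Mapping"
    "HOL-Algebra.QuotRing"
    "HOL-Algebra.Module"
    "HOL-Algebra.Subrings"
begin

section \<open>Noncommutative polynomials and monomial ideals\<close>

text \<open>
  Words are lists over a finite alphabet. The additive notation makes the finitely supported
  functions on words, with the convolution product of \<^theory>\<open>HOL-Library.Poly_Mapping\<close>, the ring
  of polynomials in noncommuting variables indexed by the alphabet.
\<close>

instantiation list :: (type) monoid_add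
begin

definition zero_list :: "'a list" where "zero_list = []"

definition plus_list :: "'a list \<Rightarrow> 'a list \<Rightarrow> 'a list" where "plus_list = (@)"

instance
  by standard (simp_all add: zero_list_def plus_list_def)

end

type_synonym 'd free_algebra = "'d list \<Rightarrow>\<^sub>0 complex"

definition free_var :: "'d \<Rightarrow> 'd free_algebra" where
  "free_var i = Poly_Mapping.single [i] 1"

definition free_monomial :: "'d list \<Rightarrow> 'd free_algebra" where
  "free_monomial w = prod_list (map free_var w)"

definition class_ring :: "'a::ring_1 ring" where
  "class_ring = \<lparr>carrier = UNIV, mult = (*), one = 1, zero = 0, add = (+)\<rparr>"

definition monomial_ideal_gen :: "'d list set \<Rightarrow> 'd free_algebra set" where
  "monomial_ideal_gen S = Idl\<^bsub>class_ring\<^esub> (free_monomial ` S)"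

definition monomial_ideal :: "'d free_algebra set \<Rightarrow> bool" where
  "monomial_ideal I \<longleftrightarrow> (\<exists>S. (\<forall>w\<in>S. 2 \<le> length w) \<and> I = monomial_ideal_gen S)"

text \<open>
  A generating set of monomials of unbounded degree counts as one of maximal degree
  at least \<open>k + 1\<close>.
\<close>

definition finite_type :: "'d free_algebra set \<Rightarrow> nat \<Rightarrow> bool" where
  "finite_type I k \<longleftrightarrow>
     (\<exists>S. I = monomial_ideal_gen S \<and>
        (\<forall>w\<in>S. length w \<le> k + 1) \<and> (\<exists>w\<in>S. length w = k + 1)) \<and>
     (\<forall>S. I = monomial_ideal_gen S \<longrightarrow> (\<exists>w\<in>S. k + 1 \<le> length w))"

definition allowed_words :: "'d free_algebra set \<Rightarrow> 'd list set" where
  "allowed_words I = {w. free_monomial w \<notin> I}"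

definition extendable_words :: "'d free_algebra set \<Rightarrow> nat \<Rightarrow> 'd \<Rightarrow> 'd list set" where
  "extendable_words I k i =
     {w \<in> allowed_words I. length w = k \<and> i # w \<in> allowed_words I}"


section \<open>Unital C*-algebras with explicit carriers\<close>

record 'a cstar = "(complex, 'a) module" +
  star :: "'a \<Rightarrow> 'a"
  cnorm :: "'a \<Rightarrow> real"

text \<open>The zero algebra is allowed, so the unit is not required to have norm one.\<close>

locale cstar_algebra = ring A + module class_ring A
  for A :: "('a, 'm) cstar_scheme" (structure) +
  assumes smult_mult_left:
      "\<lbrakk>x \<in> carrier A; y \<in> carrier A\<rbrakk> \<Longrightarrow> (c \<odot>\<^bsub>A\<^esub> x) \<otimes>\<^bsub>A\<^esub> y = c \<odot>\<^bsub>A\<^esub> (x \<otimes>\<^bsub>A\<^esub> y)"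
    and smult_mult_right:
      "\<lbrakk>x \<in> carrier A; y \<in> carrier A\<rbrakk> \<Longrightarrow> x \<otimes>\<^bsub>A\<^esub> (c \<odot>\<^bsub>A\<^esub> y) = c \<odot>\<^bsub>A\<^esub> (x \<otimes>\<^bsub>A\<^esub> y)"
    and star_closed: "x \<in> carrier A \<Longrightarrow> star A x \<in> carrier A"
    and star_star: "x \<in> carrier A \<Longrightarrow> star A (star A x) = x"
    and star_add:
      "\<lbrakk>x \<in> carrier A; y \<in> carrier A\<rbrakk> \<Longrightarrow> star A (x \<oplus>\<^bsub>A\<^esub> y) = star A x \<oplus>\<^bsub>A\<^esub> star A y"
    and star_smult: "x \<in> carrier A \<Longrightarrow> star A (c \<odot>\<^bsub>A\<^esub> x) = cnj c \<odot>\<^bsub>A\<^esub> star A x"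
    and star_mult:
      "\<lbrakk>x \<in> carrier A; y \<in> carrier A\<rbrakk> \<Longrightarrow> star A (x \<otimes>\<^bsub>A\<^esub> y) = star A y \<otimes>\<^bsub>A\<^esub> star A x"
    and cnorm_nonneg: "x \<in> carrier A \<Longrightarrow> 0 \<le> cnorm A x"
    and cnorm_eq_0: "x \<in> carrier A \<Longrightarrow> cnorm A x = 0 \<longleftrightarrow> x = \<zero>\<^bsub>A\<^esub>"
    and cnorm_triangle:
      "\<lbrakk>x \<in> carrier A; y \<in> carrier A\<rbrakk> \<Longrightarrow> cnorm A (x \<oplus>\<^bsub>A\<^esub> y) \<le> cnorm A x + cnorm A y"
    and cnorm_smult: "x \<in> carrier A \<Longrightarrow> cnorm A (c \<odot>\<^bsub>A\<^esub> x) = cmod c * cnorm A x"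
    and cnorm_mult:
      "\<lbrakk>x \<in> carrier A; y \<in> carrier A\<rbrakk> \<Longrightarrow> cnorm A (x \<otimes>\<^bsub>A\<^esub> y) \<le> cnorm A x * cnorm A y"
    and cstar_identity: "x \<in> carrier A \<Longrightarrow> cnorm A (star A x \<otimes>\<^bsub>A\<^esub> x) = (cnorm A x)\<^sup>2"
    and complete:
      "\<lbrakk>\<And>n::nat. X n \<in> carrier A;
        \<And>\<epsilon>. 0 < \<epsilon> \<Longrightarrow> \<exists>N. \<forall>m\<ge>N. \<forall>n\<ge>N. cnorm A (X m \<ominus>\<^bsub>A\<^esub> X n) < \<epsilon>\<rbrakk>
       \<Longrightarrow> \<exists>L\<in>carrier A. (\<lambda>n. cnorm A (X n \<ominus>\<^bsub>A\<^esub> L)) \<longlonglongrightarrow> 0"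

definition cstar_subalgebra :: "('a, 'm) cstar_scheme \<Rightarrow> 'a set \<Rightarrow> bool" where
  "cstar_subalgebra A B \<longleftrightarrow>
     subring B A \<and>
     (\<forall>c. \<forall>x\<in>B. c \<odot>\<^bsub>A\<^esub> x \<in> B) \<and>
     (\<forall>x\<in>B. star A x \<in> B) \<and>
     (\<forall>X. \<forall>L\<in>carrier A. (\<forall>n::nat. X n \<in> B) \<and>
        (\<lambda>n. cnorm A (X n \<ominus>\<^bsub>A\<^esub> L)) \<longlonglongrightarrow> 0 \<longrightarrow> L \<in> B)"

text \<open>Subalgebras contain the unit of the ambient algebra.\<close>

definition cstar_generated :: "('a, 'm) cstar_scheme \<Rightarrow> 'a set \<Rightarrow> 'a set" where
  "cstar_generated A S = \<Inter>{B. cstar_subalgebra A B \<and> S \<subseteq> B}"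

text \<open>
  As in \<^const>\<open>rcoset_mult\<close>, the operations are unions over representatives; for a
  closed star-closed ideal these unions are over equal cosets.
\<close>

definition cstar_quotient :: "('a, 'm) cstar_scheme \<Rightarrow> 'a set \<Rightarrow> 'a set cstar" where
  "cstar_quotient A K =
     \<lparr>carrier = carrier (A Quot K), mult = mult (A Quot K), one = one (A Quot K),
      zero = zero (A Quot K), add = add (A Quot K),
      smult = (\<lambda>c X. \<Union>x\<in>X. K +>\<^bsub>A\<^esub> (c \<odot>\<^bsub>A\<^esub> x)),
      star = (\<lambda>X. \<Union>x\<in>X. K +>\<^bsub>A\<^esub> star A x),
      cnorm = (\<lambda>X. INF x\<in>X. cnorm A x)\<rparr>"

definition star_hom ::
    "('a, 'm) cstar_scheme \<Rightarrow> ('b, 'n) cstar_scheme \<Rightarrow> ('a \<Rightarrow> 'b) \<Rightarrow> bool" where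
  "star_hom A B \<phi> \<longleftrightarrow>
     \<phi> \<in> ring_hom A B \<and>
     (\<forall>c. \<forall>x\<in>carrier A. \<phi> (c \<odot>\<^bsub>A\<^esub> x) = c \<odot>\<^bsub>B\<^esub> \<phi> x) \<and>
     (\<forall>x\<in>carrier A. \<phi> (star A x) = star B (\<phi> x))"

text \<open>In a C*-algebra the positive elements are those of the form \<open>b\<^sup>* b\<close>.\<close>

definition cstar_le :: "('a, 'm) cstar_scheme \<Rightarrow> 'a \<Rightarrow> 'a \<Rightarrow> bool" where
  "cstar_le A x y \<longleftrightarrow> (\<exists>b\<in>carrier A. y \<ominus>\<^bsub>A\<^esub> x = star A b \<otimes>\<^bsub>A\<^esub> b)"


section \<open>The defining relations\<close>

definition word_prod :: "('a, 'm) cstar_scheme \<Rightarrow> ('d \<Rightarrow> 'a) \<Rightarrow> 'd list \<Rightarrow> 'a" where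
  "word_prod A s w = foldr (\<lambda>i x. s i \<otimes>\<^bsub>A\<^esub> x) w \<one>\<^bsub>A\<^esub>"

definition poly_eval :: "('a, 'm) cstar_scheme \<Rightarrow> ('d \<Rightarrow> 'a) \<Rightarrow> 'd free_algebra \<Rightarrow> 'a" where
  "poly_eval A s p =
     (\<Oplus>\<^bsub>A\<^esub> w \<in> Poly_Mapping.keys p. Poly_Mapping.lookup p w \<odot>\<^bsub>A\<^esub> word_prod A s w)"

definition row_contraction :: "('a, 'm) cstar_scheme \<Rightarrow> ('d::finite \<Rightarrow> 'a) \<Rightarrow> bool" where
  "row_contraction A s \<longleftrightarrow>
     (\<forall>i. s i \<in> carrier A) \<and>
     cstar_le A (\<Oplus>\<^bsub>A\<^esub> i \<in> UNIV. s i \<otimes>\<^bsub>A\<^esub> star A (s i)) \<one>\<^bsub>A\<^esub>"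

definition monomial_relations ::
    "('a, 'm) cstar_scheme \<Rightarrow> 'd::finite free_algebra set \<Rightarrow> nat \<Rightarrow> ('d \<Rightarrow> 'a) \<Rightarrow> bool" where
  "monomial_relations A I k s \<longleftrightarrow>
     row_contraction A s \<and>
     \<one>\<^bsub>A\<^esub> = (\<Oplus>\<^bsub>A\<^esub> i \<in> UNIV. s i \<otimes>\<^bsub>A\<^esub> star A (s i)) \<and>
     (\<forall>p\<in>I. poly_eval A s p = \<zero>\<^bsub>A\<^esub>) \<and>
     (\<forall>i. star A (s i) \<otimes>\<^bsub>A\<^esub> s i =
        (\<Oplus>\<^bsub>A\<^esub> w \<in> extendable_words I k i. word_prod A s w \<otimes>\<^bsub>A\<^esub> star A (word_prod A s w)))"


section \<open>Operators on complex Hilbert spaces\<close>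

text \<open>The inner product is linear in the first argument.\<close>

class complex_hilbert_space = banach +
  fixes scaleC :: "complex \<Rightarrow> 'a \<Rightarrow> 'a"  (infixr \<open>*\<^sub>C\<close> 75)
    and cinner :: "'a \<Rightarrow> 'a \<Rightarrow> complex"
  assumes scaleC_add_right: "c *\<^sub>C (x + y) = c *\<^sub>C x + c *\<^sub>C y"
    and scaleC_add_left: "(b + c) *\<^sub>C x = b *\<^sub>C x + c *\<^sub>C x"
    and scaleC_scaleC: "b *\<^sub>C c *\<^sub>C x = (b * c) *\<^sub>C x"
    and scaleR_scaleC: "r *\<^sub>R x = complex_of_real r *\<^sub>C x"
    and cinner_commute: "cinner x y = cnj (cinner y x)"
    and cinner_add_left: "cinner (x + y) z = cinner x z + cinner y z"
    and cinner_scaleC_left: "cinner (c *\<^sub>C x) y = c * cinner x y"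
    and cinner_norm: "cinner x x = complex_of_real ((norm x)\<^sup>2)"

definition cspan :: "'h::complex_hilbert_space set \<Rightarrow> 'h set" where
  "cspan S = {\<Sum>x\<in>F. c x *\<^sub>C x | F c. finite F \<and> F \<subseteq> S}"

definition orthonormal_basis :: "'i set \<Rightarrow> ('i \<Rightarrow> 'h::complex_hilbert_space) \<Rightarrow> bool" where
  "orthonormal_basis J e \<longleftrightarrow>
     (\<forall>i\<in>J. \<forall>j\<in>J. cinner (e i) (e j) = (if i = j then 1 else 0)) \<and>
     closure (cspan (e ` J)) = UNIV"

definition adjoint_op ::
    "('h::complex_hilbert_space \<Rightarrow>\<^sub>L 'h) \<Rightarrow> ('h \<Rightarrow>\<^sub>L 'h)" where
  "adjoint_op A = (THE B. \<forall>x y. cinner (blinfun_apply A x) y = cinner x (blinfun_apply B y))"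

text \<open>The elements of \<open>'h \<Rightarrow>\<^sub>L 'h\<close> are only real linear, hence the restriction on the carrier.\<close>

definition bounded_operators :: "('h::complex_hilbert_space \<Rightarrow>\<^sub>L 'h) cstar" where
  "bounded_operators =
     \<lparr>carrier = {A. \<forall>c x. blinfun_apply A (c *\<^sub>C x) = c *\<^sub>C blinfun_apply A x},
      mult = (o\<^sub>L), one = id_blinfun, zero = 0, add = (+),
      smult = (\<lambda>c A. Blinfun (\<lambda>x. c *\<^sub>C blinfun_apply A x)),
      star = adjoint_op, cnorm = norm\<rparr>"

definition compact_operators :: "('h::complex_hilbert_space \<Rightarrow>\<^sub>L 'h) set" where
  "compact_operators =
     {A \<in> carrier bounded_operators. compact (closure (blinfun_apply A ` cball 0 1))}"


section \<open>The Toeplitz algebra of a tuple and its quotient by the compacts\<close>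

definition toeplitz_algebra ::
    "('d \<Rightarrow> ('h::complex_hilbert_space \<Rightarrow>\<^sub>L 'h)) \<Rightarrow> ('h \<Rightarrow>\<^sub>L 'h) cstar" where
  "toeplitz_algebra T = bounded_operators\<lparr>carrier := cstar_generated bounded_operators (range T)\<rparr>"

definition toeplitz_quotient ::
    "('d \<Rightarrow> ('h::complex_hilbert_space \<Rightarrow>\<^sub>L 'h)) \<Rightarrow> ('h \<Rightarrow>\<^sub>L 'h) set cstar" where
  "toeplitz_quotient T = cstar_quotient (toeplitz_algebra T) compact_operators"

definition toeplitz_image ::
    "('d \<Rightarrow> ('h::complex_hilbert_space \<Rightarrow>\<^sub>L 'h)) \<Rightarrow> 'd \<Rightarrow> ('h \<Rightarrow>\<^sub>L 'h) set" where
  "toeplitz_image T i = compact_operators +>\<^bsub>toeplitz_algebra T\<^esub> T i"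

text \<open>
  The left creation operators compressed to the Hilbert space with orthonormal basis
  \<open>e w\<close>, \<open>w\<close> an allowed word; \<open>e\<close> is unconstrained on the other words.
\<close>

definition fock_shifts ::
    "'d free_algebra set \<Rightarrow> ('d list \<Rightarrow> 'h::complex_hilbert_space) \<Rightarrow>
     ('d \<Rightarrow> ('h \<Rightarrow>\<^sub>L 'h)) \<Rightarrow> bool" where
  "fock_shifts I e T \<longleftrightarrow>
     (\<forall>i. T i \<in> carrier bounded_operators \<and>
       (\<forall>w\<in>allowed_words I. blinfun_apply (T i) (e w) =
          (if i # w \<in> allowed_words I then e (i # w) else 0)))"

end

theory Submission
  imports Defs
begin

text \<open>
  The relations hold in the quotient because they hold for the shifts \<open>T\<^sub>i\<close> up to finitely many
  basis vectors: \<open>1 - \<Sum> T\<^sub>i T\<^sub>i\<^sup>*\<close> is the projection onto the vacuum \<open>e\<^sub>[\<^sub>]\<close>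
  (\<open>vacuum_projection\<close>), and the two sides of the third relation differ by a projection onto
  vectors \<open>e\<^sub>w\<close> with \<open>w\<close> shorter than \<open>k\<close> (\<open>initial_projection_mod_compacts\<close>). Together with
  words in the shifts, the vacuum projection yields all matrix units, so the Toeplitz algebra contains
  the compact operators (\<open>compact_subset_generated\<close>). The compact operators have an approximate unit
  of projections onto the span of finitely many basis vectors; by means of it the C*-identity passes
  to the quotient norm (\<open>quotient_cstar_identity\<close>).

  For the universal property let \<open>s\<close> satisfy the relations on \<open>H\<close>. The first two of them give
  \<open>\<Sum> s\<^sub>w s\<^sub>w\<^sup>* = 1\<close>, the sum being over the allowed words \<open>w\<close> of any given length. Hence
  \<open>V\<^sub>n h = n\<^sup>-\<^sup>1\<^sup>/\<^sup>2 \<Sum> e\<^sub>w \<otimes> s\<^sub>w\<^sup>* h\<close>, summed over the allowed words shorter than \<open>n\<close>, is an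
  isometry of \<open>H\<close> into the tensor product of the Fock space with \<open>H\<close>: a discrete form of the
  Poisson kernel. It almost intertwines \<open>T\<^sub>i \<otimes> 1\<close> with \<open>s\<^sub>i\<close>, and \<open>T\<^sub>i\<^sup>* \<otimes> 1\<close> with \<open>s\<^sub>i\<^sup>*\<close>: the
  error comes from a number of word lengths that does not grow with \<open>n\<close>, each of weight \<open>1/n\<close>, so
  it is of order \<open>n\<^sup>-\<^sup>1\<^sup>/\<^sup>2\<close>. The third relation enters here. Together with the first two it forces
  the \<open>s\<^sub>i\<close> to be partial isometries with orthogonal ranges (\<open>s_partial_isometry\<close>, \<open>s_orthogonal\<close>) and
  \<open>s\<^sub>i\<^sup>* s\<^sub>i s\<^sub>w = s\<^sub>w\<close> as soon as \<open>w\<close> has at least \<open>k\<close> letters and \<open>i w\<close> is allowed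
  (\<open>initial_projection_word\<close>). If \<open>K\<close> is compact, then \<open>K \<otimes> 1\<close> and \<open>0\<close> are almost intertwined, as
  up to a small error \<open>K\<close> takes its values in the span of finitely many basis vectors. Those \<open>x\<close> for
  which \<open>x \<otimes> 1\<close> is almost intertwined with some \<open>y\<close>, and \<open>x\<^sup>* \<otimes> 1\<close> with \<open>y\<^sup>*\<close>, form a C*-algebra; it contains the shifts, \<open>y\<close> depends on \<open>x\<close> as a *-homomorphism, and
  compact operators are mapped to \<open>0\<close>. This is the homomorphism from the quotient.

  The tensor product remains implicit below. The proof works with the maps
  \<open>z \<mapsto> V\<^sub>n\<^sup>* (z \<otimes> 1) V\<^sub>n\<close>, which are finite sums (\<open>average\<close>) and contractive by a bound for
  operator matrices (\<open>norm_matrix_form_le\<close>). Almost intertwining, read for the adjoints, says that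
  they turn left multiplication by \<open>x\<close> into left multiplication by \<open>y\<close>, up to an error that
  tends to \<open>0\<close> uniformly for \<open>z\<close> in the unit ball (\<open>intertwines\<close>).
\<close>

section \<open>Complex Hilbert spaces\<close>

lemma scaleC_one [simp]: "1 *\<^sub>C x = x"
  using scaleR_scaleC[of 1 x] by simp

lemma scaleC_zero_left [simp]: "0 *\<^sub>C x = 0"
  using scaleR_scaleC[of 0 x] by simp

lemma scaleC_zero_right [simp]: "c *\<^sub>C 0 = 0"
  using scaleC_add_right[of c 0 0] by simp

lemma scaleC_minus_right [simp]: "c *\<^sub>C (- x) = - (c *\<^sub>C x)"
  using scaleC_add_right[of c x "- x"] by (simp add: eq_neg_iff_add_eq_0 add.commute)

lemma scaleC_minus_left [simp]: "(- c) *\<^sub>C x = - (c *\<^sub>C x)"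
  using scaleC_add_left[of c "- c" x] by (simp add: eq_neg_iff_add_eq_0 add.commute)

lemma scaleC_diff_right: "c *\<^sub>C (x - y) = c *\<^sub>C x - c *\<^sub>C y"
  using scaleC_add_right[of c x "- y"] by simp

lemma scaleC_diff_left: "(b - c) *\<^sub>C x = b *\<^sub>C x - c *\<^sub>C x"
  using scaleC_add_left[of b "- c" x] by simp

lemma scaleC_sum_right: "c *\<^sub>C (\<Sum>i\<in>A. f i) = (\<Sum>i\<in>A. c *\<^sub>C f i)"
  by (induction A rule: infinite_finite_induct) (auto simp: scaleC_add_right)

lemma scaleC_sum_left: "(\<Sum>i\<in>A. f i) *\<^sub>C x = (\<Sum>i\<in>A. f i *\<^sub>C x)"
  by (induction A rule: infinite_finite_induct) (auto simp: scaleC_add_left)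

lemma cinner_add_right: "cinner x (y + z) = cinner x y + cinner x z"
  using cinner_commute[of x "y + z"] cinner_commute[of x y] cinner_commute[of x z]
  by (simp add: cinner_add_left)

lemma cinner_scaleC_right: "cinner x (c *\<^sub>C y) = cnj c * cinner x y"
  using cinner_commute[of x "c *\<^sub>C y"] cinner_commute[of x y] by (simp add: cinner_scaleC_left)

lemma cinner_zero_left [simp]: "cinner 0 x = 0"
  using cinner_add_left[of 0 0 x] by simp

lemma cinner_zero_right [simp]: "cinner x 0 = 0"
  using cinner_add_right[of x 0 0] by simp

lemma cinner_minus_left [simp]: "cinner (- x) y = - cinner x y"
  using cinner_add_left[of x "- x" y] by (simp add: eq_neg_iff_add_eq_0 add.commute)

lemma cinner_minus_right [simp]: "cinner x (- y) = - cinner x y"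
  using cinner_add_right[of x y "- y"] by (simp add: eq_neg_iff_add_eq_0 add.commute)

lemma cinner_diff_left: "cinner (x - y) z = cinner x z - cinner y z"
  using cinner_add_left[of x "- y" z] by simp

lemma cinner_diff_right: "cinner x (y - z) = cinner x y - cinner x z"
  using cinner_add_right[of x y "- z"] by simp

lemma cinner_sum_left: "cinner (\<Sum>i\<in>A. f i) y = (\<Sum>i\<in>A. cinner (f i) y)"
  by (induction A rule: infinite_finite_induct) (auto simp: cinner_add_left)

lemma cinner_sum_right: "cinner y (\<Sum>i\<in>A. f i) = (\<Sum>i\<in>A. cinner y (f i))"
  by (induction A rule: infinite_finite_induct) (auto simp: cinner_add_right)

lemma norm_sq_eq_cinner: "(norm x)\<^sup>2 = Re (cinner x x)"
  by (simp add: cinner_norm)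

lemma norm_add_sq: "(norm (x + y))\<^sup>2 = (norm x)\<^sup>2 + (norm y)\<^sup>2 + 2 * Re (cinner x y)"
  using cinner_commute[of y x]
  by (simp add: norm_sq_eq_cinner cinner_add_left cinner_add_right)

lemma norm_diff_sq: "(norm (x - y))\<^sup>2 = (norm x)\<^sup>2 + (norm y)\<^sup>2 - 2 * Re (cinner x y)"
  using norm_add_sq[of x "- y"] by simp

lemma norm_scaleC [simp]: "norm (c *\<^sub>C x) = cmod c * norm x"
proof -
  have "complex_of_real ((norm (c *\<^sub>C x))\<^sup>2) = (c * cnj c) * complex_of_real ((norm x)\<^sup>2)"
    unfolding cinner_norm[symmetric] by (simp add: cinner_scaleC_left cinner_scaleC_right)
  also have "\<dots> = complex_of_real ((cmod c * norm x)\<^sup>2)"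
    by (simp add: complex_norm_square[symmetric] power_mult_distrib)
  finally show ?thesis
    by (simp only: of_real_eq_iff) (simp add: power2_eq_iff_nonneg)
qed

lemma cinner_eq_0_ext: "(\<And>y. cinner x y = 0) \<Longrightarrow> x = 0"
  using cinner_norm[of x] by simp

lemma cinner_ext: "(\<And>y. cinner x y = cinner z y) \<Longrightarrow> x = z"
  using cinner_eq_0_ext[of "x - z"] by (simp add: cinner_diff_left)

lemma cinner_ext_right: "(\<And>y. cinner y x = cinner y z) \<Longrightarrow> x = z"
  using cinner_ext[of x z] by (metis cinner_commute)

lemma Cauchy_Schwarz_cinner: "cmod (cinner x y) \<le> norm x * norm y"
proof (cases "y = 0")
  case False
  define c where "c = cinner x y / complex_of_real ((norm y)\<^sup>2)"
  have ny: "(norm y)\<^sup>2 > 0" using False by simp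
  have "0 \<le> (norm (x - c *\<^sub>C y))\<^sup>2" by simp
  also have "\<dots> = (norm x)\<^sup>2 + (cmod c * norm y)\<^sup>2 - 2 * Re (cnj c * cinner x y)"
    by (simp add: norm_diff_sq cinner_scaleC_right)
  also have "cnj c * cinner x y = complex_of_real ((cmod (cinner x y))\<^sup>2 / (norm y)\<^sup>2)"
    unfolding c_def by (simp add: complex_norm_square[symmetric] mult.commute flip: of_real_power)
  also have "(cmod c * norm y)\<^sup>2 = (cmod (cinner x y))\<^sup>2 / (norm y)\<^sup>2"
  proof -
    have "cmod c = cmod (cinner x y) / (norm y)\<^sup>2"
      unfolding c_def norm_divide norm_of_real by simp
    then show ?thesis using ny by (simp add: field_simps power2_eq_square)
  qed
  finally have "(cmod (cinner x y))\<^sup>2 / (norm y)\<^sup>2 \<le> (norm x)\<^sup>2" by simp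
  then have "(cmod (cinner x y))\<^sup>2 \<le> (norm x * norm y)\<^sup>2"
    using ny by (simp add: field_simps)
  then show ?thesis by (meson power2_le_imp_le mult_nonneg_nonneg norm_ge_zero)
qed simp

lemma bounded_linear_scaleC: "bounded_linear (\<lambda>x::'h::complex_hilbert_space. c *\<^sub>C x)"
  by (rule bounded_linear_intro[where K = "cmod c"])
     (auto simp: scaleC_add_right scaleR_scaleC scaleC_scaleC mult.commute)

lemma bounded_linear_cinner_left: "bounded_linear (\<lambda>x::'h::complex_hilbert_space. cinner x y)"
  by (rule bounded_linear_intro[where K = "norm y"])
     (auto simp: cinner_add_left scaleR_scaleC cinner_scaleC_left scaleR_conv_of_real
        Cauchy_Schwarz_cinner)

lemma cinner_norm_bound:
  fixes x :: "'h::complex_hilbert_space"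
  assumes "0 \<le> c" "\<And>y. cmod (cinner x y) \<le> c * norm y"
  shows "norm x \<le> c"
proof (cases "x = 0")
  case False
  have "norm x * norm x \<le> c * norm x"
    using assms(2)[of x] by (simp add: cinner_norm power2_eq_square del: of_real_mult of_real_power)
  with False show ?thesis by simp
qed (use assms in simp)

text \<open>
  The functional \<open>\<parallel>x\<parallel>\<^sup>2 - 2 Re (f x)\<close> is bounded below and, by the parallelogram law, each of its
  minimising sequences is Cauchy. The vanishing of its variation at the minimum is the
  representation of \<open>f\<close>.
\<close>

lemma riesz_representation:
  fixes f :: "'h::complex_hilbert_space \<Rightarrow> complex"
  assumes f: "bounded_linear f" and fC: "\<And>c x. f (c *\<^sub>C x) = c * f x"
  shows "\<exists>z. \<forall>x. f x = cinner x z"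
proof -
  interpret f: bounded_linear f by fact
  obtain B where B: "\<And>x. cmod (f x) \<le> norm x * B" "B \<ge> 0" using f.nonneg_bounded by blast
  define J where "J x = (norm x)\<^sup>2 - 2 * Re (f x)" for x
  have J_ge: "- B\<^sup>2 \<le> J x" for x
  proof -
    have "Re (f x) \<le> norm x * B" using B(1)[of x] complex_Re_le_cmod[of "f x"] by linarith
    moreover have "0 \<le> (norm x - B)\<^sup>2" by simp
    ultimately show ?thesis unfolding J_def power2_diff by linarith
  qed
  define m where "m = Inf (range J)"
  have bdd: "bdd_below (range J)" using J_ge by (auto simp: bdd_below_def)
  have m_le: "m \<le> J x" for x unfolding m_def by (rule cInf_lower[OF _ bdd]) auto
  have par: "(norm (x - y))\<^sup>2 = 2 * J x + 2 * J y - 4 * J ((1/2) *\<^sub>R (x + y))" for x y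
  proof -
    have "(norm ((1/2) *\<^sub>R (x + y)))\<^sup>2 = (1/4) * (norm (x + y))\<^sup>2"
      by (simp add: power2_eq_square)
    then show ?thesis
      by (simp add: J_def f.scaleR f.add norm_add_sq norm_diff_sq add_divide_distrib del: norm_scaleR)
  qed
  have "\<exists>x. J x < m + inverse (Suc n)" for n
  proof -
    have "Inf (range J) < m + inverse (Suc n)" unfolding m_def by simp
    then show ?thesis using cInf_lessD[of "range J"] by auto
  qed
  then obtain X where X: "\<And>n. J (X n) < m + inverse (real (Suc n))" by metis
  have dX: "(norm (X n - X p))\<^sup>2 \<le> 2 * inverse (real (Suc n)) + 2 * inverse (real (Suc p))" for n p
    using par[of "X n" "X p"] X[of n] X[of p] m_le[of "(1/2) *\<^sub>R (X n + X p)"] by linarith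
  have "Cauchy X"
  proof (rule metric_CauchyI)
    fix e :: real assume e: "0 < e"
    then obtain M where M: "inverse (real (Suc M)) < e\<^sup>2 / 4"
      using reals_Archimedean[of "e\<^sup>2 / 4"] by auto
    have "dist (X n) (X p) < e" if "n \<ge> M" "p \<ge> M" for n p
    proof -
      have "inverse (real (Suc n)) \<le> inverse (real (Suc M))"
           "inverse (real (Suc p)) \<le> inverse (real (Suc M))" using that by (auto simp: field_simps)
      then have "(norm (X n - X p))\<^sup>2 < e\<^sup>2" using dX[of n p] M by linarith
      then show ?thesis using e by (simp add: dist_norm power_less_imp_less_base)
    qed
    then show "\<exists>M. \<forall>n\<ge>M. \<forall>p\<ge>M. dist (X n) (X p) < e" by blast
  qed
  then obtain z where z: "X \<longlonglongrightarrow> z" using Cauchy_convergent_iff convergent_def by blast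
  have "(\<lambda>n. J (X n)) \<longlonglongrightarrow> J z" unfolding J_def
    by (intro tendsto_intros z f.tendsto)
  moreover have "(\<lambda>n. m + inverse (real (Suc n))) \<longlonglongrightarrow> m"
    using tendsto_add[OF tendsto_const LIMSEQ_inverse_real_of_nat] by simp
  ultimately have "J z \<le> m"
    by (rule LIMSEQ_le) (rule exI, rule allI, rule impI, rule less_imp_le, rule X)
  then have min: "J z \<le> J x" for x using m_le[of x] by simp
  have re: "Re (f y) = Re (cinner y z)" for y
  proof -
    define d where "d = Re (cinner y z) - Re (f y)"
    have q: "0 \<le> t\<^sup>2 * (norm y)\<^sup>2 + 2 * t * d" for t :: real
    proof -
      have "J (z + t *\<^sub>R y) = J z + t\<^sup>2 * (norm y)\<^sup>2 + 2 * t * d"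
        using cinner_commute[of z y] cinner_scaleC_right[of z "complex_of_real t" y]
        by (simp add: J_def norm_add_sq f.add f.scaleR d_def power_mult_distrib
            scaleR_scaleC[symmetric] algebra_simps)
      then show ?thesis using min[of "z + t *\<^sub>R y"] by simp
    qed
    have "d = 0"
    proof (cases "y = 0")
      case False
      have "0 \<le> (- d / (norm y)\<^sup>2)\<^sup>2 * (norm y)\<^sup>2 + 2 * (- d / (norm y)\<^sup>2) * d" by (rule q)
      also have "\<dots> = - (d\<^sup>2 / (norm y)\<^sup>2)"
        using False by (simp add: field_simps power2_eq_square)
      finally show ?thesis using False by (simp add: divide_le_0_iff)
    qed (auto simp: d_def f.zero)
    then show ?thesis by (simp add: d_def)
  qed
  have "f x = cinner x z" for x
  proof (rule complex_eqI)
    show "Im (f x) = Im (cinner x z)"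
      using re[of "(- \<i>) *\<^sub>C x"] unfolding fC cinner_scaleC_left by simp
  qed (rule re)
  then show ?thesis by blast
qed

text \<open>Gram--Schmidt: the span of finitely many vectors has a finite orthonormal basis.\<close>

lemma finite_orthonormal_expansion:
  fixes S :: "'h::complex_hilbert_space set"
  assumes "finite S"
  shows "\<exists>B. finite B \<and> (\<forall>b\<in>B. \<forall>c\<in>B. cinner b c = (if b = c then 1 else 0)) \<and>
    (\<forall>x\<in>S. x = (\<Sum>b\<in>B. cinner x b *\<^sub>C b))"
  using assms
proof induction
  case empty
  then show ?case by (intro exI[of _ "{}"]) simp
next
  case (insert x S)
  then obtain B where B: "finite B" "\<And>b c. b \<in> B \<Longrightarrow> c \<in> B \<Longrightarrow> cinner b c = (if b = c then 1 else 0)"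
     "\<And>x. x \<in> S \<Longrightarrow> x = (\<Sum>b\<in>B. cinner x b *\<^sub>C b)" by blast
  define r where "r = x - (\<Sum>b\<in>B. cinner x b *\<^sub>C b)"
  have sum_one: "(\<Sum>b\<in>B. f b * cinner b c) = f c" if "c \<in> B" for f c
  proof -
    have "(\<Sum>b\<in>B. f b * cinner b c) = (\<Sum>b\<in>B. if b = c then f b else 0)"
      by (rule sum.cong) (use B(2) that in auto)
    then show ?thesis using B(1) that by simp
  qed
  have r_orth: "cinner r c = 0" if "c \<in> B" for c
    using sum_one[OF that] by (simp add: r_def cinner_diff_left cinner_sum_left cinner_scaleC_left)
  show ?case
  proof (cases "r = 0")
    case True
    then show ?thesis using B by (intro exI[of _ B]) (auto simp: r_def)
  next
    case False
    define u where "u = complex_of_real (inverse (norm r)) *\<^sub>C r"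
    have u_orth: "cinner u c = 0" "cinner c u = 0" if "c \<in> B" for c
      using r_orth[OF that] cinner_commute[of c u] by (auto simp: u_def cinner_scaleC_left)
    have uu: "cinner u u = 1"
      using False by (simp add: u_def cinner_scaleC_left cinner_scaleC_right cinner_norm power2_eq_square
          del: of_real_inverse of_real_mult flip: of_real_mult)
    have unB: "u \<notin> B" using u_orth uu by auto
    have xu: "cinner x u = complex_of_real (norm r)"
    proof -
      have "cinner x u = cinner r u" using u_orth(2)
        by (simp add: r_def cinner_diff_left cinner_sum_left cinner_scaleC_left)
      also have "\<dots> = complex_of_real (norm r)"
        using False by (simp add: u_def cinner_scaleC_right cinner_norm power2_eq_square)
      finally show ?thesis .
    qed
    have "x = (\<Sum>b\<in>insert u B. cinner x b *\<^sub>C b)"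
      using B(1) unB False by (simp add: xu) (simp add: u_def scaleC_scaleC r_def)
    moreover have "y = (\<Sum>b\<in>insert u B. cinner y b *\<^sub>C b)" if y: "y \<in> S" for y
    proof -
      have "cinner y u = (\<Sum>b\<in>B. cinner y b * cinner b u)"
        by (subst B(3)[OF y]) (simp add: cinner_sum_left cinner_scaleC_left)
      then have "cinner y u = 0" using u_orth(2) by simp
      then show ?thesis using B(1) unB B(3)[OF y] by simp
    qed
    ultimately show ?thesis using B(1,2) u_orth uu unB
      by (intro exI[of _ "insert u B"]) auto
  qed
qed

lemma cinner_finite_expansion:
  fixes x y :: "'h::complex_hilbert_space"
  assumes "x = (\<Sum>b\<in>B. cinner x b *\<^sub>C b)"
  shows "cinner x y = (\<Sum>b\<in>B. cinner x b * cnj (cinner y b))"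
proof -
  have "cinner x y = (\<Sum>b\<in>B. cinner x b * cinner b y)"
    by (subst assms) (simp add: cinner_sum_left cinner_scaleC_left)
  also have "\<dots> = (\<Sum>b\<in>B. cinner x b * cnj (cinner y b))"
    by (intro sum.cong refl arg_cong2[where f = "(*)"] cinner_commute)
  finally show ?thesis .
qed

section \<open>The C*-algebra of bounded operators\<close>

lemma bounded_operators_sel [simp]:
  "mult bounded_operators = (o\<^sub>L)" "one bounded_operators = id_blinfun"
  "zero bounded_operators = 0" "add bounded_operators = (+)"
  "star bounded_operators = adjoint_op" "cnorm bounded_operators = norm"
  by (simp_all add: bounded_operators_def)

abbreviation ops :: "('h::complex_hilbert_space \<Rightarrow>\<^sub>L 'h) set" where
  "ops \<equiv> carrier bounded_operators"

abbreviation scale_op ::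
    "complex \<Rightarrow> ('h::complex_hilbert_space \<Rightarrow>\<^sub>L 'h) \<Rightarrow> ('h \<Rightarrow>\<^sub>L 'h)" (infixr \<open>\<cdot>\<close> 75) where
  "c \<cdot> A \<equiv> c \<odot>\<^bsub>bounded_operators\<^esub> A"

lemma ops_iff:
  "A \<in> ops \<longleftrightarrow> (\<forall>c x. A (c *\<^sub>C x) = c *\<^sub>C A x)"
  by (simp add: bounded_operators_def)

lemma smult_bounded_operators_apply [simp]:
  "(c \<cdot> A) x = c *\<^sub>C A x"
proof -
  have "bounded_linear (\<lambda>x. c *\<^sub>C A x)"
    by (rule bounded_linear_compose[OF bounded_linear_scaleC blinfun.bounded_linear_right])
  then show ?thesis
    by (simp add: bounded_operators_def bounded_linear_Blinfun_apply)
qed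

lemma ex1_adjoint:
  fixes A :: "'h::complex_hilbert_space \<Rightarrow>\<^sub>L 'h"
  assumes A: "A \<in> ops"
  shows "\<exists>!B :: 'h \<Rightarrow>\<^sub>L 'h. \<forall>x y. cinner (A x) y = cinner x (B y)"
proof -
  have "\<exists>z. \<forall>x. cinner (A x) y = cinner x z" for y
  proof (rule riesz_representation)
    show "bounded_linear (\<lambda>x. cinner (A x) y)"
      by (rule bounded_linear_compose[OF bounded_linear_cinner_left blinfun.bounded_linear_right])
  qed (use A in \<open>simp add: ops_iff cinner_scaleC_left\<close>)
  then obtain B where B: "\<And>y x. cinner (A x) y = cinner x (B y)" by metis
  have "bounded_linear B"
  proof (rule bounded_linear_intro[where K = "norm A"])
    show "B (x + y) = B x + B y" for x y
      by (rule cinner_ext_right) (simp flip: B add: cinner_add_right)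
    show "B (r *\<^sub>R x) = r *\<^sub>R B x" for r x
      by (rule cinner_ext_right) (simp flip: B add: scaleR_scaleC cinner_scaleC_right)
    show "norm (B x) \<le> norm x * norm A" for x
    proof (rule cinner_norm_bound)
      fix y
      have "cmod (cinner (B x) y) = cmod (cinner (A y) x)"
        by (metis B cinner_commute complex_mod_cnj)
      also have "\<dots> \<le> norm (A y) * norm x" by (rule Cauchy_Schwarz_cinner)
      also have "\<dots> \<le> norm A * norm y * norm x"
        by (intro mult_right_mono norm_blinfun) simp
      finally show "cmod (cinner (B x) y) \<le> norm x * norm A * norm y" by (simp add: mult_ac)
    qed simp
  qed
  then have *: "cinner (A x) y = cinner x (Blinfun B y)" for x y
    by (simp add: bounded_linear_Blinfun_apply B)
  show ?thesis
  proof (rule ex1I[of _ "Blinfun B"])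
    fix C :: "'h \<Rightarrow>\<^sub>L 'h" assume "\<forall>x y. cinner (A x) y = cinner x (C y)"
    then show "C = Blinfun B"
      by (intro blinfun_eqI cinner_ext_right) (simp flip: *)
  qed (use * in blast)
qed

lemma cinner_adjoint:
  assumes "A \<in> ops"
  shows "cinner (A x) y = cinner x (adjoint_op A y)"
  using theI'[OF ex1_adjoint[OF assms]] unfolding adjoint_op_def by blast

lemma cinner_adjoint':
  assumes "A \<in> ops"
  shows "cinner (adjoint_op A x) y = cinner x (A y)"
  using cinner_adjoint[OF assms, of y x] by (metis cinner_commute)

lemma adjoint_eqI:
  fixes A B :: "'h::complex_hilbert_space \<Rightarrow>\<^sub>L 'h"
  assumes "A \<in> ops"
    and "\<And>x y. cinner (A x) y = cinner x (B y)"
  shows "adjoint_op A = B"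
  unfolding adjoint_op_def by (rule the1_equality[OF ex1_adjoint[OF assms(1)]]) (use assms in blast)

lemma adjoint_carrier:
  assumes "A \<in> ops"
  shows "adjoint_op A \<in> ops"
  unfolding ops_iff
  by (intro allI cinner_ext) (simp add: cinner_adjoint'[OF assms] cinner_scaleC_left)

lemma adjoint_adjoint:
  "A \<in> ops \<Longrightarrow> adjoint_op (adjoint_op A) = A"
  by (rule adjoint_eqI) (auto simp: adjoint_carrier cinner_adjoint')

lemma norm_sq_blinfun_adjoint:
  assumes A: "A \<in> ops"
  shows "(norm (A x))\<^sup>2 \<le> norm (adjoint_op A o\<^sub>L A) * (norm x)\<^sup>2"
proof -
  have "complex_of_real ((norm (A x))\<^sup>2) = cinner x ((adjoint_op A o\<^sub>L A) x)"
    unfolding cinner_norm[symmetric] by (simp add: cinner_adjoint[OF A])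
  then have "(norm (A x))\<^sup>2 = cmod (cinner x ((adjoint_op A o\<^sub>L A) x))"
    by (metis norm_of_real abs_of_nonneg zero_le_power2)
  also have "\<dots> \<le> norm x * norm ((adjoint_op A o\<^sub>L A) x)" by (rule Cauchy_Schwarz_cinner)
  also have "\<dots> \<le> norm x * (norm (adjoint_op A o\<^sub>L A) * norm x)"
    by (intro mult_left_mono norm_blinfun) simp
  finally show ?thesis by (simp add: power2_eq_square mult_ac)
qed

lemma norm_sq_le_adjoint_mult:
  assumes A: "A \<in> ops"
  shows "(norm A)\<^sup>2 \<le> norm (adjoint_op A o\<^sub>L A)"
proof -
  have "norm A \<le> sqrt (norm (adjoint_op A o\<^sub>L A))"
  proof (rule norm_blinfun_bound)
    show "norm (A x) \<le> sqrt (norm (adjoint_op A o\<^sub>L A)) * norm x" for x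
      using real_sqrt_le_mono[OF norm_sq_blinfun_adjoint[OF A, of x]]
      by (simp add: real_sqrt_mult)
  qed simp
  then have "(norm A)\<^sup>2 \<le> (sqrt (norm (adjoint_op A o\<^sub>L A)))\<^sup>2" by (rule power_mono) simp
  then show ?thesis by simp
qed

lemma norm_adjoint:
  assumes A: "A \<in> ops"
  shows "norm (adjoint_op A) = norm A"
proof -
  have le: "norm B \<le> norm (adjoint_op B)" if B: "B \<in> ops" for B :: "'a \<Rightarrow>\<^sub>L 'a"
  proof (cases "B = 0")
    case False
    have "norm B * norm B \<le> norm (adjoint_op B) * norm B"
      using norm_sq_le_adjoint_mult[OF B] norm_blinfun_compose[of "adjoint_op B" B]
      by (simp add: power2_eq_square)
    then show ?thesis using False by simp
  qed simp
  show ?thesis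
    using le[OF A] le[OF adjoint_carrier[OF A]] adjoint_adjoint[OF A] by simp
qed

lemma ring_class_ring: "ring (class_ring :: 'a::ring_1 ring)"
proof (rule ringI)
  show "abelian_group (class_ring :: 'a ring)"
  proof (rule abelian_groupI)
    fix x :: 'a
    show "\<exists>y\<in>carrier class_ring. y \<oplus>\<^bsub>class_ring\<^esub> x = \<zero>\<^bsub>class_ring\<^esub>"
      by (intro bexI[of _ "- x"]) (auto simp: class_ring_def)
  qed (auto simp: class_ring_def algebra_simps)
  show "Group.monoid (class_ring :: 'a ring)"
    by (rule monoidI) (auto simp: class_ring_def algebra_simps)
qed (auto simp: class_ring_def algebra_simps)

lemma cring_class_ring: "cring (class_ring :: 'a::comm_ring_1 ring)"
proof -
  interpret ring "class_ring :: 'a ring" by (rule ring_class_ring)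
  show ?thesis
    by (rule cringI[OF abelian_group_axioms])
       (auto intro!: comm_monoidI simp: class_ring_def algebra_simps)
qed

lemma cstar_algebra_bounded_operators:
  "cstar_algebra (bounded_operators :: ('h::complex_hilbert_space \<Rightarrow>\<^sub>L 'h) cstar)"
proof -
  let ?B = "bounded_operators :: ('h \<Rightarrow>\<^sub>L 'h) cstar"
  have ab: "abelian_group ?B"
  proof (rule abelian_groupI)
    fix x assume "x \<in> carrier ?B"
    then show "\<exists>y\<in>carrier ?B. y \<oplus>\<^bsub>?B\<^esub> x = \<zero>\<^bsub>?B\<^esub>"
      by (intro bexI[of _ "- x"]) (auto simp: ops_iff blinfun.minus_left)
  qed (auto simp: ops_iff blinfun.add_left scaleC_add_right algebra_simps)
  interpret A: ring ?B
  proof (rule ringI[OF ab])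
    show "Group.monoid ?B"
      by (rule monoidI) (auto simp: ops_iff intro!: blinfun_eqI)
  qed (auto simp: bounded_bilinear.add_left[OF bounded_bilinear_blinfun_compose]
       bounded_bilinear.add_right[OF bounded_bilinear_blinfun_compose])
  have minus: "x \<ominus>\<^bsub>?B\<^esub> y = x - y" if "x \<in> carrier ?B" "y \<in> carrier ?B" for x y
  proof -
    have "\<ominus>\<^bsub>?B\<^esub> y = - y"
      by (rule A.minus_equality) (use that in \<open>auto simp: ops_iff blinfun.minus_left\<close>)
    then show ?thesis by (simp add: a_minus_def)
  qed
  have smult: "c \<odot>\<^bsub>?B\<^esub> x \<in> carrier ?B" if "x \<in> carrier ?B" for c x
    using that by (simp add: ops_iff scaleC_scaleC mult.commute)
  interpret module "class_ring :: complex ring" ?B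
    by (rule moduleI[OF cring_class_ring ab])
       (auto simp: smult class_ring_def blinfun.add_left scaleC_add_left scaleC_add_right scaleC_scaleC
         intro!: blinfun_eqI)
  show ?thesis
  proof unfold_locales
    fix x y :: "'h \<Rightarrow>\<^sub>L 'h" and c :: complex
    assume x: "x \<in> carrier ?B"
    show "star ?B x \<in> carrier ?B" "star ?B (star ?B x) = x" "0 \<le> cnorm ?B x"
      "cnorm ?B x = 0 \<longleftrightarrow> x = \<zero>\<^bsub>?B\<^esub>"
      using x by (auto simp: adjoint_carrier adjoint_adjoint)
    show "star ?B (c \<odot>\<^bsub>?B\<^esub> x) = cnj c \<odot>\<^bsub>?B\<^esub> star ?B x"
      unfolding bounded_operators_sel
      by (rule adjoint_eqI) (use x in \<open>auto simp: smult cinner_scaleC_left cinner_scaleC_right cinner_adjoint\<close>)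
    show "cnorm ?B (c \<odot>\<^bsub>?B\<^esub> x) = cmod c * cnorm ?B x"
    proof (cases "c = 0")
      case True
      then have "c \<odot>\<^bsub>?B\<^esub> x = 0" by (intro blinfun_eqI) simp
      then show ?thesis using True by simp
    next
      case False
      have le: "norm (d \<odot>\<^bsub>?B\<^esub> z) \<le> cmod d * norm z" for d z
        by (rule norm_blinfun_bound) (auto simp: norm_blinfun mult.assoc mult_left_mono)
      have "x = (1 / c) \<odot>\<^bsub>?B\<^esub> (c \<odot>\<^bsub>?B\<^esub> x)"
        using False by (intro blinfun_eqI) (simp add: scaleC_scaleC)
      then have "norm x \<le> cmod (1 / c) * norm (c \<odot>\<^bsub>?B\<^esub> x)" using le by metis
      then show ?thesis using le[of c x] False by (simp add: norm_divide field_simps)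
    qed
    show "cnorm ?B (star ?B x \<otimes>\<^bsub>?B\<^esub> x) = (cnorm ?B x)\<^sup>2"
      using norm_sq_le_adjoint_mult[OF x] norm_blinfun_compose[of "adjoint_op x" x] norm_adjoint[OF x]
      by (simp add: power2_eq_square)
    assume y: "y \<in> carrier ?B"
    show "(c \<odot>\<^bsub>?B\<^esub> x) \<otimes>\<^bsub>?B\<^esub> y = c \<odot>\<^bsub>?B\<^esub> (x \<otimes>\<^bsub>?B\<^esub> y)"
      "x \<otimes>\<^bsub>?B\<^esub> (c \<odot>\<^bsub>?B\<^esub> y) = c \<odot>\<^bsub>?B\<^esub> (x \<otimes>\<^bsub>?B\<^esub> y)"
      using x by (auto intro!: blinfun_eqI simp: ops_iff)
    show "star ?B (x \<oplus>\<^bsub>?B\<^esub> y) = star ?B x \<oplus>\<^bsub>?B\<^esub> star ?B y"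
      unfolding bounded_operators_sel
      by (rule adjoint_eqI) (use A.a_closed[OF x y] x y in
        \<open>auto simp: blinfun.add_left cinner_add_left cinner_add_right cinner_adjoint\<close>)
    show "star ?B (x \<otimes>\<^bsub>?B\<^esub> y) = star ?B y \<otimes>\<^bsub>?B\<^esub> star ?B x"
      unfolding bounded_operators_sel
      by (rule adjoint_eqI) (use A.m_closed[OF x y] x y in \<open>auto simp: cinner_adjoint\<close>)
    show "cnorm ?B (x \<oplus>\<^bsub>?B\<^esub> y) \<le> cnorm ?B x + cnorm ?B y"
      "cnorm ?B (x \<otimes>\<^bsub>?B\<^esub> y) \<le> cnorm ?B x * cnorm ?B y"
      by (auto simp: norm_triangle_ineq norm_blinfun_compose)
  next
    fix X :: "nat \<Rightarrow> 'h \<Rightarrow>\<^sub>L 'h"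
    assume X: "\<And>n. X n \<in> carrier ?B"
      and C: "\<And>\<epsilon>. 0 < \<epsilon> \<Longrightarrow> \<exists>N. \<forall>m\<ge>N. \<forall>n\<ge>N. cnorm ?B (X m \<ominus>\<^bsub>?B\<^esub> X n) < \<epsilon>"
    have "Cauchy X"
      by (rule metric_CauchyI) (use C in \<open>simp add: minus[OF X X] dist_norm\<close>)
    then obtain L where L: "X \<longlonglongrightarrow> L" using Cauchy_convergent_iff convergent_def by blast
    have "L \<in> carrier ?B"
      unfolding ops_iff
    proof (intro allI)
      fix c x
      have "(\<lambda>n. X n (c *\<^sub>C x)) \<longlonglongrightarrow> L (c *\<^sub>C x)"
        by (intro tendsto_intros L)
      moreover have "(\<lambda>n. c *\<^sub>C X n x) \<longlonglongrightarrow> c *\<^sub>C L x"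
        by (intro bounded_linear.tendsto[OF bounded_linear_scaleC] tendsto_intros L)
      ultimately show "L (c *\<^sub>C x) = c *\<^sub>C L x"
        using X LIMSEQ_unique by (simp add: ops_iff) blast
    qed
    then show "\<exists>L\<in>carrier ?B. (\<lambda>n. cnorm ?B (X n \<ominus>\<^bsub>?B\<^esub> L)) \<longlonglongrightarrow> 0"
      using L by (intro bexI[of _ L]) (simp_all add: minus[OF X] tendsto_norm_zero_iff LIM_zero_iff)
  qed
qed

lemma minus_bounded_operators [simp]:
  assumes "x \<in> ops" "y \<in> ops"
  shows "x \<ominus>\<^bsub>bounded_operators\<^esub> y = x - y"
proof -
  interpret A: ring "bounded_operators :: ('a \<Rightarrow>\<^sub>L 'a) cstar"
    using cstar_algebra_bounded_operators by (rule cstar_algebra.axioms)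
  have "\<ominus>\<^bsub>bounded_operators\<^esub> y = - y"
    by (rule A.minus_equality) (use assms in \<open>auto simp: ops_iff blinfun.minus_left\<close>)
  then show ?thesis by (simp add: a_minus_def)
qed

section \<open>Subalgebras and quotients of C*-algebras\<close>

text \<open>
  The sequence \<open>r n\<close> consists of the complements \<open>1 - u n\<close> of a sequential approximate unit \<open>u n\<close>
  in the ideal; in this form right multiplication by them is contractive and preserves every coset.
\<close>

definition approximately_unital_ideal ::
    "('a, 'm) cstar_scheme \<Rightarrow> 'a set \<Rightarrow> (nat \<Rightarrow> 'a) \<Rightarrow> bool" where
  "approximately_unital_ideal A K r \<longleftrightarrow>
     ideal K A \<and> (\<forall>x\<in>K. star A x \<in> K) \<and>
     (\<forall>X. \<forall>L\<in>carrier A. (\<forall>n::nat. X n \<in> K) \<and>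
        (\<lambda>n. cnorm A (X n \<ominus>\<^bsub>A\<^esub> L)) \<longlonglongrightarrow> 0 \<longrightarrow> L \<in> K) \<and>
     (\<forall>n. r n \<in> carrier A \<and> \<one>\<^bsub>A\<^esub> \<ominus>\<^bsub>A\<^esub> r n \<in> K \<and> cnorm A (r n) \<le> 1) \<and>
     (\<forall>x\<in>K. (\<lambda>n. cnorm A (x \<otimes>\<^bsub>A\<^esub> r n)) \<longlonglongrightarrow> 0)"

context
  fixes A :: "('a, 'm) cstar_scheme" (structure)
  assumes cstar: "cstar_algebra A"
begin

interpretation A: ring A by (rule cstar_algebra.axioms(1)[OF cstar])
interpretation M: module "class_ring :: complex ring" A by (rule cstar_algebra.axioms(2)[OF cstar])
interpretation C: cstar_algebra A by (rule cstar)

lemma cstar_smult_closed [simp]: "x \<in> carrier A \<Longrightarrow> c \<odot>\<^bsub>A\<^esub> x \<in> carrier A"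
  using M.smult_closed[of c x] by (simp add: class_ring_def)

lemma cstar_smult_add_left:
  "x \<in> carrier A \<Longrightarrow> (b + c) \<odot>\<^bsub>A\<^esub> x = b \<odot>\<^bsub>A\<^esub> x \<oplus> c \<odot>\<^bsub>A\<^esub> x"
  using M.smult_l_distr[of b c x] by (simp add: class_ring_def)

lemma cstar_smult_add_right:
  "x \<in> carrier A \<Longrightarrow> y \<in> carrier A \<Longrightarrow> c \<odot>\<^bsub>A\<^esub> (x \<oplus> y) = c \<odot>\<^bsub>A\<^esub> x \<oplus> c \<odot>\<^bsub>A\<^esub> y"
  using M.smult_r_distr[of c x y] by (simp add: class_ring_def)

lemma cstar_smult_assoc: "x \<in> carrier A \<Longrightarrow> (b * c) \<odot>\<^bsub>A\<^esub> x = b \<odot>\<^bsub>A\<^esub> (c \<odot>\<^bsub>A\<^esub> x)"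
  using M.smult_assoc1[of b c x] by (simp add: class_ring_def)

lemma cstar_smult_one [simp]: "x \<in> carrier A \<Longrightarrow> 1 \<odot>\<^bsub>A\<^esub> x = x"
  using M.smult_one[of x] by (simp add: class_ring_def)

lemma cstar_smult_zero [simp]: "x \<in> carrier A \<Longrightarrow> 0 \<odot>\<^bsub>A\<^esub> x = \<zero>"
  using C.cnorm_smult[of x 0] C.cnorm_eq_0[of "0 \<odot>\<^bsub>A\<^esub> x"] by simp

lemma cstar_smult_minus_one: "x \<in> carrier A \<Longrightarrow> (- 1) \<odot>\<^bsub>A\<^esub> x = \<ominus> x"
  using cstar_smult_add_left[of x "- 1" 1] A.minus_equality[of "(- 1) \<odot>\<^bsub>A\<^esub> x" x] by simp

lemma cnorm_zero [simp]: "cnorm A \<zero> = 0"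
  using C.cnorm_eq_0 by simp

lemma cnorm_uminus [simp]: "x \<in> carrier A \<Longrightarrow> cnorm A (\<ominus> x) = cnorm A x"
  by (simp flip: cstar_smult_minus_one add: C.cnorm_smult)

lemma star_uminus: "x \<in> carrier A \<Longrightarrow> star A (\<ominus> x) = \<ominus> star A x"
  by (simp flip: cstar_smult_minus_one add: C.star_smult C.star_closed)

lemma star_diff:
  "x \<in> carrier A \<Longrightarrow> y \<in> carrier A \<Longrightarrow> star A (x \<ominus> y) = star A x \<ominus> star A y"
  by (simp add: A.minus_eq C.star_add star_uminus)

lemma cnorm_star [simp]:
  assumes x: "x \<in> carrier A"
  shows "cnorm A (star A x) = cnorm A x"
proof -
  have le: "cnorm A y \<le> cnorm A (star A y)" if y: "y \<in> carrier A" for y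
  proof (cases "cnorm A y = 0")
    case False
    have "cnorm A y * cnorm A y \<le> cnorm A (star A y) * cnorm A y"
      using C.cstar_identity[OF y] C.cnorm_mult[OF C.star_closed[OF y] y]
      by (simp add: power2_eq_square)
    then show ?thesis using False C.cnorm_nonneg[OF y] by simp
  qed (simp add: C.cnorm_nonneg C.star_closed y)
  show ?thesis using le[OF x] le[OF C.star_closed[OF x]] by (simp add: C.star_star x)
qed

lemma cnorm_diff_commute:
  "x \<in> carrier A \<Longrightarrow> y \<in> carrier A \<Longrightarrow> cnorm A (x \<ominus> y) = cnorm A (y \<ominus> x)"
  using cnorm_uminus[of "x \<ominus> y"] A.minus_add[of x "\<ominus> y"]
  by (simp add: A.minus_eq A.a_comm A.minus_minus)

lemma cnorm_diff_triangle:
  assumes "x \<in> carrier A" "y \<in> carrier A" "z \<in> carrier A"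
  shows "cnorm A (x \<ominus> z) \<le> cnorm A (x \<ominus> y) + cnorm A (y \<ominus> z)"
proof -
  have "x \<ominus> z = (x \<ominus> y) \<oplus> (y \<ominus> z)" using assms by algebra
  then show ?thesis using C.cnorm_triangle assms by simp
qed

lemma cstar_subalgebraI:
  assumes "B \<subseteq> carrier A" "\<one> \<in> B"
    and "\<And>x y. x \<in> B \<Longrightarrow> y \<in> B \<Longrightarrow> x \<oplus> y \<in> B"
    and "\<And>x y. x \<in> B \<Longrightarrow> y \<in> B \<Longrightarrow> x \<otimes> y \<in> B"
    and smult: "\<And>c x. x \<in> B \<Longrightarrow> c \<odot>\<^bsub>A\<^esub> x \<in> B"
    and "\<And>x. x \<in> B \<Longrightarrow> star A x \<in> B"
    and "\<And>X L. L \<in> carrier A \<Longrightarrow> (\<And>n::nat. X n \<in> B) \<Longrightarrow>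
      (\<lambda>n. cnorm A (X n \<ominus> L)) \<longlonglongrightarrow> 0 \<Longrightarrow> L \<in> B"
  shows "cstar_subalgebra A B"
proof -
  have "subring B A"
  proof (rule A.subringI)
    show "\<ominus> x \<in> B" if "x \<in> B" for x
      using smult[OF that, of "- 1"] cstar_smult_minus_one[of x] subsetD[OF assms(1) that] by simp
  qed (fact assms)+
  then show ?thesis
    unfolding cstar_subalgebra_def
  proof (intro conjI ballI allI impI)
    fix X :: "nat \<Rightarrow> 'a" and L
    assume "L \<in> carrier A" "(\<forall>n. X n \<in> B) \<and> (\<lambda>n. cnorm A (X n \<ominus> L)) \<longlonglongrightarrow> 0"
    then show "L \<in> B" by (intro assms(7)[of L X]) blast+
  qed (assumption | rule assms)+
qed

lemma cstar_subalgebra_carrier: "cstar_subalgebra A (carrier A)"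
  by (rule cstar_subalgebraI) (auto intro: C.star_closed)

lemma cstar_subalgebra_generated:
  assumes "S \<subseteq> carrier A"
  shows "cstar_subalgebra A (cstar_generated A S)"
proof -
  have ne: "{B. cstar_subalgebra A B \<and> S \<subseteq> B} \<noteq> {}" using cstar_subalgebra_carrier assms by blast
  have "subring (cstar_generated A S) A"
    unfolding cstar_generated_def
    by (rule A.subring_Inter[OF _ ne]) (simp add: cstar_subalgebra_def)
  then show ?thesis
    unfolding cstar_subalgebra_def cstar_generated_def by blast
qed

lemma a_minus_subring:
  assumes B: "subring B A" and xy: "x \<in> B" "y \<in> B"
  shows "x \<ominus>\<^bsub>A\<lparr>carrier := B\<rparr>\<^esub> y = x \<ominus> y"
proof -
  interpret B: ring "A\<lparr>carrier := B\<rparr>" by (rule A.subring_is_ring[OF B])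
  have "\<ominus>\<^bsub>A\<lparr>carrier := B\<rparr>\<^esub> y = \<ominus> y"
    by (rule B.minus_equality)
       (use subringE(1,5)[OF B] xy in \<open>auto simp: A.l_neg subset_iff\<close>)
  then show ?thesis by (simp add: a_minus_def)
qed

lemma cstar_algebra_subalgebra:
  assumes B: "cstar_subalgebra A B"
  shows "cstar_algebra (A\<lparr>carrier := B\<rparr>)"
proof -
  let ?B = "A\<lparr>carrier := B\<rparr>"
  have sub: "subring B A" and smult: "\<And>c x. x \<in> B \<Longrightarrow> c \<odot>\<^bsub>A\<^esub> x \<in> B"
    and star: "\<And>x. x \<in> B \<Longrightarrow> star A x \<in> B"
    and closed: "\<And>X L. L \<in> carrier A \<Longrightarrow> (\<And>n::nat. X n \<in> B) \<Longrightarrow>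
       (\<lambda>n. cnorm A (X n \<ominus> L)) \<longlonglongrightarrow> 0 \<Longrightarrow> L \<in> B"
    using B unfolding cstar_subalgebra_def by blast+
  have BA: "x \<in> carrier A" if "x \<in> B" for x using subringE(1)[OF sub] that by blast
  interpret B: ring ?B by (rule A.subring_is_ring[OF sub])
  interpret module "class_ring :: complex ring" ?B
    by (rule moduleI[OF cring_class_ring B.abelian_group_axioms])
       (use M.smult_l_distr M.smult_r_distr M.smult_assoc1 in \<open>auto simp: BA smult\<close>)
  show ?thesis
  proof unfold_locales
    fix X :: "nat \<Rightarrow> 'a"
    assume X: "\<And>n. X n \<in> carrier ?B"
      and Cau: "\<And>\<epsilon>. 0 < \<epsilon> \<Longrightarrow> \<exists>N. \<forall>m\<ge>N. \<forall>n\<ge>N. cnorm ?B (X m \<ominus>\<^bsub>?B\<^esub> X n) < \<epsilon>"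
    have "\<exists>L\<in>carrier A. (\<lambda>n. cnorm A (X n \<ominus> L)) \<longlonglongrightarrow> 0"
      by (rule C.complete) (use X Cau a_minus_subring[OF sub] in \<open>auto simp: BA\<close>)
    then obtain L where L: "L \<in> carrier A" "(\<lambda>n. cnorm A (X n \<ominus> L)) \<longlonglongrightarrow> 0" by blast
    then have "L \<in> B" using closed[of L X] X by auto
    then show "\<exists>L\<in>carrier ?B. (\<lambda>n. cnorm ?B (X n \<ominus>\<^bsub>?B\<^esub> L)) \<longlonglongrightarrow> 0"
      using L X by (intro bexI[of _ L]) (auto simp: a_minus_subring[OF sub])
  qed (simp_all add: BA star C.smult_mult_left C.smult_mult_right C.star_star C.star_add C.star_smult
      C.star_mult C.cnorm_nonneg C.cnorm_eq_0 C.cnorm_triangle C.cnorm_smult C.cnorm_mult C.cstar_identity)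
qed

context
  fixes K :: "'a set" and r :: "nat \<Rightarrow> 'a"
  assumes unital: "approximately_unital_ideal A K r"
begin

private abbreviation Q :: "'a set cstar" where
  "Q \<equiv> cstar_quotient A K"

private abbreviation q :: "'a \<Rightarrow> real" where
  "q x \<equiv> cnorm Q (K +> x)"

lemma ideal_K: "ideal K A"
  and K_star: "x \<in> K \<Longrightarrow> star A x \<in> K"
  and K_closed: "L \<in> carrier A \<Longrightarrow> (\<And>n::nat. X n \<in> K) \<Longrightarrow>
    (\<lambda>n. cnorm A (X n \<ominus> L)) \<longlonglongrightarrow> 0 \<Longrightarrow> L \<in> K"
  and r: "r n \<in> carrier A" "\<one> \<ominus> r n \<in> K" "cnorm A (r n) \<le> 1"
    "x \<in> K \<Longrightarrow> (\<lambda>n. cnorm A (x \<otimes> r n)) \<longlonglongrightarrow> 0"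
  using unital unfolding approximately_unital_ideal_def by blast+

interpretation K: ideal K A by (rule ideal_K)

lemma K_carrier: "x \<in> K \<Longrightarrow> x \<in> carrier A" by (rule K.a_Hcarr)

lemma coset_eq_iff: "x \<in> carrier A \<Longrightarrow> y \<in> carrier A \<Longrightarrow> K +> x = K +> y \<longleftrightarrow> x \<ominus> y \<in> K"
  using A.quotient_eq_iff_same_a_r_cos[OF ideal_K] by simp

lemma mem_coset:
  assumes x: "x \<in> carrier A"
  shows "y \<in> K +> x \<longleftrightarrow> y \<in> carrier A \<and> K +> y = K +> x"
proof
  assume y: "y \<in> K +> x"
  show "y \<in> carrier A \<and> K +> y = K +> x"
    using A.a_r_coset_subset_G[OF K.a_subset x] A.a_repr_independence[OF y x K.a_subgroup] y by auto
next
  assume "y \<in> carrier A \<and> K +> y = K +> x"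
  then show "y \<in> K +> x" using K.a_rcos_self[of y] by auto
qed

lemma coset_eq_ideal_iff:
  assumes x: "x \<in> carrier A"
  shows "K +> x = K \<longleftrightarrow> x \<in> K"
  using A.a_coset_join2[OF x K.a_subgroup] K.a_rcos_self[OF x] by auto

lemma K_smult: "x \<in> K \<Longrightarrow> c \<odot>\<^bsub>A\<^esub> x \<in> K"
  using C.smult_mult_left[of \<one> x c] K.I_l_closed[of x "c \<odot>\<^bsub>A\<^esub> \<one>"]
  by (simp add: K_carrier)

lemma carrier_quotient: "carrier (Q) = (+>) K ` carrier A"
  by (auto simp: cstar_quotient_def FactRing_simps)

lemma quotient_sel:
  assumes x: "x \<in> carrier A"
  shows "c \<odot>\<^bsub>Q\<^esub> (K +> x) = K +> (c \<odot>\<^bsub>A\<^esub> x)"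
    and "star Q (K +> x) = K +> star A x"
    and "q x = (INF y\<in>K +> x. cnorm A y)"
    and "y \<in> carrier A \<Longrightarrow> (K +> x) \<otimes>\<^bsub>Q\<^esub> (K +> y) = K +> (x \<otimes> y)"
    and "y \<in> carrier A \<Longrightarrow> (K +> x) \<oplus>\<^bsub>Q\<^esub> (K +> y) = K +> (x \<oplus> y)"
    and "one Q = K +> \<one>"
    and "zero Q = K"
proof -
  have "K +> (c \<odot>\<^bsub>A\<^esub> y) = K +> (c \<odot>\<^bsub>A\<^esub> x)" if "y \<in> K +> x" for y
  proof -
    have y: "y \<in> carrier A" "y \<ominus> x \<in> K" using that x by (auto simp: mem_coset coset_eq_iff)
    have "c \<odot>\<^bsub>A\<^esub> y \<ominus> c \<odot>\<^bsub>A\<^esub> x = c \<odot>\<^bsub>A\<^esub> (y \<ominus> x)"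
      using x y by (simp add: A.minus_eq cstar_smult_add_right flip: cstar_smult_minus_one cstar_smult_assoc)
    then show ?thesis using K_smult[OF y(2)] x y(1) by (simp add: coset_eq_iff)
  qed
  then have "(\<Union>y\<in>K +> x. K +> (c \<odot>\<^bsub>A\<^esub> y)) = K +> (c \<odot>\<^bsub>A\<^esub> x)"
    using K.a_rcos_self[OF x] by blast
  then show "c \<odot>\<^bsub>Q\<^esub> (K +> x) = K +> (c \<odot>\<^bsub>A\<^esub> x)"
    by (simp add: cstar_quotient_def)
  have "K +> star A y = K +> star A x" if "y \<in> K +> x" for y
  proof -
    have y: "y \<in> carrier A" "y \<ominus> x \<in> K" using that x by (auto simp: mem_coset coset_eq_iff)
    then show ?thesis using K_star[OF y(2)] x by (simp add: coset_eq_iff star_diff C.star_closed)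
  qed
  then have "(\<Union>y\<in>K +> x. K +> star A y) = K +> star A x"
    using K.a_rcos_self[OF x] by blast
  then show "star Q (K +> x) = K +> star A x"
    by (simp add: cstar_quotient_def)
qed (use x in \<open>auto simp: cstar_quotient_def FactRing_simps K.rcoset_mult_add K.a_rcos_sum\<close>)

lemma quotient_norm_le: "x \<in> carrier A \<Longrightarrow> q x \<le> cnorm A x"
  unfolding quotient_sel
  by (rule cINF_lower) (auto simp: K.a_rcos_self mem_coset intro!: bdd_belowI2[where m = 0] C.cnorm_nonneg)

lemma quotient_norm_approx:
  assumes x: "x \<in> carrier A"
    and lt: "q x < e"
  shows "\<exists>y\<in>carrier A. K +> y = K +> x \<and> cnorm A y < e"
proof -
  have "Inf (cnorm A ` (K +> x)) < e" using lt x by (simp add: quotient_sel)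
  then obtain y where "y \<in> K +> x" "cnorm A y < e"
    using cInf_lessD[of "cnorm A ` (K +> x)" e] K.a_rcos_self[OF x] by auto
  then show ?thesis using x by (auto simp: mem_coset)
qed

lemma quotient_norm_nonneg: "x \<in> carrier A \<Longrightarrow> 0 \<le> q x"
  using quotient_norm_approx[of x 0] C.cnorm_nonneg by (meson not_le)

text \<open>
  Norm inequalities pass from the algebra to the quotient by taking limits along such sequences
  of representatives.
\<close>

lemma quotient_norm_sequence:
  assumes x: "x \<in> carrier A"
  obtains Y where "\<And>n::nat. Y n \<in> carrier A" "\<And>n. K +> Y n = K +> x"
    "(\<lambda>n. cnorm A (Y n)) \<longlonglongrightarrow> q x"
proof -
  let ?q = "q x"
  have "\<exists>y\<in>carrier A. K +> y = K +> x \<and> cnorm A y < ?q + inverse (real (Suc n))" for n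
    by (rule quotient_norm_approx[OF x]) simp
  then obtain Y where Y: "\<And>n. Y n \<in> carrier A" "\<And>n. K +> Y n = K +> x"
    "\<And>n. cnorm A (Y n) < ?q + inverse (real (Suc n))" by metis
  have "(\<lambda>n. cnorm A (Y n)) \<longlonglongrightarrow> ?q"
  proof (rule tendsto_sandwich)
    show "\<forall>\<^sub>F n in sequentially. ?q \<le> cnorm A (Y n)"
      using quotient_norm_le[OF Y(1)] by (simp add: Y(2))
    show "\<forall>\<^sub>F n in sequentially. cnorm A (Y n) \<le> ?q + inverse (real (Suc n))"
      by (intro always_eventually allI less_imp_le Y(3))
    show "(\<lambda>n. ?q) \<longlonglongrightarrow> ?q" by simp
    show "(\<lambda>n. ?q + inverse (real (Suc n))) \<longlonglongrightarrow> ?q"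
      using tendsto_add[OF tendsto_const LIMSEQ_inverse_real_of_nat] by simp
  qed
  with Y that show ?thesis by blast
qed


lemma zero_quotient: "\<zero>\<^bsub>Q\<^esub> = K +> \<zero>"
  using quotient_sel(7)[OF A.zero_closed] coset_eq_ideal_iff[OF A.zero_closed] K.zero_closed
  by simp

lemma quotient_norm_add:
  assumes x: "x \<in> carrier A" and y: "y \<in> carrier A"
  shows "q (x \<oplus> y)
    \<le> q x + q y"
proof -
  obtain X where X: "\<And>n::nat. X n \<in> carrier A" "\<And>n. K +> X n = K +> x"
    "(\<lambda>n. cnorm A (X n)) \<longlonglongrightarrow> q x"
    using quotient_norm_sequence[OF x] by blast
  obtain Y where Y: "\<And>n::nat. Y n \<in> carrier A" "\<And>n. K +> Y n = K +> y"
    "(\<lambda>n. cnorm A (Y n)) \<longlonglongrightarrow> q y"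
    using quotient_norm_sequence[OF y] by blast
  have "K +> (x \<oplus> y) = K +> (X n \<oplus> Y n)" for n
    using K.a_rcos_sum[OF x y] K.a_rcos_sum[OF X(1) Y(1)] by (simp add: X(2) Y(2))
  then have "q (x \<oplus> y) \<le> cnorm A (X n) + cnorm A (Y n)" for n
    using order_trans[OF quotient_norm_le[of "X n \<oplus> Y n"] C.cnorm_triangle[OF X(1) Y(1)]] X(1) Y(1) by simp
  then show ?thesis
    by (intro LIMSEQ_le_const[OF tendsto_add[OF X(3) Y(3)]]) blast
qed

lemma quotient_norm_mult:
  assumes x: "x \<in> carrier A" and y: "y \<in> carrier A"
  shows "q (x \<otimes> y)
    \<le> q x * q y"
proof -
  obtain X where X: "\<And>n::nat. X n \<in> carrier A" "\<And>n. K +> X n = K +> x"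
    "(\<lambda>n. cnorm A (X n)) \<longlonglongrightarrow> q x"
    using quotient_norm_sequence[OF x] by blast
  obtain Y where Y: "\<And>n::nat. Y n \<in> carrier A" "\<And>n. K +> Y n = K +> y"
    "(\<lambda>n. cnorm A (Y n)) \<longlonglongrightarrow> q y"
    using quotient_norm_sequence[OF y] by blast
  have "K +> (x \<otimes> y) = K +> (X n \<otimes> Y n)" for n
    using K.rcoset_mult_add[OF x y] K.rcoset_mult_add[OF X(1) Y(1)] by (simp add: X(2) Y(2))
  then have "q (x \<otimes> y) \<le> cnorm A (X n) * cnorm A (Y n)" for n
    using order_trans[OF quotient_norm_le[of "X n \<otimes> Y n"] C.cnorm_mult[OF X(1) Y(1)]] X(1) Y(1) by simp
  then show ?thesis
    by (intro LIMSEQ_le_const[OF tendsto_mult[OF X(3) Y(3)]]) blast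
qed

lemma quotient_norm_smult_le:
  assumes x: "x \<in> carrier A"
  shows "q (c \<odot>\<^bsub>A\<^esub> x)
    \<le> cmod c * q x"
proof -
  obtain X where X: "\<And>n::nat. X n \<in> carrier A" "\<And>n. K +> X n = K +> x"
    "(\<lambda>n. cnorm A (X n)) \<longlonglongrightarrow> q x"
    using quotient_norm_sequence[OF x] by blast
  have "K +> (c \<odot>\<^bsub>A\<^esub> x) = K +> (c \<odot>\<^bsub>A\<^esub> X n)" for n
    using quotient_sel(1)[OF x, of c] quotient_sel(1)[OF X(1), of c n] by (simp add: X(2))
  then have "q (c \<odot>\<^bsub>A\<^esub> x) \<le> cmod c * cnorm A (X n)" for n
    using quotient_norm_le[of "c \<odot>\<^bsub>A\<^esub> X n"] C.cnorm_smult[OF X(1), of c n] X(1) by simp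
  then show ?thesis
    by (intro LIMSEQ_le_const[OF tendsto_mult[OF tendsto_const X(3)]]) blast
qed

lemma quotient_norm_eq_0:
  assumes x: "x \<in> carrier A"
  shows "q x = 0 \<longleftrightarrow> K +> x = K +> \<zero>"
proof
  assume 0: "q x = 0"
  obtain X where X: "\<And>n::nat. X n \<in> carrier A" "\<And>n. K +> X n = K +> x"
    "(\<lambda>n. cnorm A (X n)) \<longlonglongrightarrow> q x"
    using quotient_norm_sequence[OF x] by blast
  have "(x \<ominus> X n) \<ominus> x = \<ominus> X n" for n using x X(1)[of n] by algebra
  then have "(\<lambda>n. cnorm A ((x \<ominus> X n) \<ominus> x)) \<longlonglongrightarrow> 0" using X 0 by simp
  moreover have "x \<ominus> X n \<in> K" for n using coset_eq_iff[OF x X(1)] X(2) by simp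
  ultimately have "x \<in> K" using K_closed[OF x, of "\<lambda>n. x \<ominus> X n"] by simp
  then show "K +> x = K +> \<zero>" using x by (simp add: coset_eq_iff A.minus_eq)
next
  assume "K +> x = K +> \<zero>"
  then show "q x = 0"
    using quotient_norm_le[of \<zero>] quotient_norm_nonneg[of \<zero>] by simp
qed

lemma quotient_norm_star_le:
  assumes x: "x \<in> carrier A"
  shows "q (star A x) \<le> q x"
proof -
  obtain X where X: "\<And>n::nat. X n \<in> carrier A" "\<And>n. K +> X n = K +> x"
    "(\<lambda>n. cnorm A (X n)) \<longlonglongrightarrow> q x"
    using quotient_norm_sequence[OF x] by blast
  have "K +> star A x = K +> star A (X n)" for n
    using quotient_sel(2)[OF x] quotient_sel(2)[OF X(1), of n] by (simp add: X(2))
  then have "q (star A x) \<le> cnorm A (X n)" for n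
    using quotient_norm_le[of "star A (X n)"] X(1) by (simp add: C.star_closed)
  then show ?thesis by (intro LIMSEQ_le_const[OF X(3)]) blast
qed

text \<open>
  The C*-identity is where the approximate unit enters. Multiplying a representative
  \<open>x\<^sup>* x + k\<close> by \<open>r n\<close> on both sides does not increase its norm; it turns \<open>x\<^sup>* x\<close> into the
  square of a representative of the coset of \<open>x\<close> and makes \<open>k\<close> disappear in the limit.
\<close>

lemma quotient_cstar_identity:
  assumes x: "x \<in> carrier A"
  shows "q (star A x \<otimes> x)
    = (q x)\<^sup>2"
proof (rule antisym)
    have "q (star A x \<otimes> x) \<le> q (star A x) * q x"
    by (rule quotient_norm_mult) (simp_all add: x C.star_closed)
  also have "\<dots> \<le> q x * q x"
    by (intro mult_right_mono quotient_norm_star_le quotient_norm_nonneg x)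
  finally show "q (star A x \<otimes> x) \<le> (q x)\<^sup>2" by (simp add: power2_eq_square)
  have sx: "star A x \<in> carrier A" by (rule C.star_closed[OF x])
  obtain Y where Y: "\<And>n::nat. Y n \<in> carrier A" "\<And>n. K +> Y n = K +> (star A x \<otimes> x)"
    "(\<lambda>n. cnorm A (Y n)) \<longlonglongrightarrow> q (star A x \<otimes> x)"
    using quotient_norm_sequence[of "star A x \<otimes> x"] sx x by auto
  have "(q x)\<^sup>2 \<le> cnorm A (Y m)" for m
  proof -
    define k where "k = star A x \<otimes> x \<ominus> Y m"
    have k: "k \<in> K" using coset_eq_iff[of "star A x \<otimes> x" "Y m"] Y(1,2) sx x by (simp add: k_def)
    have "(q x)\<^sup>2 \<le> cnorm A (Y m) + cnorm A (k \<otimes> r n)" for n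
    proof -
      note rn = r(1)[of n] C.star_closed[OF r(1)[of n]]
      have contr: "cnorm A (star A (r n) \<otimes> z) \<le> cnorm A z" "cnorm A (z \<otimes> r n) \<le> cnorm A z"
        if z: "z \<in> carrier A" for z
        using C.cnorm_mult[OF rn(2) z] C.cnorm_mult[OF z rn(1)] r(3)[of n] C.cnorm_nonneg[OF z]
          mult_right_mono[of "cnorm A (r n)" 1 "cnorm A z"] mult_left_mono[of "cnorm A (r n)" 1 "cnorm A z"]
        by (simp_all add: rn)
      have "x \<ominus> x \<otimes> r n = x \<otimes> (\<one> \<ominus> r n)"
        using x rn(1) by (simp add: A.minus_eq A.r_distr A.r_minus)
      then have "x \<ominus> x \<otimes> r n \<in> K" using K.I_l_closed[OF r(2) x, of n] by simp
      then have "K +> (x \<otimes> r n) = K +> x" using coset_eq_iff[OF x, of "x \<otimes> r n"] x rn by simp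
      then have "q x \<le> cnorm A (x \<otimes> r n)" using quotient_norm_le[of "x \<otimes> r n"] x rn by simp
      then have "(q x)\<^sup>2 \<le> (cnorm A (x \<otimes> r n))\<^sup>2"
        by (rule power_mono) (rule quotient_norm_nonneg[OF x])
      also have "\<dots> = cnorm A (star A (r n) \<otimes> ((star A x \<otimes> x) \<otimes> r n))"
        using x sx rn by (simp flip: C.cstar_identity add: C.star_mult A.m_assoc)
      also have "(star A x \<otimes> x) \<otimes> r n = Y m \<otimes> r n \<oplus> k \<otimes> r n"
      proof -
        have "star A x \<otimes> x = Y m \<oplus> k" unfolding k_def using x sx Y(1)[of m] by algebra
        then show ?thesis using Y(1) rn k by (simp add: A.l_distr K_carrier)
      qed
      also have "cnorm A (star A (r n) \<otimes> (Y m \<otimes> r n \<oplus> k \<otimes> r n)) \<le> cnorm A (Y m \<otimes> r n \<oplus> k \<otimes> r n)"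
        using Y(1) rn k by (intro contr) (simp add: K_carrier)
      also have "\<dots> \<le> cnorm A (Y m \<otimes> r n) + cnorm A (k \<otimes> r n)"
        using Y(1) rn k by (intro C.cnorm_triangle) (simp_all add: K_carrier)
      also have "cnorm A (Y m \<otimes> r n) \<le> cnorm A (Y m)" by (rule contr) (rule Y)
      finally show ?thesis by simp
    qed
    then show ?thesis
      using tendsto_add[OF tendsto_const r(4)[OF k], of "cnorm A (Y m)"]
      by (intro LIMSEQ_le_const[where a = "(q x)\<^sup>2"]) auto
  qed
  then show "(q x)\<^sup>2 \<le> q (star A x \<otimes> x)"
    by (intro LIMSEQ_le_const[OF Y(3)]) blast
qed

text \<open>
  A subsequence with summable distances is lifted term by term, the norm of each new difference being
  controlled by the choice of its representative. The lifted sequence is Cauchy in the algebra.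
\<close>

lemma quotient_complete:
  assumes Y: "\<And>n::nat. Y n \<in> carrier A"
    and Cau: "\<And>e. 0 < e \<Longrightarrow> \<exists>N. \<forall>m\<ge>N. \<forall>n\<ge>N. q (Y m \<ominus> Y n) < e"
  shows "\<exists>L\<in>carrier A. (\<lambda>n. q (Y n \<ominus> L)) \<longlonglongrightarrow> 0"
proof -
    have "\<exists>N. \<forall>m\<ge>N. \<forall>n\<ge>N. q (Y m \<ominus> Y n) < (1/2) ^ j" for j
    by (rule Cau) simp
  then obtain N where N: "\<And>j m n. m \<ge> N j \<Longrightarrow> n \<ge> N j \<Longrightarrow> q (Y m \<ominus> Y n) < (1/2) ^ j"
    by metis
  \<comment> \<open>Partial sums make the thresholds \<open>N j\<close> monotone.\<close>
  define M where "M j = (\<Sum>i\<le>j. N i)" for j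
  have M1: "N j \<le> M j" for j
    unfolding M_def by (rule member_le_sum) auto
  have M: "N j \<le> M j" "N j \<le> M (Suc j)" for j
    using M1[of j] by (auto simp: M_def)
  have "\<exists>d\<in>carrier A. K +> d = K +> (Y (M (Suc j)) \<ominus> Y (M j)) \<and> cnorm A d < (1/2) ^ j" for j
    by (rule quotient_norm_approx[OF _ N[OF M(2) M(1)]]) (simp add: Y)
  then obtain d where d: "\<And>j. d j \<in> carrier A"
    "\<And>j. K +> d j = K +> (Y (M (Suc j)) \<ominus> Y (M j))" "\<And>j. cnorm A (d j) < (1/2) ^ j"
    by metis
  define a where "a = rec_nat (Y (M 0)) (\<lambda>j b. b \<oplus> d j)"
  have a_Suc: "a (Suc j) = a j \<oplus> d j" and a_0: "a 0 = Y (M 0)" for j by (simp_all add: a_def)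
  have a: "a j \<in> carrier A" for j by (induction j) (simp_all add: a_Suc a_0 Y d)
  have a_coset: "K +> a j = K +> Y (M j)" for j
  proof (induction j)
    case (Suc j)
    have "K +> a (Suc j) = K +> (Y (M j) \<oplus> (Y (M (Suc j)) \<ominus> Y (M j)))"
      unfolding a_Suc using K.a_rcos_sum[OF a d(1), of j j] K.a_rcos_sum[of "Y (M j)" "Y (M (Suc j)) \<ominus> Y (M j)"]
      by (simp add: Suc d(2) Y)
    also have "Y (M j) \<oplus> (Y (M (Suc j)) \<ominus> Y (M j)) = Y (M (Suc j))"
      using Y[of "M j"] Y[of "M (Suc j)"] by algebra
    finally show ?case .
  qed (simp add: a_0)
  have a_diff: "cnorm A (a (j + i) \<ominus> a j) \<le> 2 * (1/2) ^ j - 2 * (1/2) ^ (j + i)" for i j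
  proof (induction i)
    case (Suc i)
    have "a (Suc (j + i)) \<ominus> a j = (a (j + i) \<ominus> a j) \<oplus> d (j + i)"
      unfolding a_Suc using a[of "j + i"] a[of j] d(1)[of "j + i"] by algebra
    then have "cnorm A (a (Suc (j + i)) \<ominus> a j) \<le> cnorm A (a (j + i) \<ominus> a j) + cnorm A (d (j + i))"
      using C.cnorm_triangle[of "a (j + i) \<ominus> a j" "d (j + i)"] a d(1) by simp
    then show ?case using Suc d(3)[of "j + i"] by simp
  qed (simp add: A.minus_eq A.r_neg a)
  have small: "\<exists>j. (1/2) ^ j < e" if "0 < e" for e :: real
    using real_arch_pow_inv[OF that, of "1/2"] by simp
  have "\<exists>L\<in>carrier A. (\<lambda>n. cnorm A (a n \<ominus> L)) \<longlonglongrightarrow> 0"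
  proof (rule C.complete[OF a])
    fix e :: real assume "0 < e"
    then obtain j where j: "(1/2) ^ j < e / 4" using small[of "e / 4"] by auto
    have near: "cnorm A (a m \<ominus> a j) < e / 2" if "m \<ge> j" for m
    proof -
      have "cnorm A (a m \<ominus> a j) \<le> 2 * (1/2) ^ j - 2 * (1/2) ^ m"
        using a_diff[of j "m - j"] that by simp
      moreover have "0 < (1/2::real) ^ m" by simp
      ultimately show ?thesis using j by linarith
    qed
    have "cnorm A (a m \<ominus> a n) < e" if "m \<ge> j" "n \<ge> j" for m n
      using near[OF that(1)] near[OF that(2)] cnorm_diff_triangle[OF a[of m] a[of j] a[of n]]
        cnorm_diff_commute[OF a[of j] a[of n]] by linarith
    then show "\<exists>N. \<forall>m\<ge>N. \<forall>n\<ge>N. cnorm A (a m \<ominus> a n) < e" by blast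
  qed
  then obtain L where L: "L \<in> carrier A" "(\<lambda>n. cnorm A (a n \<ominus> L)) \<longlonglongrightarrow> 0" by blast
  have "(\<lambda>n. q (Y n \<ominus> L)) \<longlonglongrightarrow> 0"
  proof (rule LIMSEQ_I)
    fix e :: real assume e: "0 < e"
    obtain j0 where j0: "(1/2) ^ j0 < e / 2" using small[of "e / 2"] e by auto
    obtain j1 where "\<forall>j\<ge>j1. norm (cnorm A (a j \<ominus> L) - 0) < e / 2"
      using LIMSEQ_D[OF L(2) half_gt_zero[OF e]] by blast
    then have j1: "cnorm A (a j \<ominus> L) < e / 2" if "j \<ge> j1" for j
      using that unfolding diff_0_right real_norm_def abs_less_iff by blast
    define j where "j = max j0 j1"
    have j: "(1/2) ^ j < e / 2"
    proof (rule le_less_trans[OF _ j0])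
      show "(1/2) ^ j \<le> (1/2::real) ^ j0" by (rule power_decreasing) (simp_all add: j_def)
    qed
    have "q (Y n \<ominus> L) < e" if n: "n \<ge> N j" for n
    proof -
      have cl: "Y n \<ominus> Y (M j) \<in> carrier A" "Y (M j) \<ominus> L \<in> carrier A" "a j \<ominus> L \<in> carrier A"
        using Y L(1) a by simp_all
      have "Y n \<ominus> L = (Y n \<ominus> Y (M j)) \<oplus> (Y (M j) \<ominus> L)"
        using Y[of n] Y[of "M j"] L(1) by algebra
      then have "q (Y n \<ominus> L) \<le> q (Y n \<ominus> Y (M j)) + q (Y (M j) \<ominus> L)"
        using quotient_norm_add[OF cl(1,2)] by simp
      moreover have "q (Y (M j) \<ominus> L) \<le> cnorm A (a j \<ominus> L)"
      proof -
        have "K +> (Y (M j) \<ominus> L) = K +> (a j \<ominus> L)"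
          using K.a_rcos_sum[of "Y (M j)" "\<ominus> L"] K.a_rcos_sum[of "a j" "\<ominus> L"] Y L(1) a
          by (simp add: A.minus_eq a_coset)
        then show ?thesis using quotient_norm_le[OF cl(3)] by simp
      qed
      moreover have "cnorm A (a j \<ominus> L) < e / 2" by (rule j1) (simp add: j_def)
      ultimately show ?thesis using N[OF n M(1)] j by linarith
    qed
    moreover have "norm (q (Y n \<ominus> L) - 0) = q (Y n \<ominus> L)" for n
      using quotient_norm_nonneg[of "Y n \<ominus> L"] Y L(1) by simp
    ultimately show "\<exists>no. \<forall>n\<ge>no. norm (q (Y n \<ominus> L) - 0) < e" by metis
  qed
  then show ?thesis using L(1) by blast
qed

lemma quotient_minus:
  assumes R: "ring Q" and x: "x \<in> carrier A" and y: "y \<in> carrier A"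
  shows "(K +> x) \<ominus>\<^bsub>Q\<^esub> (K +> y) = K +> (x \<ominus> y)"
proof -
  interpret Q: ring "Q" by (rule R)
  have "\<ominus>\<^bsub>Q\<^esub> (K +> y) = K +> (\<ominus> y)"
    by (rule Q.minus_equality)
       (use y in \<open>auto simp: carrier_quotient quotient_sel(5) zero_quotient A.l_neg\<close>)
  then show ?thesis using x y by (simp add: a_minus_def quotient_sel(5))
qed

lemma ring_quotient: "ring Q"
proof (rule ringI)
  let ?Q = Q
  show "abelian_group ?Q"
  proof (rule abelian_groupI)
    fix X assume "X \<in> carrier ?Q"
    then obtain x where x: "x \<in> carrier A" "X = K +> x" by (auto simp: carrier_quotient)
    then show "\<exists>Y\<in>carrier ?Q. Y \<oplus>\<^bsub>?Q\<^esub> X = \<zero>\<^bsub>?Q\<^esub>"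
      by (intro bexI[of _ "K +> (\<ominus> x)"])
         (auto simp: carrier_quotient quotient_sel(5) zero_quotient A.l_neg)
  qed (auto simp: carrier_quotient quotient_sel(5) zero_quotient A.a_ac)
  show "Group.monoid ?Q"
    by (rule monoidI)
       (auto simp: carrier_quotient quotient_sel(4) quotient_sel(6)[OF A.zero_closed] A.m_assoc)
  fix X Y Z assume "X \<in> carrier ?Q" "Y \<in> carrier ?Q" "Z \<in> carrier ?Q"
  then obtain x y z where xyz: "x \<in> carrier A" "y \<in> carrier A" "z \<in> carrier A"
    and X: "X = K +> x" "Y = K +> y" "Z = K +> z" by (auto simp: carrier_quotient)
  show "(X \<oplus>\<^bsub>?Q\<^esub> Y) \<otimes>\<^bsub>?Q\<^esub> Z = X \<otimes>\<^bsub>?Q\<^esub> Z \<oplus>\<^bsub>?Q\<^esub> Y \<otimes>\<^bsub>?Q\<^esub> Z"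
    "Z \<otimes>\<^bsub>?Q\<^esub> (X \<oplus>\<^bsub>?Q\<^esub> Y) = Z \<otimes>\<^bsub>?Q\<^esub> X \<oplus>\<^bsub>?Q\<^esub> Z \<otimes>\<^bsub>?Q\<^esub> Y"
    using xyz by (simp_all add: X quotient_sel(4,5) A.l_distr A.r_distr)
qed

theorem cstar_algebra_quotient: "cstar_algebra Q"
proof -
  let ?Q = Q
  interpret Q: ring ?Q by (rule ring_quotient)
  interpret module "class_ring :: complex ring" ?Q
    by (rule moduleI[OF cring_class_ring Q.abelian_group_axioms])
       (auto simp: carrier_quotient quotient_sel(1,5) class_ring_def
         cstar_smult_add_left cstar_smult_add_right cstar_smult_assoc)
  show ?thesis
  proof unfold_locales
    fix X assume "X \<in> carrier ?Q"
    then obtain x where x: "x \<in> carrier A" and X: "X = K +> x" by (auto simp: carrier_quotient)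
    have sx: "star A x \<in> carrier A" by (rule C.star_closed[OF x])
    show "star ?Q X \<in> carrier ?Q" "star ?Q (star ?Q X) = X"
      "star ?Q (c \<odot>\<^bsub>?Q\<^esub> X) = cnj c \<odot>\<^bsub>?Q\<^esub> star ?Q X" for c
      using x sx by (simp_all add: X quotient_sel(1,2) carrier_quotient C.star_star C.star_smult)
    show "0 \<le> cnorm ?Q X" by (simp add: X quotient_norm_nonneg[OF x])
    show "cnorm ?Q X = 0 \<longleftrightarrow> X = \<zero>\<^bsub>?Q\<^esub>"
      by (simp add: X quotient_norm_eq_0[OF x] zero_quotient)
    show "cnorm ?Q (star ?Q X \<otimes>\<^bsub>?Q\<^esub> X) = (cnorm ?Q X)\<^sup>2"
      using quotient_cstar_identity[OF x] x sx by (simp add: X quotient_sel(2,4))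
    show "cnorm ?Q (c \<odot>\<^bsub>?Q\<^esub> X) = cmod c * cnorm ?Q X" for c
    proof (cases "c = 0")
      case True
      then show ?thesis using quotient_norm_eq_0[OF A.zero_closed] x X by (simp add: quotient_sel(1))
    next
      case False
      then have "cnorm ?Q (K +> x) \<le> cmod (1 / c) * cnorm ?Q (K +> (c \<odot>\<^bsub>A\<^esub> x))"
        using quotient_norm_smult_le[of "c \<odot>\<^bsub>A\<^esub> x" "1 / c"] x
        by (simp flip: cstar_smult_assoc)
      then have "cmod c * cnorm ?Q (K +> x) \<le> cnorm ?Q (K +> (c \<odot>\<^bsub>A\<^esub> x))"
        using False by (simp add: norm_divide field_simps)
      then show ?thesis
        using quotient_norm_smult_le[OF x, of c] x X by (simp add: quotient_sel(1))
    qed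
    fix Y assume "Y \<in> carrier ?Q"
    then obtain y where y: "y \<in> carrier A" and Y: "Y = K +> y" by (auto simp: carrier_quotient)
    have sy: "star A y \<in> carrier A" by (rule C.star_closed[OF y])
    show "(c \<odot>\<^bsub>?Q\<^esub> X) \<otimes>\<^bsub>?Q\<^esub> Y = c \<odot>\<^bsub>?Q\<^esub> (X \<otimes>\<^bsub>?Q\<^esub> Y)"
      "X \<otimes>\<^bsub>?Q\<^esub> (c \<odot>\<^bsub>?Q\<^esub> Y) = c \<odot>\<^bsub>?Q\<^esub> (X \<otimes>\<^bsub>?Q\<^esub> Y)" for c
      using x y by (simp_all add: X Y quotient_sel(1,4) C.smult_mult_left C.smult_mult_right)
    show "star ?Q (X \<oplus>\<^bsub>?Q\<^esub> Y) = star ?Q X \<oplus>\<^bsub>?Q\<^esub> star ?Q Y"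
      "star ?Q (X \<otimes>\<^bsub>?Q\<^esub> Y) = star ?Q Y \<otimes>\<^bsub>?Q\<^esub> star ?Q X"
      using x y sx sy by (simp_all add: X Y quotient_sel(2,4,5) C.star_add C.star_mult)
    show "cnorm ?Q (X \<oplus>\<^bsub>?Q\<^esub> Y) \<le> cnorm ?Q X + cnorm ?Q Y"
      using quotient_norm_add[OF x y] x y by (simp add: X Y quotient_sel(5))
    show "cnorm ?Q (X \<otimes>\<^bsub>?Q\<^esub> Y) \<le> cnorm ?Q X * cnorm ?Q Y"
      using quotient_norm_mult[OF x y] x y by (simp add: X Y quotient_sel(4))
  next
    fix Z :: "nat \<Rightarrow> 'a set"
    assume Z: "\<And>n. Z n \<in> carrier ?Q"
      and Cau: "\<And>e. 0 < e \<Longrightarrow> \<exists>N. \<forall>m\<ge>N. \<forall>n\<ge>N. cnorm ?Q (Z m \<ominus>\<^bsub>?Q\<^esub> Z n) < e"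
    from Z have "\<exists>y\<in>carrier A. Z n = K +> y" for n by (auto simp: carrier_quotient)
    then obtain Y where Y: "\<And>n. Y n \<in> carrier A" "\<And>n. Z n = K +> Y n" by metis
    have "\<exists>L\<in>carrier A. (\<lambda>n. cnorm ?Q (K +> (Y n \<ominus> L))) \<longlonglongrightarrow> 0"
      by (rule quotient_complete[OF Y(1)])
         (use Cau in \<open>simp add: Y quotient_minus[OF ring_quotient]\<close>)
    then obtain L where "L \<in> carrier A" "(\<lambda>n. cnorm ?Q (K +> (Y n \<ominus> L))) \<longlonglongrightarrow> 0" by blast
    then show "\<exists>L\<in>carrier ?Q. (\<lambda>n. cnorm ?Q (Z n \<ominus>\<^bsub>?Q\<^esub> L)) \<longlonglongrightarrow> 0"
      by (intro bexI[of _ "K +> L"])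
         (simp_all add: Y quotient_minus[OF ring_quotient] carrier_quotient)
  qed
qed

end
end

section \<open>Words avoiding the generators of a monomial ideal\<close>

lemma free_monomial_eq_single: "free_monomial w = Poly_Mapping.single w 1"
proof (induction w)
  case Nil
  then show ?case using single_one[where ?'a = "'a list" and ?'b = complex]
    by (simp add: free_monomial_def zero_list_def)
next
  case (Cons i w)
  then show ?case
    by (simp add: free_monomial_def free_var_def mult_single plus_list_def)
qed

lemma keys_free_monomial [simp]: "Poly_Mapping.keys (free_monomial w) = {w}"
  by (simp add: free_monomial_eq_single)

lemma free_monomial_append: "free_monomial (v @ w) = free_monomial v * free_monomial w"
  by (simp add: free_monomial_def)

definition has_factor_in :: "'d list set \<Rightarrow> 'd list \<Rightarrow> bool" where
  "has_factor_in S w \<longleftrightarrow> (\<exists>u\<in>S. \<exists>a b. w = a @ u @ b)"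

lemma has_factor_in_append:
  "has_factor_in S w \<Longrightarrow> has_factor_in S (v @ w)" "has_factor_in S w \<Longrightarrow> has_factor_in S (w @ v)"
  unfolding has_factor_in_def by (metis append.assoc)+

text \<open>
  The polynomials all of whose monomials have a factor in \<open>S\<close> form an ideal.
\<close>

lemma monomial_ideal_gen_keys:
  assumes "p \<in> monomial_ideal_gen S" "w \<in> Poly_Mapping.keys p"
  shows "has_factor_in S w"
proof -
  let ?R = "class_ring :: 'a free_algebra ring"
  define J where "J = {p :: 'a free_algebra. \<forall>w\<in>Poly_Mapping.keys p. has_factor_in S w}"
  interpret R: ring ?R by (rule ring_class_ring)
  have neg: "\<ominus>\<^bsub>?R\<^esub> p = - p" for p
    by (rule R.minus_equality) (auto simp: class_ring_def)
  have "ideal J ?R"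
  proof (rule idealI[OF ring_class_ring])
    show "subgroup J (add_monoid ?R)"
    proof (rule R.add.subgroupI)
      show "J \<noteq> {}" unfolding J_def by (auto intro!: exI[of _ 0])
    next
      fix p assume "p \<in> J"
      then show "\<ominus>\<^bsub>?R\<^esub> p \<in> J" by (simp add: neg J_def)
    next
      fix p q assume "p \<in> J" "q \<in> J"
      then show "p \<oplus>\<^bsub>?R\<^esub> q \<in> J"
        using keys_add[of p q] by (auto simp: J_def class_ring_def)
    qed (simp add: class_ring_def)
  next
    fix p q assume "p \<in> J"
    then show "q \<otimes>\<^bsub>?R\<^esub> p \<in> J" "p \<otimes>\<^bsub>?R\<^esub> q \<in> J"
      using keys_mult[of q p] keys_mult[of p q]
      by (auto simp: J_def class_ring_def plus_list_def has_factor_in_append dest!: subsetD)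
  qed
  moreover have "has_factor_in S u" if "u \<in> S" for u
    unfolding has_factor_in_def using that by (intro bexI[of _ u] exI[of _ "[]"]) simp_all
  then have "free_monomial ` S \<subseteq> J" by (auto simp: J_def)
  ultimately have "monomial_ideal_gen S \<subseteq> J"
    unfolding monomial_ideal_gen_def by (rule R.genideal_minimal)
  then show ?thesis using assms by (auto simp: J_def)
qed

lemma free_monomial_in_ideal_iff: "free_monomial w \<in> monomial_ideal_gen S \<longleftrightarrow> has_factor_in S w"
proof
  let ?R = "class_ring :: 'a free_algebra ring"
  interpret R: ring ?R by (rule ring_class_ring)
  have sub: "free_monomial ` S \<subseteq> carrier ?R" by (simp add: class_ring_def)
  interpret I: ideal "monomial_ideal_gen S" ?R
    unfolding monomial_ideal_gen_def by (rule R.genideal_ideal[OF sub])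
  assume "has_factor_in S w"
  then obtain u a b where u: "u \<in> S" "w = a @ u @ b" unfolding has_factor_in_def by blast
  have "free_monomial u \<in> monomial_ideal_gen S"
    unfolding monomial_ideal_gen_def using R.genideal_self[OF sub] u(1) by blast
  then have "free_monomial a * (free_monomial u * free_monomial b) \<in> monomial_ideal_gen S"
    using I.I_l_closed[OF I.I_r_closed, of "free_monomial u" "free_monomial b" "free_monomial a"]
    by (simp add: class_ring_def)
  then show "free_monomial w \<in> monomial_ideal_gen S"
    by (simp add: u(2) free_monomial_append)
qed (rule monomial_ideal_gen_keys[of "free_monomial w" S], simp_all)

text \<open>
  What the representation theory needs from an ideal of finite type \<open>k\<close>: its allowed words are
  closed under factors, and whether a letter may be put in front of a long word is decided by
  the first \<open>k\<close> letters of that word.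
\<close>

locale finite_type_language =
  fixes L :: "'d::finite list set" and k :: nat
  assumes Nil_mem: "[] \<in> L"
    and factor_mem: "a @ w @ b \<in> L \<Longrightarrow> w \<in> L"
    and Cons_mem: "w \<in> L \<Longrightarrow> k \<le> length w \<Longrightarrow> i # take k w \<in> L \<Longrightarrow> i # w \<in> L"

lemma allowed_words_monomial_ideal_gen:
  "allowed_words (monomial_ideal_gen S) = {w. \<not> has_factor_in S w}"
  by (simp add: allowed_words_def free_monomial_in_ideal_iff)

lemma finite_type_language_allowed_words:
  fixes I :: "'d::finite free_algebra set"
  assumes "monomial_ideal I" "finite_type I k"
  shows "finite_type_language (allowed_words I) k"
proof
  obtain S where S: "I = monomial_ideal_gen S" "\<And>w. w \<in> S \<Longrightarrow> length w \<le> k + 1"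
    using assms(2) unfolding finite_type_def by blast
  obtain S' where S': "I = monomial_ideal_gen S'" "\<And>w. w \<in> S' \<Longrightarrow> 2 \<le> length w"
    using assms(1) unfolding monomial_ideal_def by blast
  note mem = allowed_words_monomial_ideal_gen[of S, folded S(1)]
  have "\<not> has_factor_in S' []" using S'(2) unfolding has_factor_in_def by force
  then show "[] \<in> allowed_words I" by (simp add: S'(1) allowed_words_monomial_ideal_gen)
  show "w \<in> allowed_words I" if "a @ w @ b \<in> allowed_words I" for a w b
    using that has_factor_in_append unfolding mem by blast
  show "i # w \<in> allowed_words I"
    if w: "w \<in> allowed_words I" "k \<le> length w" "i # take k w \<in> allowed_words I" for i w
  proof (rule ccontr)
    assume "i # w \<notin> allowed_words I"
    then obtain u a b where u: "u \<in> S" "i # w = a @ u @ b"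
      unfolding mem has_factor_in_def by blast
    show False
    proof (cases a)
      case Nil
      have "i # take k w = take (Suc k) (u @ b)" using u(2) Nil by (metis append_Nil take_Suc_Cons)
      also have "\<dots> = [] @ u @ take (Suc k - length u) b" using S(2)[OF u(1)] by simp
      finally show False using w(3) u(1) unfolding mem has_factor_in_def by blast
    next
      case (Cons j a')
      then have "w = a' @ u @ b" using u(2) by simp
      then show False using w(1) u(1) unfolding mem has_factor_in_def by blast
    qed
  qed
qed

lemma keys_monomial_ideal_not_allowed:
  assumes "monomial_ideal I" "p \<in> I" "w \<in> Poly_Mapping.keys p"
  shows "w \<notin> allowed_words I"
proof -
  obtain S where "I = monomial_ideal_gen S" using assms(1) unfolding monomial_ideal_def by blast
  then show ?thesis
    using monomial_ideal_gen_keys[of p S w] assms(2,3) by (simp add: allowed_words_monomial_ideal_gen)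
qed

context finite_type_language
begin

lemma ConsD: "i # w \<in> L \<Longrightarrow> w \<in> L"
  using factor_mem[of "[i]" w "[]"] by simp

lemma appendD: "v @ w \<in> L \<Longrightarrow> v \<in> L" "v @ w \<in> L \<Longrightarrow> w \<in> L"
  using factor_mem[of "[]" v w] factor_mem[of v w "[]"] by simp_all

definition short_words :: "nat \<Rightarrow> 'd list set" where
  "short_words n = {w \<in> L. length w < n}"

lemma finite_short_words [simp]: "finite (short_words n)"
  by (rule finite_subset[OF _ finite_lists_length_le[of "UNIV :: 'd set" n]])
     (auto simp: short_words_def)

end

section \<open>Compact operators on the Fock space\<close>

definition rank_one ::
    "'h::complex_hilbert_space \<Rightarrow> 'h \<Rightarrow> ('h \<Rightarrow>\<^sub>L 'h)" where
  "rank_one a b = Blinfun (\<lambda>x. cinner x b *\<^sub>C a)"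

lemma bounded_linear_scaleC_left: "bounded_linear (\<lambda>c. c *\<^sub>C (a::'h::complex_hilbert_space))"
  by (rule bounded_linear_intro[where K = "norm a"])
     (auto simp: scaleC_add_left scaleR_scaleC scaleC_scaleC scaleR_conv_of_real)

lemma rank_one_apply [simp]: "rank_one a b x = cinner x b *\<^sub>C a"
  unfolding rank_one_def
  by (rule fun_cong[OF bounded_linear_Blinfun_apply])
     (rule bounded_linear_compose[OF bounded_linear_scaleC_left bounded_linear_cinner_left])

lemma rank_one_carrier [simp]: "rank_one a b \<in> ops"
  by (simp add: ops_iff cinner_scaleC_left scaleC_scaleC)

lemma adjoint_rank_one: "adjoint_op (rank_one a b) = rank_one b a"
proof (rule adjoint_eqI)
  show "cinner (rank_one a b x) y = cinner x (rank_one b a y)" for x y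
    using cinner_commute[of a y] by (simp add: cinner_scaleC_left cinner_scaleC_right)
qed simp

lemma compose_rank_one:
  "A \<in> ops \<Longrightarrow> A o\<^sub>L rank_one a b = rank_one (A a) b"
  by (rule blinfun_eqI) (simp add: ops_iff)

lemma rank_one_compose:
  "A \<in> ops \<Longrightarrow> rank_one a b o\<^sub>L A = rank_one a (adjoint_op A b)"
  by (rule blinfun_eqI) (simp add: cinner_adjoint)

lemma rank_one_diff_left: "rank_one a b - rank_one c b = rank_one (a - c) b"
  by (rule blinfun_eqI) (simp add: blinfun.diff_left scaleC_diff_right)

lemma norm_rank_one_le: "norm (rank_one a b) \<le> norm a * norm b"
proof (rule norm_blinfun_bound)
  fix x
  have "cmod (cinner x b) * norm a \<le> norm x * norm b * norm a"
    by (intro mult_right_mono Cauchy_Schwarz_cinner) simp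
  then show "norm (rank_one a b x) \<le> norm a * norm b * norm x"
    by (simp add: mult_ac)
qed simp

lemma ops_closed:
  shows "id_blinfun \<in> ops" "0 \<in> ops"
    and "A \<in> ops \<Longrightarrow> B \<in> ops \<Longrightarrow> A o\<^sub>L B \<in> ops"
    and "A \<in> ops \<Longrightarrow> B \<in> ops \<Longrightarrow> A + B \<in> ops"
    and "A \<in> ops \<Longrightarrow> B \<in> ops \<Longrightarrow> A - B \<in> ops"
    and "A \<in> ops \<Longrightarrow> c \<cdot> A \<in> ops"
    and "(\<And>i. i \<in> F \<Longrightarrow> f i \<in> ops) \<Longrightarrow> (\<Sum>i\<in>F. f i) \<in> ops"
proof -
  show "A - B \<in> ops"
    if "A \<in> ops" "B \<in> ops"
    using that by (simp add: ops_iff blinfun.diff_left scaleC_diff_right)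
  show "(\<Sum>i\<in>F. f i) \<in> ops" if "\<And>i. i \<in> F \<Longrightarrow> f i \<in> ops"
    using that unfolding ops_iff
    by (simp add: blinfun.sum_left scaleC_sum_right)
qed (simp_all add: ops_iff blinfun.add_left scaleC_add_right scaleC_scaleC mult.commute)

lemma adjoint_add:
  assumes "A \<in> ops" "B \<in> ops"
  shows "adjoint_op (A + B) = adjoint_op A + adjoint_op B"
  using cstar_algebra.star_add[OF cstar_algebra_bounded_operators assms] by simp

lemma adjoint_smult:
  assumes "A \<in> ops"
  shows "adjoint_op (c \<cdot> A) = cnj c \<cdot> adjoint_op A"
  using cstar_algebra.star_smult[OF cstar_algebra_bounded_operators assms] by simp

lemma adjoint_id: "adjoint_op id_blinfun = id_blinfun"
  by (rule adjoint_eqI) (simp_all add: ops_closed)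

lemma adjoint_diff:
  assumes "A \<in> ops" "B \<in> ops"
  shows "adjoint_op (A - B) = adjoint_op A - adjoint_op B"
  by (rule adjoint_eqI)
     (simp_all add: assms ops_closed blinfun.diff_left cinner_diff_left
        cinner_diff_right cinner_adjoint)

lemma adjoint_compose:
  assumes "A \<in> ops" "B \<in> ops"
  shows "adjoint_op (A o\<^sub>L B) = adjoint_op B o\<^sub>L adjoint_op A"
  by (rule adjoint_eqI) (simp_all add: assms ops_closed cinner_adjoint)

lemma adjoint_sum:
  assumes "\<And>i. i \<in> F \<Longrightarrow> f i \<in> ops"
  shows "adjoint_op (\<Sum>i\<in>F. f i) = (\<Sum>i\<in>F. adjoint_op (f i))"
  by (rule adjoint_eqI)
     (simp_all add: assms ops_closed blinfun.sum_left cinner_sum_left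
        cinner_sum_right cinner_adjoint)

lemma compact_finite_span_ball:
  fixes v :: "'i \<Rightarrow> 'h::complex_hilbert_space"
  assumes "finite F"
  shows "compact {\<Sum>i\<in>F. c i *\<^sub>C v i | c. \<forall>i\<in>F. cmod (c i) \<le> M}"
  using assms
proof induction
  case empty
  then show ?case by simp
next
  case (insert j F)
  let ?S = "{\<Sum>i\<in>F. c i *\<^sub>C v i | c. \<forall>i\<in>F. cmod (c i) \<le> M}"
  have "compact ((\<lambda>c. c *\<^sub>C v j) ` cball 0 M)"
    by (intro compact_continuous_image compact_cball linear_continuous_on bounded_linear_scaleC_left)
  then have "compact {x + y | x y. x \<in> (\<lambda>c. c *\<^sub>C v j) ` cball 0 M \<and> y \<in> ?S}"
    by (rule compact_sums[OF _ insert.IH])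
  also have "{x + y | x y. x \<in> (\<lambda>c. c *\<^sub>C v j) ` cball 0 M \<and> y \<in> ?S} =
    {\<Sum>i\<in>insert j F. c i *\<^sub>C v i | c. \<forall>i\<in>insert j F. cmod (c i) \<le> M}" (is "?l = ?r")
  proof (intro equalityI subsetI)
    fix z assume "z \<in> ?l"
    then obtain a c where a: "cmod a \<le> M" "\<forall>i\<in>F. cmod (c i) \<le> M"
      and z: "z = a *\<^sub>C v j + (\<Sum>i\<in>F. c i *\<^sub>C v i)" by auto
    have "(\<Sum>i\<in>F. c i *\<^sub>C v i) = (\<Sum>i\<in>F. (c(j := a)) i *\<^sub>C v i)"
      by (rule sum.cong) (use insert.hyps in auto)
    then have "z = (\<Sum>i\<in>insert j F. (c(j := a)) i *\<^sub>C v i)"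
      using insert.hyps by (simp add: z)
    moreover have "\<forall>i\<in>insert j F. cmod ((c(j := a)) i) \<le> M" using a by simp
    ultimately show "z \<in> ?r" by blast
  next
    fix z assume "z \<in> ?r"
    then obtain c where c: "\<forall>i\<in>insert j F. cmod (c i) \<le> M" "z = (\<Sum>i\<in>insert j F. c i *\<^sub>C v i)"
      by blast
    then have "z = c j *\<^sub>C v j + (\<Sum>i\<in>F. c i *\<^sub>C v i)" using insert.hyps by simp
    moreover have "c j *\<^sub>C v j \<in> (\<lambda>c. c *\<^sub>C v j) ` cball 0 M" using c(1) by simp
    moreover have "(\<Sum>i\<in>F. c i *\<^sub>C v i) \<in> ?S" using c(1) by blast
    ultimately show "z \<in> ?l" by blast
  qed
  finally show ?case .
qed

text \<open>The index set is a language so that its finite parts of bounded length exhaust it.\<close>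

locale language_basis = finite_type_language L k
  for L :: "'d::finite list set" and k :: nat +
  fixes e :: "'d list \<Rightarrow> 'f::complex_hilbert_space"
  assumes basis: "orthonormal_basis L e"
begin

lemma cinner_basis: "v \<in> L \<Longrightarrow> w \<in> L \<Longrightarrow> cinner (e v) (e w) = (if v = w then 1 else 0)"
  using basis by (auto simp: orthonormal_basis_def)

lemma closure_span: "closure (cspan (e ` L)) = UNIV"
  using basis by (auto simp: orthonormal_basis_def)

lemma basis_vec_ext:
  assumes "\<And>w. w \<in> L \<Longrightarrow> cinner (e w) x = cinner (e w) y"
  shows "x = y"
proof (rule cinner_ext_right)
  fix z
  have "closed {z. cinner z x - cinner z y = 0}"
    by (intro closed_Collect_eq continuous_intros
        linear_continuous_on[OF bounded_linear_cinner_left])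
  moreover have "cspan (e ` L) \<subseteq> {z. cinner z x - cinner z y = 0}"
  proof
    fix z assume "z \<in> cspan (e ` L)"
    then obtain F c where F: "F \<subseteq> e ` L" and z: "z = (\<Sum>u\<in>F. c u *\<^sub>C u)"
      unfolding cspan_def by blast
    have "(\<Sum>u\<in>F. c u * cinner u x) = (\<Sum>u\<in>F. c u * cinner u y)"
      by (rule sum.cong) (use F assms in auto)
    then show "z \<in> {z. cinner z x - cinner z y = 0}"
      by (simp add: z cinner_sum_left cinner_scaleC_left)
  qed
  ultimately have "closure (cspan (e ` L)) \<subseteq> {z. cinner z x - cinner z y = 0}"
    by (rule closure_minimal[rotated])
  then show "cinner z x = cinner z y" unfolding closure_span by auto
qed

lemma basis_op_ext:
  assumes A: "A \<in> ops" "B \<in> ops"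
    and eq: "\<And>w. w \<in> L \<Longrightarrow> A (e w) = B (e w)"
  shows "A = B"
proof -
  have "adjoint_op A = adjoint_op B"
    by (rule blinfun_eqI, rule basis_vec_ext) (simp flip: cinner_adjoint[OF A(1)] cinner_adjoint[OF A(2)] add: eq)
  then show ?thesis by (metis A adjoint_adjoint)
qed

definition proj :: "nat \<Rightarrow> ('f \<Rightarrow>\<^sub>L 'f)" where
  "proj n = (\<Sum>w\<in>short_words n. rank_one (e w) (e w))"

lemma proj_apply: "proj n x = (\<Sum>w\<in>short_words n. cinner x (e w) *\<^sub>C e w)"
  by (simp add: proj_def blinfun.sum_left)

lemma proj_carrier [simp]: "proj n \<in> ops"
  unfolding proj_def by (rule ops_closed) simp

lemma adjoint_proj [simp]: "adjoint_op (proj n) = proj n"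
  unfolding proj_def by (simp add: adjoint_sum adjoint_rank_one)

lemma proj_basis:
  assumes "v \<in> L"
  shows "proj n (e v) = (if length v < n then e v else 0)"
proof -
  have "proj n (e v) = (\<Sum>w\<in>short_words n. if v = w then e v else 0)"
    unfolding proj_apply by (rule sum.cong) (use assms in \<open>auto simp: short_words_def cinner_basis\<close>)
  moreover have "v \<in> short_words n \<longleftrightarrow> length v < n" using assms by (simp add: short_words_def)
  ultimately show ?thesis by simp
qed

lemma cinner_sum_basis:
  assumes "finite A" "A \<subseteq> L"
  shows "cinner (\<Sum>w\<in>A. c w *\<^sub>C e w) (\<Sum>w\<in>A. d w *\<^sub>C e w) = (\<Sum>w\<in>A. c w * cnj (d w))"
proof -
  have "cinner (\<Sum>w\<in>A. c w *\<^sub>C e w) (\<Sum>w\<in>A. d w *\<^sub>C e w) =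
    (\<Sum>v\<in>A. \<Sum>w\<in>A. c v * (cnj (d w) * cinner (e v) (e w)))"
    unfolding cinner_sum_left
    by (intro sum.cong refl)
      (simp add: cinner_scaleC_left cinner_sum_right cinner_scaleC_right sum_distrib_left mult_ac)
  also have "\<dots> = (\<Sum>v\<in>A. \<Sum>w\<in>A. if v = w then c v * cnj (d v) else 0)"
    by (intro sum.cong refl) (use assms(2) in \<open>auto simp: cinner_basis subset_iff\<close>)
  finally show ?thesis using assms(1) by simp
qed

lemma norm_sum_basis_sq:
  assumes "finite A" "A \<subseteq> L"
  shows "(norm (\<Sum>w\<in>A. c w *\<^sub>C e w))\<^sup>2 = (\<Sum>w\<in>A. (cmod (c w))\<^sup>2)"
proof -
  have "complex_of_real ((norm (\<Sum>w\<in>A. c w *\<^sub>C e w))\<^sup>2) = (\<Sum>w\<in>A. c w * cnj (c w))"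
    unfolding cinner_norm[symmetric] by (rule cinner_sum_basis[OF assms])
  also have "\<dots> = complex_of_real (\<Sum>w\<in>A. (cmod (c w))\<^sup>2)"
    unfolding of_real_sum by (intro sum.cong refl) (simp flip: complex_norm_square of_real_power)
  finally show ?thesis by (simp only: of_real_eq_iff)
qed

lemma short_words_subset: "short_words n \<subseteq> L"
  by (auto simp: short_words_def)

lemma proj_pythagoras:
  "(norm (proj n x))\<^sup>2 + (norm (x - proj n x))\<^sup>2 = (norm x)\<^sup>2"
proof -
  have "complex_of_real ((norm (proj n x))\<^sup>2) =
      (\<Sum>w\<in>short_words n. cinner x (e w) * cnj (cinner x (e w)))"
    unfolding cinner_norm[symmetric] proj_apply
    by (rule cinner_sum_basis) (simp_all add: short_words_subset)
  also have "\<dots> = cinner x (proj n x)"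
    by (simp add: proj_apply cinner_sum_right cinner_scaleC_right mult.commute)
  finally have "(norm (proj n x))\<^sup>2 = Re (cinner x (proj n x))"
    by (metis Re_complex_of_real)
  then show ?thesis by (simp add: norm_diff_sq)
qed

lemma norm_proj_apply_le: "norm (proj n x) \<le> norm x"
  by (rule power2_le_imp_le) (use proj_pythagoras[of n x] in \<open>simp_all add: le_add_same_cancel1 flip: proj_pythagoras[of n x]\<close>)

lemma norm_id_minus_proj_le: "norm (id_blinfun - proj n) \<le> 1"
proof (rule norm_blinfun_bound)
  fix x
  have "norm (x - proj n x) \<le> norm x"
    by (rule power2_le_imp_le) (simp_all flip: proj_pythagoras[of n x])
  then show "norm ((id_blinfun - proj n) x) \<le> 1 * norm x"
    by (simp add: blinfun.diff_left)
qed simp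

lemma proj_tendsto: "(\<lambda>n. proj n x) \<longlonglongrightarrow> x"
proof (rule LIMSEQ_I)
  fix r :: real assume r: "0 < r"
  have "x \<in> closure (cspan (e ` L))" by (simp add: closure_span)
  then obtain y where y: "y \<in> cspan (e ` L)" "dist y x < r / 2"
    using half_gt_zero[OF r] unfolding closure_approachable by blast
  then obtain F c where F: "finite F" "F \<subseteq> e ` L" and yF: "y = (\<Sum>u\<in>F. c u *\<^sub>C u)"
    unfolding cspan_def by blast
  obtain G where G: "finite G" "G \<subseteq> L" "F = e ` G" using finite_subset_image[OF F] by blast
  define N where "N = Suc (\<Sum>w\<in>G. length w)"
  have len: "length w < N" if "w \<in> G" for w
    unfolding N_def using member_le_sum[of w G length] G(1) that by simp
  have "norm (proj n x - x) < r" if n: "n \<ge> N" for n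
  proof -
    have "proj n u = u" if "u \<in> F" for u
    proof -
      obtain w where "w \<in> G" "u = e w" using \<open>u \<in> F\<close> G(3) by blast
      then show ?thesis using len[of w] n G(2) proj_basis[of w n] by auto
    qed
    then have "proj n y = y"
      using proj_carrier[of n] unfolding ops_iff
      by (simp add: yF blinfun.sum_right)
    then have "proj n x - x = proj n (x - y) - (x - y)"
      by (simp add: blinfun.diff_right)
    also have "norm \<dots> \<le> norm (proj n (x - y)) + norm (x - y)"
      by (rule norm_triangle_ineq4)
    also have "\<dots> \<le> norm (x - y) + norm (x - y)" by (simp add: norm_proj_apply_le)
    also have "\<dots> < r" using y(2) by (simp add: dist_norm norm_minus_commute)
    finally show ?thesis .
  qed
  then show "\<exists>N. \<forall>n\<ge>N. norm (proj n x - x) < r" by blast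
qed

lemma norm_diff_proj_le:
  "norm (A - (proj n o\<^sub>L A)) \<le> norm (B - (proj n o\<^sub>L B)) + norm (A - B)"
proof -
  have "A - (proj n o\<^sub>L A) = (B - (proj n o\<^sub>L B)) + ((id_blinfun - proj n) o\<^sub>L (A - B))"
    by (rule blinfun_eqI) (simp add: blinfun.diff_left blinfun.add_left blinfun.diff_right)
  also have "norm \<dots> \<le> norm (B - (proj n o\<^sub>L B)) + norm ((id_blinfun - proj n) o\<^sub>L (A - B))"
    by (rule norm_triangle_ineq)
  also have "norm ((id_blinfun - proj n) o\<^sub>L (A - B)) \<le> norm (id_blinfun - proj n) * norm (A - B)"
    by (rule norm_blinfun_compose)
  also have "\<dots> \<le> 1 * norm (A - B)" by (intro mult_right_mono norm_id_minus_proj_le) simp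
  finally show ?thesis by simp
qed

text \<open>
  The projections are contractions that converge pointwise to the identity, so they converge
  uniformly on the compact closure of the image of the unit ball.
\<close>

lemma compact_imp_proj_tendsto:
  assumes "K \<in> compact_operators"
  shows "(\<lambda>n. norm (K - (proj n o\<^sub>L K))) \<longlonglongrightarrow> 0"
proof (rule LIMSEQ_I)
  fix r :: real assume r: "0 < r"
  let ?C = "closure (K ` cball 0 1)"
  have "compact ?C" using assms by (simp add: compact_operators_def)
  then obtain F where F: "finite F" "?C \<subseteq> (\<Union>x\<in>F. ball x (r / 4))"
    using r unfolding compact_eq_totally_bounded by (meson divide_pos_pos zero_less_numeral)
  have "\<forall>x\<in>F. \<forall>\<^sub>F n in sequentially. dist (proj n x) x < r / 4"
    using tendstoD[OF proj_tendsto, of "r / 4"] r by simp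
  then have "\<forall>\<^sub>F n in sequentially. \<forall>x\<in>F. dist (proj n x) x < r / 4"
    by (rule eventually_ball_finite[OF F(1)])
  then obtain N where N: "\<And>n x. n \<ge> N \<Longrightarrow> x \<in> F \<Longrightarrow> dist (proj n x) x < r / 4"
    unfolding eventually_sequentially by blast
  have "norm (norm (K - (proj n o\<^sub>L K)) - 0) < r" if n: "n \<ge> N" for n
  proof -
    have ball: "norm ((K - (proj n o\<^sub>L K)) x) \<le> 3 * r / 4" if x: "norm x \<le> 1" for x
    proof -
      have "K x \<in> ?C" using x by (intro subsetD[OF closure_subset] imageI) simp
      then obtain c where c: "c \<in> F" "dist c (K x) < r / 4" using F(2) by auto
      define d where "d = K x - c"
      have "(K - (proj n o\<^sub>L K)) x = d - proj n d + (c - proj n c)"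
        by (simp add: d_def blinfun.diff_left blinfun.diff_right)
      then have "norm ((K - (proj n o\<^sub>L K)) x) \<le>
          norm d + norm (proj n d) + norm (c - proj n c)"
        using norm_triangle_ineq[of "d - proj n d" "c - proj n c"]
          norm_triangle_ineq4[of d "proj n d"] by simp
      moreover have "norm d < r / 4" using c(2) by (simp add: d_def dist_norm norm_minus_commute)
      moreover have "norm (c - proj n c) < r / 4"
        using N[OF n c(1)] by (simp add: dist_norm norm_minus_commute)
      ultimately show ?thesis using norm_proj_apply_le[of n d] by linarith
    qed
    have "norm (K - (proj n o\<^sub>L K)) \<le> 3 * r / 4"
    proof (rule norm_blinfun_bound)
      fix x
      show "norm ((K - (proj n o\<^sub>L K)) x) \<le> 3 * r / 4 * norm x"
      proof (cases "x = 0")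
        case False
        have "norm ((K - (proj n o\<^sub>L K)) ((1 / norm x) *\<^sub>R x)) \<le> 3 * r / 4"
          by (rule ball) (use False in simp)
        then show ?thesis using False
          by (simp add: blinfun.scaleR_right field_simps del: blinfun_apply_blinfun_compose)
      qed simp
    qed (use r in simp)
    then show ?thesis using r by simp
  qed
  then show "\<exists>N. \<forall>n\<ge>N. norm (norm (K - (proj n o\<^sub>L K)) - 0) < r" by blast
qed

text \<open>
  Up to any given error the image of the unit ball lies in a bounded subset of a finite-dimensional
  subspace, so it is totally bounded.
\<close>

lemma proj_tendsto_imp_compact:
  assumes K: "K \<in> ops"
    and lim: "(\<lambda>n. norm (K - (proj n o\<^sub>L K))) \<longlonglongrightarrow> 0"
  shows "K \<in> compact_operators"
proof -
  let ?S = "K ` cball 0 1"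
  have "\<exists>F. finite F \<and> closure ?S \<subseteq> (\<Union>x\<in>F. ball x r)" if r: "0 < r" for r :: real
  proof -
    have "\<exists>n. norm (norm (K - (proj n o\<^sub>L K)) - 0) < r / 3"
      using LIMSEQ_D[OF lim, of "r / 3"] r by (meson divide_pos_pos le_refl zero_less_numeral)
    then obtain n where n: "norm (K - (proj n o\<^sub>L K)) < r / 3" by auto
    define D where "D = {\<Sum>w\<in>short_words n. c w *\<^sub>C e w | c. \<forall>w\<in>short_words n. cmod (c w) \<le> norm K}"
    have "compact D" unfolding D_def by (rule compact_finite_span_ball) simp
    then obtain F where F: "finite F" "D \<subseteq> (\<Union>x\<in>F. ball x (r / 3))"
      using r unfolding compact_eq_totally_bounded by (meson divide_pos_pos zero_less_numeral)
    have "?S \<subseteq> (\<Union>x\<in>F. cball x (2 * r / 3))"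
    proof
      fix y assume "y \<in> ?S"
      then obtain x where x: "norm x \<le> 1" "y = K x" by auto
      have Kx: "norm (A x) \<le> norm A" for A :: "'f \<Rightarrow>\<^sub>L 'f"
        using norm_blinfun[of A x] mult_left_mono[OF x(1), of "norm A"] by simp
      have "proj n y \<in> D"
      proof -
        have "cmod (cinner y (e w)) \<le> norm K" if "w \<in> short_words n" for w
        proof -
          have "norm (e w) = 1"
            using cinner_basis[of w w] that norm_sq_eq_cinner[of "e w"] norm_ge_zero[of "e w"]
            by (simp add: short_words_def power2_eq_1_iff)
          then show ?thesis
            using Cauchy_Schwarz_cinner[of y "e w"] Kx[of K] by (simp add: x(2))
        qed
        then show ?thesis unfolding D_def proj_apply
          by (intro CollectI exI[of _ "\<lambda>w. cinner y (e w)"] conjI refl ballI)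
      qed
      then obtain c where c: "c \<in> F" "dist c (proj n y) < r / 3" using F(2) by auto
      have "dist (proj n y) y < r / 3"
        using Kx[of "K - (proj n o\<^sub>L K)"] n
        by (simp add: dist_norm norm_minus_commute x(2) blinfun.diff_left)
      then have "dist c y \<le> 2 * r / 3"
        using c(2) dist_triangle[of c y "proj n y"] by linarith
      then show "y \<in> (\<Union>x\<in>F. cball x (2 * r / 3))" using c(1) by auto
    qed
    then have "closure ?S \<subseteq> (\<Union>x\<in>F. cball x (2 * r / 3))"
      by (rule closure_minimal) (use F(1) in blast)
    also have "\<dots> \<subseteq> (\<Union>x\<in>F. ball x r)" using r by (intro UN_mono) auto
    finally show ?thesis using F(1) by blast
  qed
  then have "compact (closure ?S)"
    unfolding compact_eq_totally_bounded using complete_eq_closed closed_closure by blast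
  then show ?thesis using K by (simp add: compact_operators_def)
qed

end

context language_basis
begin

abbreviation compacts :: "('f \<Rightarrow>\<^sub>L 'f) set" where
  "compacts \<equiv> compact_operators"

text \<open>The stability properties of the compact operators all follow from this criterion.\<close>

lemma compact_operators_iff:
  "K \<in> compacts \<longleftrightarrow>
    K \<in> ops \<and> (\<lambda>n. norm (K - (proj n o\<^sub>L K))) \<longlonglongrightarrow> 0"
  using compact_imp_proj_tendsto proj_tendsto_imp_compact by (auto simp: compact_operators_def)

lemma compact_carrier: "K \<in> compacts \<Longrightarrow> K \<in> ops"
  by (simp add: compact_operators_def)

lemma compact_add:
  assumes "A \<in> compacts" "B \<in> compacts"
  shows "A + B \<in> compacts"
proof -
  have "(\<lambda>n. norm (A - (proj n o\<^sub>L A)) + norm (B - (proj n o\<^sub>L B))) \<longlonglongrightarrow> 0"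
    using tendsto_add[of _ 0 _ _ 0] assms unfolding compact_operators_iff by force
  moreover have "norm ((A + B) - (proj n o\<^sub>L (A + B))) \<le>
      norm (A - (proj n o\<^sub>L A)) + norm (B - (proj n o\<^sub>L B))" for n
  proof -
    have "(A + B) - (proj n o\<^sub>L (A + B)) = (A - (proj n o\<^sub>L A)) + (B - (proj n o\<^sub>L B))"
      by (rule blinfun_eqI) (simp add: blinfun.diff_left blinfun.add_left blinfun.add_right)
    then show ?thesis by (simp only: norm_triangle_ineq)
  qed
  ultimately have "(\<lambda>n. norm ((A + B) - (proj n o\<^sub>L (A + B)))) \<longlonglongrightarrow> 0"
    by (elim metric_tendsto_imp_tendsto) simp
  then show ?thesis
    using assms by (simp add: compact_operators_iff ops_closed)
qed

lemma compact_compose_right: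
  assumes K: "K \<in> compacts" and B: "B \<in> ops"
  shows "K o\<^sub>L B \<in> compacts"
proof -
  have "(\<lambda>n. norm (K - (proj n o\<^sub>L K)) * norm B) \<longlonglongrightarrow> 0"
    using tendsto_mult_right[of _ 0] K unfolding compact_operators_iff by force
  moreover have "norm ((K o\<^sub>L B) - (proj n o\<^sub>L (K o\<^sub>L B))) \<le> norm (K - (proj n o\<^sub>L K)) * norm B" for n
  proof -
    have "(K o\<^sub>L B) - (proj n o\<^sub>L (K o\<^sub>L B)) = (K - (proj n o\<^sub>L K)) o\<^sub>L B"
      by (rule blinfun_eqI) (simp add: blinfun.diff_left)
    then show ?thesis by (simp only: norm_blinfun_compose)
  qed
  ultimately have "(\<lambda>n. norm ((K o\<^sub>L B) - (proj n o\<^sub>L (K o\<^sub>L B)))) \<longlonglongrightarrow> 0"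
    by (elim metric_tendsto_imp_tendsto) simp
  then show ?thesis
    using K B by (simp add: compact_operators_iff ops_closed)
qed

lemma compact_limit:
  assumes X: "\<And>n::nat. X n \<in> compacts" and K: "K \<in> ops"
    and lim: "(\<lambda>n. norm (X n - K)) \<longlonglongrightarrow> 0"
  shows "K \<in> compacts"
proof -
  have "(\<lambda>n. norm (K - (proj n o\<^sub>L K))) \<longlonglongrightarrow> 0"
  proof (rule LIMSEQ_I)
    fix r :: real assume r: "0 < r"
    obtain m where m: "norm (X m - K) < r / 2"
      using LIMSEQ_D[OF lim half_gt_zero[OF r]] by auto
    have "(\<lambda>n. norm (X m - (proj n o\<^sub>L X m))) \<longlonglongrightarrow> 0" by (rule compact_imp_proj_tendsto[OF X])
    then obtain N where N: "\<And>n. n \<ge> N \<Longrightarrow> norm (norm (X m - (proj n o\<^sub>L X m)) - 0) < r / 2"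
      using LIMSEQ_D[OF _ half_gt_zero[OF r]] by blast
    have "norm (norm (K - (proj n o\<^sub>L K)) - 0) < r" if "n \<ge> N" for n
      using N[OF that] m norm_diff_proj_le[of K n "X m"] by (simp add: norm_minus_commute)
    then show "\<exists>N. \<forall>n\<ge>N. norm (norm (K - (proj n o\<^sub>L K)) - 0) < r" by blast
  qed
  then show ?thesis using K by (simp add: compact_operators_iff)
qed

lemma compact_rank_one: "rank_one a b \<in> compacts"
proof -
  have "(\<lambda>n. norm (a - proj n a) * norm b) \<longlonglongrightarrow> norm (a - a) * norm b"
    by (intro tendsto_intros proj_tendsto)
  then have "(\<lambda>n. norm (a - proj n a) * norm b) \<longlonglongrightarrow> 0" by simp
  moreover have "norm (rank_one a b - (proj n o\<^sub>L rank_one a b)) \<le> norm (a - proj n a) * norm b" for n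
    by (simp add: compose_rank_one rank_one_diff_left norm_rank_one_le)
  ultimately have "(\<lambda>n. norm (rank_one a b - (proj n o\<^sub>L rank_one a b))) \<longlonglongrightarrow> 0"
    by (elim metric_tendsto_imp_tendsto) simp
  then show ?thesis by (simp add: compact_operators_iff)
qed

lemma compact_zero: "0 \<in> compacts"
  by (simp add: compact_operators_iff ops_closed)

lemma compact_sum:
  "(\<And>i. i \<in> F \<Longrightarrow> f i \<in> compacts) \<Longrightarrow> (\<Sum>i\<in>F. f i) \<in> compacts"
  by (induction F rule: infinite_finite_induct) (simp_all add: compact_zero compact_add)

lemma compose_proj:
  "A \<in> ops \<Longrightarrow> A o\<^sub>L proj n = (\<Sum>w\<in>short_words n. rank_one (A (e w)) (e w))"
  by (rule blinfun_eqI)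
     (simp add: proj_apply blinfun.sum_left blinfun.sum_right ops_iff)

lemma compact_proj: "proj n \<in> compacts"
  unfolding proj_def by (rule compact_sum) (rule compact_rank_one)

text \<open>
  Taking adjoints is isometric, so \<open>K\<^sup>*\<close> is the limit of the adjoints of \<open>proj n o\<^sub>L K\<close>, and these have
  finite rank.
\<close>

lemma compact_adjoint:
  assumes K: "K \<in> compacts"
  shows "adjoint_op K \<in> compacts"
proof (rule compact_limit)
  have c: "K \<in> ops" by (rule compact_carrier[OF K])
  show "adjoint_op K \<in> ops" by (rule adjoint_carrier[OF c])
  show "adjoint_op K o\<^sub>L proj n \<in> compacts" for n
    unfolding compose_proj[OF adjoint_carrier[OF c]] by (rule compact_sum) (rule compact_rank_one)
  have "norm ((adjoint_op K o\<^sub>L proj n) - adjoint_op K) = norm (K - (proj n o\<^sub>L K))" for n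
  proof -
    have "norm (K - (proj n o\<^sub>L K)) = norm (adjoint_op (K - (proj n o\<^sub>L K)))"
      by (simp add: norm_adjoint c ops_closed)
    also have "adjoint_op (K - (proj n o\<^sub>L K)) = adjoint_op K - (adjoint_op K o\<^sub>L proj n)"
      by (simp add: adjoint_diff adjoint_compose c ops_closed)
    finally show ?thesis by (simp add: norm_minus_commute)
  qed
  then show "(\<lambda>n. norm ((adjoint_op K o\<^sub>L proj n) - adjoint_op K)) \<longlonglongrightarrow> 0"
    using compact_imp_proj_tendsto[OF K] by simp
qed

lemma compact_compose_left:
  assumes K: "K \<in> compacts" and A: "A \<in> ops"
  shows "A o\<^sub>L K \<in> compacts"
proof -
  have "adjoint_op (adjoint_op K o\<^sub>L adjoint_op A) \<in> compacts"
    by (intro compact_adjoint compact_compose_right adjoint_carrier K A)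
  then show ?thesis
    by (simp add: adjoint_compose adjoint_adjoint adjoint_carrier compact_carrier[OF K] A)
qed

lemma compact_compose_proj_tendsto:
  assumes K: "K \<in> compacts"
  shows "(\<lambda>n. norm (K - (K o\<^sub>L proj n))) \<longlonglongrightarrow> 0"
proof -
  have c: "K \<in> ops" by (rule compact_carrier[OF K])
  have "norm (K - (K o\<^sub>L proj n)) = norm (adjoint_op K - (proj n o\<^sub>L adjoint_op K))" for n
  proof -
    have "norm (K - (K o\<^sub>L proj n)) = norm (adjoint_op (K - (K o\<^sub>L proj n)))"
      by (simp add: norm_adjoint c ops_closed)
    then show ?thesis
      by (simp add: adjoint_diff adjoint_compose c ops_closed)
  qed
  then show ?thesis using compact_imp_proj_tendsto[OF compact_adjoint[OF K]] by simp
qed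

end

section \<open>Shifts and matrix units\<close>

locale language_shifts = language_basis L k e
  for L :: "'d::finite list set" and k :: nat and e :: "'d list \<Rightarrow> 'f::complex_hilbert_space" +
  fixes T :: "'d \<Rightarrow> ('f \<Rightarrow>\<^sub>L 'f)"
  assumes T_carrier [simp]: "T i \<in> ops"
    and T_basis: "w \<in> L \<Longrightarrow> T i (e w) = (if i # w \<in> L then e (i # w) else 0)"
begin

abbreviation shift_word :: "'d list \<Rightarrow> ('f \<Rightarrow>\<^sub>L 'f)" where
  "shift_word \<equiv> word_prod bounded_operators T"

lemma adjoint_T_basis:
  assumes w: "w \<in> L"
  shows "adjoint_op (T i) (e w) = (if w \<noteq> [] \<and> hd w = i then e (tl w) else 0)"
proof (rule basis_vec_ext)
  fix v assume v: "v \<in> L"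
  show "cinner (e v) (adjoint_op (T i) (e w)) =
      cinner (e v) (if w \<noteq> [] \<and> hd w = i then e (tl w) else 0)"
    by (cases w) (use w v ConsD in \<open>auto simp: T_basis cinner_basis simp flip: cinner_adjoint\<close>)
qed

lemma shift_word_carrier [simp]: "shift_word w \<in> ops"
  by (induction w) (simp_all add: word_prod_def ops_closed)

lemma shift_word_basis:
  "w \<in> L \<Longrightarrow> shift_word v (e w) = (if v @ w \<in> L then e (v @ w) else 0)"
proof (induction v)
  case (Cons i v)
  have "shift_word (i # v) = T i o\<^sub>L shift_word v" by (simp add: word_prod_def)
  then show ?case using Cons ConsD[of i "v @ w"] by (auto simp: T_basis)
qed (simp add: word_prod_def)

lemma shift_word_not_allowed:
  assumes "v \<notin> L"
  shows "shift_word v = 0"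
proof (rule basis_op_ext)
  show "shift_word v (e w) = blinfun_apply 0 (e w)" if "w \<in> L" for w
    using shift_word_basis[OF that] appendD(1)[of v w] assms by auto
qed (simp_all add: ops_closed)

lemma adjoint_shift_word_basis:
  assumes w: "w \<in> L"
  shows "adjoint_op (shift_word v) (e w) =
    (if take (length v) w = v then e (drop (length v) w) else 0)"
proof (rule basis_vec_ext)
  fix u assume u: "u \<in> L"
  have iff: "v @ u = w \<longleftrightarrow> take (length v) w = v \<and> drop (length v) w = u"
    by (auto simp: append_eq_conv_conj)
  have "drop (length v) w \<in> L" using appendD(2)[of "take (length v) w" "drop (length v) w"] w by simp
  then show "cinner (e u) (adjoint_op (shift_word v) (e w)) =
      cinner (e u) (if take (length v) w = v then e (drop (length v) w) else 0)"
    using iff w u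
    by (auto simp: shift_word_basis cinner_basis simp flip: cinner_adjoint)
qed

lemma vacuum_projection:
  "id_blinfun - (\<Sum>i\<in>UNIV. T i o\<^sub>L adjoint_op (T i)) = rank_one (e []) (e [])"
proof (rule basis_op_ext)
  fix w assume w: "w \<in> L"
  show "(id_blinfun - (\<Sum>i\<in>UNIV. T i o\<^sub>L adjoint_op (T i))) (e w) =
      rank_one (e []) (e []) (e w)"
  proof (cases w)
    case Nil
    then show ?thesis using Nil_mem by (simp add: blinfun.diff_left blinfun.sum_left adjoint_T_basis cinner_basis)
  next
    case (Cons j v)
    have "(\<Sum>i\<in>UNIV. T i (adjoint_op (T i) (e w))) =
        (\<Sum>i\<in>UNIV. if i = j then e w else 0)"
      by (intro sum.cong refl) (use w Cons ConsD in \<open>auto simp: adjoint_T_basis T_basis\<close>)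
    then show ?thesis using w Cons Nil_mem
      by (simp add: blinfun.diff_left blinfun.sum_left cinner_basis)
  qed
qed (simp_all add: ops_closed adjoint_carrier)

lemma rank_one_shift_word:
  assumes "v \<in> L" "w \<in> L"
  shows "rank_one (e v) (e w) = shift_word v o\<^sub>L (rank_one (e []) (e []) o\<^sub>L adjoint_op (shift_word w))"
  using assms Nil_mem
  by (simp add: rank_one_compose compose_rank_one adjoint_carrier adjoint_adjoint shift_word_basis)

text \<open>The vacuum projection and words in the shifts yield all matrix units, hence all compacts.\<close>

lemma compact_subset_generated:
  "compacts \<subseteq> cstar_generated bounded_operators (range T)"
proof
  fix K :: "'f \<Rightarrow>\<^sub>L 'f" assume K: "K \<in> compacts"
  let ?A = "cstar_generated bounded_operators (range T)"
  have c: "K \<in> ops" by (rule compact_carrier[OF K])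
  have sub: "cstar_subalgebra bounded_operators ?A"
    by (rule cstar_subalgebra_generated[OF cstar_algebra_bounded_operators]) auto
  then have subr: "subring ?A bounded_operators"
    and smult: "\<And>c x. x \<in> ?A \<Longrightarrow> c \<cdot> x \<in> ?A"
    and star: "\<And>x. x \<in> ?A \<Longrightarrow> adjoint_op x \<in> ?A"
    and closed: "\<And>X L. L \<in> ops \<Longrightarrow> (\<And>n::nat. X n \<in> ?A) \<Longrightarrow>
       (\<lambda>n. cnorm bounded_operators (X n \<ominus>\<^bsub>bounded_operators\<^esub> L)) \<longlonglongrightarrow> 0 \<Longrightarrow> L \<in> ?A"
    unfolding cstar_subalgebra_def bounded_operators_sel by blast+
  note rng = subringE[OF subr, unfolded bounded_operators_sel]
  have clos: "L \<in> ?A" if "L \<in> ops" "\<And>n. X n \<in> ?A" "(\<lambda>n. norm (X n - L)) \<longlonglongrightarrow> 0" for X L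
  proof (rule closed[OF that(1,2)])
    have "X n \<in> ops" for n using rng(1) that(2) by blast
    then show "(\<lambda>n. cnorm bounded_operators (X n \<ominus>\<^bsub>bounded_operators\<^esub> L)) \<longlonglongrightarrow> 0"
      using that(1,3) by simp
  qed
  have sums: "(\<Sum>i\<in>F. f i) \<in> ?A" if "\<And>i. i \<in> F \<Longrightarrow> f i \<in> ?A" for F :: "'i set" and f
    using that by (induction F rule: infinite_finite_induct) (simp_all add: rng)
  have diff: "a - b \<in> ?A" if "a \<in> ?A" "b \<in> ?A" for a b
  proof -
    have "a - b = a + (- 1) \<cdot> b"
      by (rule blinfun_eqI) (simp add: blinfun.diff_left blinfun.add_left)
    then show ?thesis using that smult rng by metis
  qed
  have T: "T i \<in> ?A" for i unfolding cstar_generated_def by auto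
  have word: "shift_word w \<in> ?A" for w
    by (induction w) (simp_all add: word_prod_def rng T)
  have "rank_one (e []) (e []) \<in> ?A"
    unfolding vacuum_projection[symmetric] by (intro diff sums rng T star)
  then have unit: "rank_one (e v) (e w) \<in> ?A" if "v \<in> L" "w \<in> L" for v w
    unfolding rank_one_shift_word[OF that] by (intro rng word star)
  have corner: "proj m o\<^sub>L (K o\<^sub>L proj n) \<in> ?A" for m n
  proof -
    have "proj m o\<^sub>L (K o\<^sub>L proj n) = (\<Sum>w\<in>short_words n. \<Sum>v\<in>short_words m.
        cinner (K (e w)) (e v) \<cdot> rank_one (e v) (e w))"
      by (rule blinfun_eqI)
         (simp add: compose_proj[OF c] blinfun.sum_left blinfun.sum_right proj_apply cinner_sum_left
           cinner_scaleC_left scaleC_sum_right scaleC_sum_left scaleC_scaleC mult.commute sum.swap[of _ "short_words m"])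
    then show ?thesis
      using short_words_subset by (auto intro!: sums smult unit)
  qed
  have half: "proj m o\<^sub>L K \<in> ?A" for m
  proof (rule clos[OF _ corner])
    have "proj m o\<^sub>L K \<in> compacts" by (rule compact_compose_left[OF K]) simp
    then have "(\<lambda>n. norm ((proj m o\<^sub>L K) - ((proj m o\<^sub>L K) o\<^sub>L proj n))) \<longlonglongrightarrow> 0"
      by (rule compact_compose_proj_tendsto)
    moreover have "(proj m o\<^sub>L K) o\<^sub>L proj n = proj m o\<^sub>L (K o\<^sub>L proj n)" for n
      by (rule blinfun_eqI) simp
    ultimately show "(\<lambda>n. norm ((proj m o\<^sub>L (K o\<^sub>L proj n)) - (proj m o\<^sub>L K))) \<longlonglongrightarrow> 0"
      by (simp add: norm_minus_commute)
  qed (simp add: c ops_closed)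
  show "K \<in> ?A"
    by (rule clos[OF c half]) (use compact_imp_proj_tendsto[OF K] in \<open>simp add: norm_minus_commute\<close>)
qed

end

section \<open>Words in a tuple satisfying the relations\<close>

lemma word_prod_bounded_operators_Nil [simp]: "word_prod bounded_operators s [] = id_blinfun"
  by (simp add: word_prod_def)

lemma word_prod_bounded_operators_Cons:
  "word_prod bounded_operators s (i # w) = s i o\<^sub>L word_prod bounded_operators s w"
  by (simp add: word_prod_def)

lemma word_prod_bounded_operators_append:
  "word_prod bounded_operators s (v @ w) = word_prod bounded_operators s v o\<^sub>L word_prod bounded_operators s w"
  by (induction v) (auto simp: word_prod_bounded_operators_Cons intro!: blinfun_eqI)

lemma sum_length_Suc:
  fixes f :: "'d::finite list \<Rightarrow> 'b::comm_monoid_add"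
  shows "(\<Sum>w | length w = Suc n. f w) = (\<Sum>i\<in>UNIV. \<Sum>w | length w = n. f (i # w))"
proof -
  have "{w :: 'd list. length w = Suc n} = (\<lambda>(i, w). i # w) ` (UNIV \<times> {w. length w = n})"
    by (auto simp: length_Suc_conv)
  moreover have "inj_on (\<lambda>(i, w). i # w) (UNIV \<times> {w :: 'd list. length w = n})"
    by (auto intro!: inj_onI)
  ultimately show ?thesis by (simp add: sum.reindex sum.cartesian_product case_prod_unfold)
qed

lemma finite_length_eq [simp]: "finite {w :: 'd::finite list. length w = n}"
  using finite_lists_length_eq[of "UNIV :: 'd set" n] by simp

lemma norm_sq_sum_cinner:
  fixes A :: "'i \<Rightarrow> ('h::complex_hilbert_space \<Rightarrow>\<^sub>L 'h)"
  assumes "\<And>i. i \<in> F \<Longrightarrow> A i \<in> ops"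
  shows "(\<Sum>i\<in>F. (norm (adjoint_op (A i) x))\<^sup>2) =
    Re (cinner (\<Sum>i\<in>F. A i (adjoint_op (A i) x)) x)"
  unfolding cinner_sum_left Re_sum norm_sq_eq_cinner
  by (intro sum.cong refl) (simp add: cinner_adjoint assms)

locale language_representation = finite_type_language L k
  for L :: "'d::finite list set" and k :: nat +
  fixes s :: "'d \<Rightarrow> ('h::complex_hilbert_space \<Rightarrow>\<^sub>L 'h)"
  assumes s_carrier [simp]: "s i \<in> ops"
    and s_unit: "(\<Sum>i\<in>UNIV. s i o\<^sub>L adjoint_op (s i)) = id_blinfun"
    and s_zero: "w \<notin> L \<Longrightarrow> word_prod bounded_operators s w = 0"
    and s_initial: "adjoint_op (s i) o\<^sub>L s i = (\<Sum>w | w \<in> L \<and> length w = k \<and> i # w \<in> L.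
      word_prod bounded_operators s w o\<^sub>L adjoint_op (word_prod bounded_operators s w))"
begin

abbreviation sw :: "'d list \<Rightarrow> ('h \<Rightarrow>\<^sub>L 'h)" where
  "sw \<equiv> word_prod bounded_operators s"

lemma sw_carrier [simp]: "sw w \<in> ops"
  by (induction w) (simp_all add: word_prod_bounded_operators_Cons ops_closed)

lemma sw_linear [simp]: "sw w (c *\<^sub>C x) = c *\<^sub>C sw w x"
  using sw_carrier[of w] unfolding ops_iff by blast

lemma sum_level: "(\<Sum>w | length w = n. sw w (adjoint_op (sw w) x)) = x"
proof (induction n arbitrary: x)
  case 0
  have "adjoint_op (id_blinfun :: 'h \<Rightarrow>\<^sub>L 'h) = id_blinfun"
    by (rule adjoint_eqI) (simp_all add: ops_closed)
  then show ?case by simp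
next
  case (Suc n)
  have "(\<Sum>w | length w = Suc n. sw w (adjoint_op (sw w) x)) =
    (\<Sum>i\<in>UNIV. s i (\<Sum>w | length w = n.
       sw w (adjoint_op (sw w) (adjoint_op (s i) x))))"
    by (simp add: sum_length_Suc word_prod_bounded_operators_Cons adjoint_compose blinfun.sum_right)
  also have "\<dots> = (\<Sum>i\<in>UNIV. s i o\<^sub>L adjoint_op (s i)) x"
    by (simp add: Suc blinfun.sum_left)
  finally show ?case by (simp add: s_unit)
qed

lemma norm_sq_level:
  "(\<Sum>w | w \<in> L \<and> length w = n. (norm (adjoint_op (sw w) x))\<^sup>2) = (norm x)\<^sup>2"
proof -
  have zero: "adjoint_op (sw w) = 0" if "w \<notin> L" for w
    by (rule adjoint_eqI) (simp_all add: s_zero[OF that] ops_closed)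
  have "(\<Sum>w | w \<in> L \<and> length w = n. (norm (adjoint_op (sw w) x))\<^sup>2) =
      (\<Sum>w | length w = n. (norm (adjoint_op (sw w) x))\<^sup>2)"
  proof (rule sum.mono_neutral_left)
    show "\<forall>w\<in>{w. length w = n} - {w. w \<in> L \<and> length w = n}.
        (norm (adjoint_op (sw w) x))\<^sup>2 = 0"
    proof
      fix w assume "w \<in> {w. length w = n} - {w. w \<in> L \<and> length w = n}"
      then have "w \<notin> L" by blast
      then show "(norm (adjoint_op (sw w) x))\<^sup>2 = 0" by (simp add: zero)
    qed
  qed auto
  also have "\<dots> = Re (cinner x x)"
    by (subst norm_sq_sum_cinner) (simp_all add: sum_level)
  finally show ?thesis by (simp add: norm_sq_eq_cinner)
qed

lemma norm_sq_short_words: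
  "(\<Sum>w\<in>short_words n. (norm (adjoint_op (sw w) x))\<^sup>2) = real n * (norm x)\<^sup>2"
proof (induction n)
  case (Suc n)
  have "short_words (Suc n) = short_words n \<union> {w. w \<in> L \<and> length w = n}"
    by (auto simp: short_words_def)
  moreover have "finite {w. w \<in> L \<and> length w = n}"
    by (rule finite_subset[OF _ finite_length_eq[of n]]) auto
  moreover have "short_words n \<inter> {w. w \<in> L \<and> length w = n} = {}"
    by (auto simp: short_words_def)
  ultimately show ?case
    using Suc by (simp add: sum.union_disjoint norm_sq_level algebra_simps)
qed (simp add: short_words_def)

text \<open>
  The first relation resolves the identity as \<open>1 = \<Sum> s\<^sub>w s\<^sub>w\<^sup>*\<close> over all words of length \<open>k\<close>.
  After multiplication by \<open>s\<^sub>i\<close> only the words \<open>w\<close> with \<open>i w\<close> allowed remain, which are those of the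
  formula for \<open>s\<^sub>i\<^sup>* s\<^sub>i\<close>.
\<close>

lemma s_partial_isometry:
  "s i (adjoint_op (s i) (s i x)) = s i x"
proof -
  let ?t = "\<lambda>w. sw w (adjoint_op (sw w) x)"
  have "adjoint_op (s i) (s i x) =
      (adjoint_op (s i) o\<^sub>L s i) x" by simp
  also have "\<dots> = (\<Sum>w | w \<in> L \<and> length w = k \<and> i # w \<in> L. ?t w)"
    unfolding s_initial by (simp add: blinfun.sum_left)
  finally have "s i (adjoint_op (s i) (s i x)) =
      (\<Sum>w | w \<in> L \<and> length w = k \<and> i # w \<in> L. s i (?t w))"
    by (simp add: blinfun.sum_right)
  also have "\<dots> = (\<Sum>w | length w = k. s i (?t w))"
  proof (rule sum.mono_neutral_left)
    show "\<forall>w\<in>{w. length w = k} - {w. w \<in> L \<and> length w = k \<and> i # w \<in> L}. s i (?t w) = 0"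
    proof
      fix w assume "w \<in> {w. length w = k} - {w. w \<in> L \<and> length w = k \<and> i # w \<in> L}"
      then have "i # w \<notin> L" using ConsD by blast
      then have "s i o\<^sub>L sw w = 0" using s_zero by (simp flip: word_prod_bounded_operators_Cons)
      then show "s i (?t w) = 0"
        by (metis blinfun_apply_blinfun_compose zero_blinfun.rep_eq)
    qed
  qed auto
  also have "\<dots> = s i x"
    by (simp add: sum_level flip: blinfun.sum_right)
  finally show ?thesis .
qed

text \<open>
  By the first relation \<open>\<Sum> \<parallel>s\<^sub>j\<^sup>* s\<^sub>i x\<parallel>\<^sup>2 = \<parallel>s\<^sub>i x\<parallel>\<^sup>2\<close>, summed over \<open>j\<close>, and the term with \<open>j = i\<close>
  already exhausts the right-hand side.
\<close>

lemma s_orthogonal: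
  assumes "j \<noteq> i"
  shows "adjoint_op (s j) (s i x) = 0"
proof -
  let ?n = "\<lambda>j. (norm (adjoint_op (s j) (s i x)))\<^sup>2"
  have "(\<Sum>j\<in>UNIV. ?n j) = Re (cinner ((\<Sum>i\<in>UNIV. s i o\<^sub>L adjoint_op (s i)) (s i x)) (s i x))"
    by (subst norm_sq_sum_cinner) (simp_all add: blinfun.sum_left)
  also have "\<dots> = (norm (s i x))\<^sup>2"
    by (simp add: s_unit norm_sq_eq_cinner)
  also have "\<dots> = ?n i"
    unfolding norm_sq_eq_cinner
    by (simp add: s_partial_isometry flip: cinner_adjoint)
  finally have "(\<Sum>j\<in>UNIV. ?n j) = ?n i" .
  moreover have "(\<Sum>j\<in>UNIV. ?n j) = ?n i + (\<Sum>j\<in>UNIV - {i}. ?n j)"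
    by (rule sum.remove) auto
  ultimately have "(\<Sum>j\<in>UNIV - {i}. ?n j) = 0" by simp
  then have "?n j = 0" using assms by (subst (asm) sum_nonneg_eq_0_iff) auto
  then show ?thesis by simp
qed

text \<open>
  The projection \<open>s\<^sub>i\<^sup>* s\<^sub>i\<close> is a sum of positive operators \<open>s\<^sub>w s\<^sub>w\<^sup>*\<close>, so each \<open>s\<^sub>w\<^sup>*\<close> in it vanishes on
  the kernel of the projection.
\<close>

lemma initial_projection_word_level:
  assumes w: "i # w \<in> L" "length w = k"
  shows "adjoint_op (s i) (s i (sw w x)) = sw w x"
proof (rule cinner_ext)
  fix y
  let ?q = "\<lambda>y. adjoint_op (s i) (s i y)"
  let ?E = "{w. w \<in> L \<and> length w = k \<and> i # w \<in> L}"
  define d where "d = y - ?q y"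
  have s_q: "?q d = 0"
    by (simp add: d_def blinfun.diff_right s_partial_isometry)
  have "(\<Sum>v\<in>?E. (norm (adjoint_op (sw v) d))\<^sup>2) = Re (cinner ((adjoint_op (s i) o\<^sub>L s i) d) d)"
    unfolding s_initial by (subst norm_sq_sum_cinner) (simp_all add: blinfun.sum_left)
  also have "\<dots> = 0" using s_q by simp
  finally have sum0: "(\<Sum>v\<in>?E. (norm (adjoint_op (sw v) d))\<^sup>2) = 0" .
  have "finite ?E" by (rule finite_subset[OF _ finite_length_eq[of k]]) auto
  then have "adjoint_op (sw w) d = 0"
    using sum0 w ConsD[OF w(1)] by (subst (asm) sum_nonneg_eq_0_iff) auto
  then have "adjoint_op (sw w) y = adjoint_op (sw w) (?q y)"
    by (simp add: d_def blinfun.diff_right)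
  then show "cinner (?q (sw w x)) y = cinner (sw w x) y"
    by (simp add: cinner_adjoint cinner_adjoint')
qed

lemma initial_projection_word:
  assumes w: "i # w \<in> L" "k \<le> length w"
  shows "adjoint_op (s i) (s i (sw w x)) = sw w x"
proof -
  have "sw w = sw (take k w) o\<^sub>L sw (drop k w)"
    by (simp flip: word_prod_bounded_operators_append)
  moreover have "i # take k w \<in> L"
    using appendD(1)[of "i # take k w" "drop k w"] w(1) by simp
  ultimately show ?thesis
    using initial_projection_word_level[of i "take k w"] w(2) by simp
qed

end

section \<open>A bound for operator matrices\<close>

text \<open>
  The bound is that of \<open>z \<otimes> 1\<close> on the vectors \<open>\<Sum> e\<^sub>w \<otimes> g\<^sub>w\<close> and \<open>\<Sum> e\<^sub>v \<otimes> h\<^sub>v\<close> of a Hilbert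
  space tensor product. An orthonormal basis of the span of the finitely many vectors
  \<open>g\<^sub>w\<close> and \<open>h\<^sub>v\<close> reduces it to the bound for \<open>z\<close>.
\<close>

lemma (in language_basis) norm_matrix_form_le:
  fixes g h :: "'d list \<Rightarrow> 'h::complex_hilbert_space"
  assumes z: "z \<in> ops"
    and A: "finite A" "A \<subseteq> L" and B: "finite B" "B \<subseteq> L"
  shows "cmod (\<Sum>v\<in>A. \<Sum>w\<in>B. cinner (z (e w)) (e v) * cinner (g w) (h v))
    \<le> norm z * (sqrt (\<Sum>w\<in>B. (norm (g w))\<^sup>2) * sqrt (\<Sum>v\<in>A. (norm (h v))\<^sup>2))"
proof -
  have "finite (g ` B \<union> h ` A)" using A(1) B(1) by simp
  from finite_orthonormal_expansion[OF this] obtain U where U: "finite U"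
    and exp: "\<And>x. x \<in> g ` B \<union> h ` A \<Longrightarrow> x = (\<Sum>b\<in>U. cinner x b *\<^sub>C b)" by blast
  define G where "G b = (\<Sum>w\<in>B. cinner (g w) b *\<^sub>C e w)" for b
  define H where "H b = (\<Sum>v\<in>A. cinner (h v) b *\<^sub>C e v)" for b
  have zlin: "z (c *\<^sub>C x) = c *\<^sub>C z x" for c x
    using z unfolding ops_iff by blast
  have parseval: "(\<Sum>b\<in>U. (cmod (cinner x b))\<^sup>2) = (norm x)\<^sup>2" if "x \<in> g ` B \<union> h ` A" for x
  proof -
    have "complex_of_real ((norm x)\<^sup>2) = (\<Sum>b\<in>U. cinner x b * cnj (cinner x b))"
      unfolding cinner_norm[symmetric] by (rule cinner_finite_expansion[OF exp[OF that]])
    also have "\<dots> = complex_of_real (\<Sum>b\<in>U. (cmod (cinner x b))\<^sup>2)"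
      unfolding of_real_sum by (intro sum.cong refl) (simp flip: complex_norm_square of_real_power)
    finally show ?thesis by (simp only: of_real_eq_iff)
  qed
  have normG: "(\<Sum>b\<in>U. (norm (G b))\<^sup>2) = (\<Sum>w\<in>B. (norm (g w))\<^sup>2)"
    unfolding G_def norm_sum_basis_sq[OF B] by (subst sum.swap) (simp add: parseval)
  have normH: "(\<Sum>b\<in>U. (norm (H b))\<^sup>2) = (\<Sum>v\<in>A. (norm (h v))\<^sup>2)"
    unfolding H_def norm_sum_basis_sq[OF A] by (subst sum.swap) (simp add: parseval)
  have "(\<Sum>v\<in>A. \<Sum>w\<in>B. cinner (z (e w)) (e v) * cinner (g w) (h v)) =
      (\<Sum>v\<in>A. \<Sum>w\<in>B. \<Sum>b\<in>U. cinner (g w) b * (cnj (cinner (h v) b) * cinner (z (e w)) (e v)))"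
  proof (intro sum.cong refl)
    fix v w assume "v \<in> A" "w \<in> B"
    then have "cinner (g w) (h v) = (\<Sum>b\<in>U. cinner (g w) b * cnj (cinner (h v) b))"
      by (intro cinner_finite_expansion exp) blast
    then show "cinner (z (e w)) (e v) * cinner (g w) (h v) =
        (\<Sum>b\<in>U. cinner (g w) b * (cnj (cinner (h v) b) * cinner (z (e w)) (e v)))"
      by (simp add: sum_distrib_left mult_ac)
  qed
  also have "\<dots> = (\<Sum>b\<in>U. \<Sum>v\<in>A. \<Sum>w\<in>B. cinner (g w) b * (cnj (cinner (h v) b) * cinner (z (e w)) (e v)))"
    by (simp add: sum.swap[of _ U])
  also have "\<dots> = (\<Sum>b\<in>U. cinner (z (G b)) (H b))"
    by (intro sum.cong refl)
       (simp add: G_def H_def blinfun.sum_right zlin cinner_sum_right cinner_sum_left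
         cinner_scaleC_left cinner_scaleC_right sum_distrib_left mult_ac)
  also have "cmod \<dots> \<le> (\<Sum>b\<in>U. norm z * (norm (G b) * norm (H b)))"
  proof (rule sum_norm_le)
    fix b
    have "cmod (cinner (z (G b)) (H b)) \<le> norm (z (G b)) * norm (H b)"
      by (rule Cauchy_Schwarz_cinner)
    also have "\<dots> \<le> norm z * norm (G b) * norm (H b)"
      by (intro mult_right_mono norm_blinfun) simp
    finally show "cmod (cinner (z (G b)) (H b)) \<le> norm z * (norm (G b) * norm (H b))"
      by (simp add: mult.assoc)
  qed
  also have "\<dots> = norm z * (\<Sum>b\<in>U. norm (G b) * norm (H b))" by (simp add: sum_distrib_left)
  also have "\<dots> \<le> norm z * (sqrt (\<Sum>w\<in>B. (norm (g w))\<^sup>2) * sqrt (\<Sum>v\<in>A. (norm (h v))\<^sup>2))"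
    using L2_set_mult_ineq[of "\<lambda>b. norm (G b)" "\<lambda>b. norm (H b)" U]
    by (intro mult_left_mono) (simp_all add: L2_set_def normG normH)
  finally show ?thesis .
qed

section \<open>The intertwining relation\<close>

locale fock_representation =
  language_shifts L k e T + language_representation L k s
  for L :: "'d::finite list set" and k :: nat and e :: "'d list \<Rightarrow> 'f::complex_hilbert_space"
    and T :: "'d \<Rightarrow> ('f \<Rightarrow>\<^sub>L 'f)" and s :: "'d \<Rightarrow> ('h::complex_hilbert_space \<Rightarrow>\<^sub>L 'h)"
begin

text \<open>
  Write \<open>V\<^sub>B x = \<Sum> e\<^sub>w \<otimes> s\<^sub>w\<^sup>* x\<close>, summed over \<open>w\<close> in \<open>B\<close>. Then \<open>row B z x f\<close> is the inner product
  of \<open>(z \<otimes> 1) V\<^sub>B x\<close> with \<open>f\<close> in the first tensor factor, and \<open>transfer_op A B z\<close> below is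
  \<open>V\<^sub>A\<^sup>* (z \<otimes> 1) V\<^sub>B\<close>.
\<close>

definition row :: "'d list set \<Rightarrow> ('f \<Rightarrow>\<^sub>L 'f) \<Rightarrow> 'h \<Rightarrow> 'f \<Rightarrow> 'h" where
  "row B z x f = (\<Sum>w\<in>B. cinner (z (e w)) f *\<^sub>C adjoint_op (sw w) x)"

definition transfer_op :: "'d list set \<Rightarrow> 'd list set \<Rightarrow> ('f \<Rightarrow>\<^sub>L 'f) \<Rightarrow> ('h \<Rightarrow>\<^sub>L 'h)" where
  "transfer_op A B z = (\<Sum>v\<in>A. \<Sum>w\<in>B.
     cinner (z (e w)) (e v) \<cdot> (sw v o\<^sub>L adjoint_op (sw w)))"

lemma transfer_op_apply:
  "transfer_op A B z x = (\<Sum>v\<in>A. sw v (row B z x (e v)))"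
  unfolding transfer_op_def row_def by (simp add: blinfun.sum_left blinfun.sum_right)

lemma row_zero [simp]: "row B z x 0 = 0"
  by (simp add: row_def)

lemma row_compose:
  "X \<in> ops \<Longrightarrow> row B (X o\<^sub>L z) x f = row B z x (adjoint_op X f)"
  by (simp add: row_def cinner_adjoint)

lemma transfer_op_union:
  "finite A \<Longrightarrow> finite A' \<Longrightarrow> A \<inter> A' = {} \<Longrightarrow>
    transfer_op (A \<union> A') B z = transfer_op A B z + transfer_op A' B z"
  by (rule blinfun_eqI) (simp add: transfer_op_apply sum.union_disjoint blinfun.add_left)

lemma transfer_op_add: "transfer_op A B (z + z') = transfer_op A B z + transfer_op A B z'"
  by (rule blinfun_eqI)
     (simp add: transfer_op_apply row_def blinfun.add_left blinfun.add_right cinner_add_left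
       scaleC_add_left sum.distrib)

lemma transfer_op_smult:
  "transfer_op A B (c \<cdot> z) = c \<cdot> transfer_op A B z"
  by (rule blinfun_eqI)
     (simp add: transfer_op_apply row_def cinner_scaleC_left blinfun.sum_right scaleC_sum_right
        flip: scaleC_scaleC)

lemma norm_transfer_op_le:
  assumes z: "z \<in> ops"
    and A: "finite A" "A \<subseteq> L" and B: "finite B" "B \<subseteq> L"
    and a: "\<And>x. (\<Sum>v\<in>A. (norm (adjoint_op (sw v) x))\<^sup>2) = a * (norm x)\<^sup>2"
    and b: "\<And>x. (\<Sum>w\<in>B. (norm (adjoint_op (sw w) x))\<^sup>2) = b * (norm x)\<^sup>2"
    and nonneg: "0 \<le> a" "0 \<le> b"
  shows "norm (transfer_op A B z) \<le> sqrt a * sqrt b * norm z"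
proof (rule norm_blinfun_bound)
  fix x
  show "norm (transfer_op A B z x) \<le> sqrt a * sqrt b * norm z * norm x"
  proof (rule cinner_norm_bound)
    fix y
    have "cinner (transfer_op A B z x) y = (\<Sum>v\<in>A. \<Sum>w\<in>B.
        cinner (z (e w)) (e v) *
        cinner (adjoint_op (sw w) x) (adjoint_op (sw v) y))"
      by (simp add: transfer_op_apply row_def cinner_sum_left cinner_adjoint cinner_scaleC_left)
    then have "cmod (cinner (transfer_op A B z x) y) \<le>
        norm z * (sqrt (b * (norm x)\<^sup>2) * sqrt (a * (norm y)\<^sup>2))"
      using norm_matrix_form_le[OF z A B, of "\<lambda>w. adjoint_op (sw w) x"
          "\<lambda>v. adjoint_op (sw v) y"]
      by (simp only: a b)
    also have "\<dots> = sqrt a * sqrt b * norm z * norm x * norm y"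
      by (simp add: real_sqrt_mult mult_ac)
    finally show "cmod (cinner (transfer_op A B z x) y) \<le>
        sqrt a * sqrt b * norm z * norm x * norm y" .
  qed (use nonneg in simp)
qed (use nonneg in simp)

definition level :: "nat \<Rightarrow> 'd list set" where
  "level n = {w \<in> L. length w = n}"

lemma finite_level [simp]: "finite (level n)"
  by (rule finite_subset[OF _ finite_length_eq[of n]]) (auto simp: level_def)

lemma short_words_Suc: "short_words (Suc n) = short_words n \<union> level n"
  by (auto simp: short_words_def level_def)

lemma short_words_level_disjoint: "short_words n \<inter> level n = {}"
  by (auto simp: short_words_def level_def)

lemma norm_transfer_short:
  assumes "z \<in> ops"
  shows "norm (transfer_op (short_words m) (short_words n) z) \<le> sqrt (real m) * sqrt (real n) * norm z"
  by (rule norm_transfer_op_le[OF assms])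
     (simp_all add: short_words_subset norm_sq_short_words)

lemma norm_transfer_level:
  assumes "z \<in> ops"
  shows "norm (transfer_op (level m) (short_words n) z) \<le> sqrt (real n) * norm z"
proof -
  have "norm (transfer_op (level m) (short_words n) z) \<le> sqrt 1 * sqrt (real n) * norm z"
    by (rule norm_transfer_op_le[OF assms])
       (simp_all add: short_words_subset norm_sq_short_words level_def norm_sq_level)
  then show ?thesis by simp
qed

text \<open>
  This is \<open>V\<^sub>n\<^sup>* (z \<otimes> 1) V\<^sub>n\<close>. The allowed words of each length contribute \<open>1\<close> to
  \<open>\<Sum> s\<^sub>w s\<^sub>w\<^sup>*\<close>, which explains the factor \<open>1 / n\<close>.
\<close>

definition average :: "nat \<Rightarrow> ('f \<Rightarrow>\<^sub>L 'f) \<Rightarrow> ('h \<Rightarrow>\<^sub>L 'h)" where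
  "average n z = (1 / real n) *\<^sub>R transfer_op (short_words n) (short_words n) z"

lemma norm_average_le:
  assumes "z \<in> ops"
  shows "norm (average n z) \<le> norm z"
proof (cases "n = 0")
  case False
  have "norm (transfer_op (short_words n) (short_words n) z) \<le> real n * norm z"
    using norm_transfer_short[OF assms, of n n] by simp
  then show ?thesis using False by (simp add: average_def field_simps)
qed (simp add: average_def)

lemma transfer_op_id: "transfer_op (short_words n) (short_words n) id_blinfun = real n *\<^sub>R id_blinfun"
proof (rule blinfun_eqI)
  fix x
  have row: "row (short_words n) id_blinfun x (e v) = adjoint_op (sw v) x"
    if "v \<in> short_words n" for v
  proof -
    have "row (short_words n) id_blinfun x (e v) =
        (\<Sum>w\<in>short_words n. if w = v then adjoint_op (sw v) x else 0)"
      unfolding row_def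
      by (intro sum.cong refl) (use that in \<open>auto simp: cinner_basis short_words_def\<close>)
    then show ?thesis using that by simp
  qed
  have "transfer_op (short_words n) (short_words n) id_blinfun x =
      (\<Sum>v\<in>short_words n. sw v (adjoint_op (sw v) x))"
    unfolding transfer_op_apply by (intro sum.cong refl) (simp add: row)
  also have "\<dots> = real n *\<^sub>R x"
  proof (induction n)
    case (Suc n)
    have "(\<Sum>v\<in>level n. sw v (adjoint_op (sw v) x)) =
        (\<Sum>v | length v = n. sw v (adjoint_op (sw v) x))"
    proof (rule sum.mono_neutral_left)
      show "\<forall>v\<in>{v. length v = n} - level n. sw v (adjoint_op (sw v) x) = 0"
      proof
        fix v assume "v \<in> {v. length v = n} - level n"
        then have "v \<notin> L" by (auto simp: level_def)
        then show "sw v (adjoint_op (sw v) x) = 0" by (simp add: s_zero)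
      qed
    qed (auto simp: level_def)
    then show ?case
      using Suc short_words_level_disjoint
      by (simp add: short_words_Suc sum.union_disjoint sum_level scaleR_add_left)
  qed (simp add: short_words_def)
  finally show "transfer_op (short_words n) (short_words n) id_blinfun x =
      (real n *\<^sub>R id_blinfun) x" by (simp add: blinfun.scaleR_left)
qed

lemma average_id: "0 < n \<Longrightarrow> average n id_blinfun = id_blinfun"
  by (simp add: average_def transfer_op_id)

text \<open>
  The defect is the distance between \<open>V\<^sub>n\<^sup>* (x \<otimes> 1)\<close> and \<open>y V\<^sub>n\<^sup>*\<close>, tested on the operators
  \<open>(z \<otimes> 1) V\<^sub>n\<close>. Testing on all \<open>z\<close> is what makes the relation multiplicative.
\<close>

definition defect_le :: "nat \<Rightarrow> real \<Rightarrow> ('f \<Rightarrow>\<^sub>L 'f) \<Rightarrow> ('h \<Rightarrow>\<^sub>L 'h) \<Rightarrow> bool" where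
  "defect_le n \<delta> x y \<longleftrightarrow> (\<forall>z\<in>ops. norm (average n (x o\<^sub>L z) - (y o\<^sub>L average n z)) \<le> \<delta> * norm z)"

definition intertwines :: "('f \<Rightarrow>\<^sub>L 'f) \<Rightarrow> ('h \<Rightarrow>\<^sub>L 'h) \<Rightarrow> bool" where
  "intertwines x y \<longleftrightarrow> (\<forall>\<delta>>0. \<forall>\<^sub>F n in sequentially. defect_le n \<delta> x y)"

lemma average_add: "average n (x + y) = average n x + average n y"
  by (simp add: average_def transfer_op_add scaleR_add_right)

lemma average_smult: "average n (c \<cdot> z) = c \<cdot> average n z"
  by (rule blinfun_eqI)
     (simp add: average_def transfer_op_smult blinfun.scaleR_left scaleR_scaleC scaleC_scaleC mult.commute)

lemma defect_le_mono: "defect_le n a x y \<Longrightarrow> a \<le> b \<Longrightarrow> defect_le n b x y"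
  unfolding defect_le_def by (meson mult_right_mono norm_ge_zero order_trans)

lemma defect_le_add:
  assumes "defect_le n a x y" "defect_le n b x' y'"
  shows "defect_le n (a + b) (x + x') (y + y')"
  unfolding defect_le_def
proof
  fix z :: "'f \<Rightarrow>\<^sub>L 'f" assume z: "z \<in> ops"
  have "(x + x') o\<^sub>L z = (x o\<^sub>L z) + (x' o\<^sub>L z)"
    by (rule blinfun_eqI) (simp add: blinfun.add_left)
  then have eq: "average n ((x + x') o\<^sub>L z) - ((y + y') o\<^sub>L average n z) =
      (average n (x o\<^sub>L z) - (y o\<^sub>L average n z)) + (average n (x' o\<^sub>L z) - (y' o\<^sub>L average n z))"
    by (intro blinfun_eqI) (simp add: average_add blinfun.diff_left blinfun.add_left)
  show "norm (average n ((x + x') o\<^sub>L z) - ((y + y') o\<^sub>L average n z)) \<le> (a + b) * norm z"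
    unfolding eq distrib_right using assms z unfolding defect_le_def
    by (intro norm_triangle_le add_mono) blast+
qed

lemma defect_le_smult:
  assumes "defect_le n a x y"
  shows "defect_le n (cmod c * a) (c \<cdot> x) (c \<cdot> y)"
  unfolding defect_le_def
proof
  fix z :: "'f \<Rightarrow>\<^sub>L 'f" assume z: "z \<in> ops"
  let ?d = "average n (x o\<^sub>L z) - (y o\<^sub>L average n z)"
  have "(c \<cdot> x) o\<^sub>L z = c \<cdot> (x o\<^sub>L z)" by (rule blinfun_eqI) simp
  then have eq: "average n ((c \<cdot> x) o\<^sub>L z) - ((c \<cdot> y) o\<^sub>L average n z) = c \<cdot> ?d"
    by (intro blinfun_eqI) (simp add: average_smult blinfun.diff_left scaleC_diff_right)
  have "norm (c \<cdot> ?d) \<le> cmod c * norm ?d"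
    by (rule norm_blinfun_bound) (simp_all add: norm_blinfun mult.assoc mult_left_mono)
  also have "\<dots> \<le> cmod c * (a * norm z)"
    using assms z unfolding defect_le_def by (intro mult_left_mono) simp_all
  finally show "norm (average n ((c \<cdot> x) o\<^sub>L z) - ((c \<cdot> y) o\<^sub>L average n z)) \<le> cmod c * a * norm z"
    unfolding eq by (simp add: mult.assoc)
qed

lemma defect_le_mult:
  assumes xy: "defect_le n a x y" and xy': "defect_le n b x' y'" and x': "x' \<in> ops" and a: "0 \<le> a"
  shows "defect_le n (a * norm x' + norm y * b) (x o\<^sub>L x') (y o\<^sub>L y')"
  unfolding defect_le_def
proof
  fix z :: "'f \<Rightarrow>\<^sub>L 'f" assume z: "z \<in> ops"
  have xz: "x' o\<^sub>L z \<in> ops" using x' z by (simp add: ops_closed)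
  let ?d = "average n (x' o\<^sub>L z) - (y' o\<^sub>L average n z)"
  let ?e = "average n (x o\<^sub>L (x' o\<^sub>L z)) - (y o\<^sub>L average n (x' o\<^sub>L z))"
  have "(x o\<^sub>L x') o\<^sub>L z = x o\<^sub>L (x' o\<^sub>L z)" by (rule blinfun_eqI) simp
  then have eq: "average n ((x o\<^sub>L x') o\<^sub>L z) - ((y o\<^sub>L y') o\<^sub>L average n z) = ?e + (y o\<^sub>L ?d)"
    by (intro blinfun_eqI) (simp add: blinfun.diff_left blinfun.add_left blinfun.diff_right)
  have "norm ?e \<le> a * norm (x' o\<^sub>L z)" using xy xz unfolding defect_le_def by blast
  also have "\<dots> \<le> a * (norm x' * norm z)" by (rule mult_left_mono[OF norm_blinfun_compose a])
  finally have 1: "norm ?e \<le> a * norm x' * norm z" by (simp add: mult.assoc)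
  have "norm (y o\<^sub>L ?d) \<le> norm y * norm ?d" by (rule norm_blinfun_compose)
  also have "\<dots> \<le> norm y * (b * norm z)"
    using xy' z unfolding defect_le_def by (intro mult_left_mono) simp_all
  finally have 2: "norm (y o\<^sub>L ?d) \<le> norm y * b * norm z" by (simp add: mult.assoc)
  show "norm (average n ((x o\<^sub>L x') o\<^sub>L z) - ((y o\<^sub>L y') o\<^sub>L average n z))
      \<le> (a * norm x' + norm y * b) * norm z"
    unfolding eq distrib_right by (rule norm_triangle_le[OF add_mono[OF 1 2]])
qed

lemma defect_le_norm:
  assumes x: "x \<in> ops"
  shows "defect_le n (norm x + norm y) x y"
  unfolding defect_le_def
proof
  fix z :: "'f \<Rightarrow>\<^sub>L 'f" assume z: "z \<in> ops"
  have "norm (average n (x o\<^sub>L z)) \<le> norm x * norm z"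
    using norm_average_le[of "x o\<^sub>L z" n] norm_blinfun_compose[of x z] x z by (simp add: ops_closed)
  moreover have "norm (y o\<^sub>L average n z) \<le> norm y * norm z"
    by (rule order_trans[OF norm_blinfun_compose mult_left_mono[OF norm_average_le[OF z]]]) simp
  ultimately show "norm (average n (x o\<^sub>L z) - (y o\<^sub>L average n z)) \<le> (norm x + norm y) * norm z"
    using norm_triangle_ineq4[of "average n (x o\<^sub>L z)" "y o\<^sub>L average n z"] by (simp add: distrib_right)
qed

text \<open>
  Without the factor \<open>1 / n\<close>, an error supported on boundedly many word lengths has norm of order
  \<open>sqrt n\<close>.
\<close>

lemma intertwines_sqrt:
  assumes bound: "\<And>n z. n > n0 \<Longrightarrow> z \<in> ops \<Longrightarrow>
    norm (transfer_op (short_words n) (short_words n) (x o\<^sub>L z)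
      - (y o\<^sub>L transfer_op (short_words n) (short_words n) z)) \<le> C * sqrt (real n) * norm z"
  shows "intertwines x y"
  unfolding intertwines_def
proof (intro allI impI)
  fix \<delta> :: real assume "0 < \<delta>"
  have "((\<lambda>n. C / sqrt (real n)) \<longlongrightarrow> 0) sequentially"
    by (intro tendsto_divide_0[OF tendsto_const] filterlim_at_top_imp_at_infinity
        filterlim_compose[OF sqrt_at_top filterlim_real_sequentially])
  then have "\<forall>\<^sub>F n in sequentially. C / sqrt (real n) < \<delta>"
    by (rule order_tendstoD) fact
  with eventually_gt_at_top[of n0] show "\<forall>\<^sub>F n in sequentially. defect_le n \<delta> x y"
  proof eventually_elim
    case (elim n)
    have "defect_le n (C / sqrt (real n)) x y"
      unfolding defect_le_def
    proof
      fix z :: "'f \<Rightarrow>\<^sub>L 'f" assume z: "z \<in> ops"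
      have n: "0 < real n" using elim(1) by simp
      have "average n (x o\<^sub>L z) - (y o\<^sub>L average n z) =
        (1 / real n) *\<^sub>R (transfer_op (short_words n) (short_words n) (x o\<^sub>L z)
          - (y o\<^sub>L transfer_op (short_words n) (short_words n) z))"
        by (rule blinfun_eqI)
           (simp add: average_def blinfun.diff_left blinfun.scaleR_left blinfun.scaleR_right scaleR_diff_right)
      then have "norm (average n (x o\<^sub>L z) - (y o\<^sub>L average n z)) \<le> (1 / real n) * (C * sqrt (real n) * norm z)"
        using bound[OF elim(1) z] by (simp add: divide_right_mono)
      also have "\<dots> = C / sqrt (real n) * norm z"
        using n real_sqrt_mult_self[of "real n"] by (simp add: field_simps)
      finally show "norm (average n (x o\<^sub>L z) - (y o\<^sub>L average n z)) \<le> C / sqrt (real n) * norm z" .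
    qed
    then show ?case by (rule defect_le_mono) (use elim(2) in simp)
  qed
qed

lemma intertwines_approx:
  assumes x: "x \<in> ops"
    and approx: "\<And>\<delta>. 0 < \<delta> \<Longrightarrow> \<exists>x'\<in>ops. \<exists>y'. intertwines x' y' \<and> norm (x - x') \<le> \<delta> \<and> norm (y - y') \<le> \<delta>"
  shows "intertwines x y"
  unfolding intertwines_def
proof (intro allI impI)
  fix \<delta> :: real assume "0 < \<delta>"
  then have \<delta>: "0 < \<delta> / 3" by simp
  from approx[OF this] obtain x' y' where x': "x' \<in> ops" "intertwines x' y'"
    and near: "norm (x - x') \<le> \<delta> / 3" "norm (y - y') \<le> \<delta> / 3" by blast
  have "\<forall>\<^sub>F n in sequentially. defect_le n (\<delta> / 3) x' y'"
    using x'(2) \<delta> unfolding intertwines_def by blast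
  then show "\<forall>\<^sub>F n in sequentially. defect_le n \<delta> x y"
  proof eventually_elim
    case (elim n)
    have "defect_le n (\<delta> / 3 + (norm (x - x') + norm (y - y'))) (x' + (x - x')) (y' + (y - y'))"
      by (rule defect_le_add[OF elim defect_le_norm]) (simp add: ops_closed x x'(1))
    then show ?case using near by (auto elim: defect_le_mono)
  qed
qed

lemma intertwines_add:
  assumes "intertwines x y" "intertwines x' y'"
  shows "intertwines (x + x') (y + y')"
  unfolding intertwines_def
proof (intro allI impI)
  fix \<delta> :: real assume "0 < \<delta>"
  then have "0 < \<delta> / 2" by simp
  then have "\<forall>\<^sub>F n in sequentially. defect_le n (\<delta> / 2) x y" "\<forall>\<^sub>F n in sequentially. defect_le n (\<delta> / 2) x' y'"
    using assms unfolding intertwines_def by blast+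
  then show "\<forall>\<^sub>F n in sequentially. defect_le n \<delta> (x + x') (y + y')"
  proof eventually_elim
    case (elim n)
    show ?case using defect_le_add[OF elim] by simp
  qed
qed

lemma intertwines_smult:
  assumes "intertwines x y"
  shows "intertwines (c \<cdot> x) (c \<cdot> y)"
  unfolding intertwines_def
proof (intro allI impI)
  fix \<delta> :: real assume \<delta>: "0 < \<delta>"
  define a where "a = \<delta> / (cmod c + 1)"
  have c: "0 < cmod c + 1" by (simp add: add_nonneg_pos)
  then have a: "0 < a" "cmod c * a \<le> \<delta>" using \<delta> by (simp_all add: a_def field_simps)
  have "\<forall>\<^sub>F n in sequentially. defect_le n a x y" using assms a(1) unfolding intertwines_def by blast
  then show "\<forall>\<^sub>F n in sequentially. defect_le n \<delta> (c \<cdot> x) (c \<cdot> y)"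
    by eventually_elim (rule defect_le_mono[OF defect_le_smult a(2)])
qed

lemma intertwines_mult:
  assumes "intertwines x y" "intertwines x' y'" and x': "x' \<in> ops"
  shows "intertwines (x o\<^sub>L x') (y o\<^sub>L y')"
  unfolding intertwines_def
proof (intro allI impI)
  fix \<delta> :: real assume \<delta>: "0 < \<delta>"
  define a where "a = \<delta> / (norm x' + norm y + 1)"
  have c: "0 < norm x' + norm y + 1" by (simp add: add_nonneg_pos)
  have a: "0 < a" using \<delta> c by (simp add: a_def)
  have "a * norm x' + norm y * a \<le> a * (norm x' + norm y + 1)"
    using a by (simp add: algebra_simps)
  then have le: "a * norm x' + norm y * a \<le> \<delta>" using c by (simp add: a_def)
  have "\<forall>\<^sub>F n in sequentially. defect_le n a x y" "\<forall>\<^sub>F n in sequentially. defect_le n a x' y'"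
    using assms(1,2) a unfolding intertwines_def by blast+
  then show "\<forall>\<^sub>F n in sequentially. defect_le n \<delta> (x o\<^sub>L x') (y o\<^sub>L y')"
  proof eventually_elim
    case (elim n)
    show ?case by (rule defect_le_mono[OF defect_le_mult[OF elim x'] le]) (use a in simp)
  qed
qed

lemma intertwines_id: "intertwines id_blinfun id_blinfun"
proof -
  have "id_blinfun o\<^sub>L z = z" for z :: "'h \<Rightarrow>\<^sub>L 'h" by (rule blinfun_eqI) simp
  moreover have "id_blinfun o\<^sub>L z = z" for z :: "'f \<Rightarrow>\<^sub>L 'f" by (rule blinfun_eqI) simp
  ultimately show ?thesis unfolding intertwines_def defect_le_def by simp
qed

text \<open>As \<open>average n\<close> is unital and contractive, \<open>y\<close> is the limit of \<open>average n x\<close>.\<close>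

lemma intertwines_norm_le:
  assumes "intertwines x y" and x: "x \<in> ops"
  shows "norm y \<le> norm x"
proof (rule field_le_epsilon)
  fix \<delta> :: real assume \<delta>: "0 < \<delta>"
  then have "\<forall>\<^sub>F n in sequentially. defect_le n \<delta> x y"
    using assms unfolding intertwines_def by blast
  with eventually_gt_at_top[of 0]
  have "\<forall>\<^sub>F n in sequentially. norm (average n x - y) \<le> \<delta>"
  proof eventually_elim
    case (elim n)
    have "norm (average n (x o\<^sub>L id_blinfun) - (y o\<^sub>L average n id_blinfun)) \<le> \<delta> * norm (id_blinfun :: 'f \<Rightarrow>\<^sub>L 'f)"
      using elim(2) ops_closed(1) unfolding defect_le_def by blast
    also have "\<dots> \<le> \<delta> * 1" using \<delta> by (intro mult_left_mono norm_blinfun_id_le) simp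
    also have "x o\<^sub>L id_blinfun = x" by (rule blinfun_eqI) simp
    also have "y o\<^sub>L average n id_blinfun = y"
      unfolding average_id[OF elim(1)] by (rule blinfun_eqI) simp
    finally show ?case by simp
  qed
  then obtain n where "norm (average n x - y) \<le> \<delta>"
    using eventually_happens'[OF sequentially_bot] by blast
  then show "norm y \<le> norm x + \<delta>"
    using norm_triangle_sub[of y "average n x"] norm_average_le[OF x, of n]
    by (simp add: norm_minus_commute)
qed

lemma intertwines_diff:
  assumes "intertwines x y" "intertwines x' y'"
  shows "intertwines (x - x') (y - y')"
proof -
  have "(- 1) \<cdot> x' = - x'" "(- 1) \<cdot> y' = - y'"
    by (rule blinfun_eqI, simp add: blinfun.minus_left)+
  then show ?thesis using intertwines_add[OF assms(1) intertwines_smult[OF assms(2), of "- 1"]] by simp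
qed

lemma intertwines_unique:
  assumes "intertwines x y" "intertwines x y'"
  shows "y = y'"
  using intertwines_norm_le[OF intertwines_diff[OF assms]] by (simp add: ops_closed)

end

context fock_representation
begin

lemma s_linear [simp]: "s i (c *\<^sub>C x) = c *\<^sub>C s i x"
  using s_carrier[of i] unfolding ops_iff by blast

lemma s_sw: "s i (sw w x) = sw (i # w) x"
  by (simp add: word_prod_bounded_operators_Cons)

lemma sum_short_words_Suc:
  fixes f :: "'d list \<Rightarrow> 'b::comm_monoid_add"
  assumes "\<And>w. w \<notin> L \<Longrightarrow> f w = 0"
  shows "(\<Sum>w\<in>short_words (Suc n). f w) = f [] + (\<Sum>j\<in>UNIV. \<Sum>w\<in>short_words n. f (j # w))"
proof -
  let ?C = "(\<lambda>(j, w). j # w) ` (UNIV \<times> short_words n)"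
  have "(\<Sum>w\<in>short_words (Suc n). f w) = (\<Sum>w\<in>insert [] ?C. f w)"
  proof (rule sum.mono_neutral_left)
    show "short_words (Suc n) \<subseteq> insert [] ?C"
    proof
      fix w assume w: "w \<in> short_words (Suc n)"
      show "w \<in> insert [] ?C"
      proof (cases w)
        case (Cons j u)
        then have "u \<in> short_words n" using w ConsD[of j u] by (simp add: short_words_def)
        then have "(j, u) \<in> UNIV \<times> short_words n" by simp
        then have "(\<lambda>(j, w). j # w) (j, u) \<in> ?C" by (rule imageI)
        then show ?thesis by (simp add: Cons)
      qed simp
    qed
    show "\<forall>w\<in>insert [] ?C - short_words (Suc n). f w = 0"
      using assms Nil_mem by (auto simp: short_words_def)
  qed simp
  also have "\<dots> = f [] + (\<Sum>w\<in>?C. f w)" by (subst sum.insert) auto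
  also have "(\<Sum>w\<in>?C. f w) = (\<Sum>j\<in>UNIV. \<Sum>w\<in>short_words n. f (j # w))"
    by (subst sum.reindex) (auto intro!: inj_onI simp: sum.cartesian_product case_prod_unfold)
  finally show ?thesis .
qed

text \<open>
  Both terms on the left reduce to sums of \<open>s\<^sub>i s\<^sub>w\<close>. In the first one \<open>i w\<close> is shorter than
  \<open>Suc n\<close>, in the second one \<open>w\<close> is, so the words \<open>w\<close> of length \<open>n\<close> are left over.
\<close>

lemma transfer_op_shift:
  "transfer_op (short_words (Suc n)) B (T i o\<^sub>L z) - (s i o\<^sub>L transfer_op (short_words (Suc n)) B z)
    = - (s i o\<^sub>L transfer_op (level n) B z)"
proof (rule blinfun_eqI)
  fix x
  let ?r = "\<lambda>w. row B z x (e w)"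
  let ?f = "\<lambda>w. sw w (row B (T i o\<^sub>L z) x (e w))"
  have "(\<Sum>w\<in>short_words (Suc n). ?f w) = ?f [] + (\<Sum>j\<in>UNIV. \<Sum>w\<in>short_words n. ?f (j # w))"
    by (rule sum_short_words_Suc) (simp add: s_zero)
  also have "?f [] = 0" using Nil_mem by (simp add: row_compose adjoint_T_basis)
  also have "(\<Sum>j\<in>UNIV. \<Sum>w\<in>short_words n. ?f (j # w)) =
      (\<Sum>j\<in>UNIV. if j = i then \<Sum>w\<in>short_words n. s i (sw w (?r w)) else 0)"
  proof (intro sum.cong refl)
    fix j
    have "?f (j # w) = (if j = i then s i (sw w (?r w)) else 0)"
      if "w \<in> short_words n" for w
    proof (cases "j # w \<in> L")
      case True
      then show ?thesis by (simp add: row_compose adjoint_T_basis s_sw)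
    qed (auto simp: s_zero s_sw)
    then show "(\<Sum>w\<in>short_words n. ?f (j # w)) =
        (if j = i then \<Sum>w\<in>short_words n. s i (sw w (?r w)) else 0)"
      by simp
  qed
  finally have "transfer_op (short_words (Suc n)) B (T i o\<^sub>L z) x =
      s i (transfer_op (short_words n) B z x)"
    by (simp add: transfer_op_apply blinfun.sum_right)
  then show "(transfer_op (short_words (Suc n)) B (T i o\<^sub>L z)
        - (s i o\<^sub>L transfer_op (short_words (Suc n)) B z)) x =
      (- (s i o\<^sub>L transfer_op (level n) B z)) x"
    using short_words_level_disjoint
    by (simp add: blinfun.diff_left blinfun.minus_left short_words_Suc transfer_op_union
        blinfun.add_left blinfun.add_right)
qed

text \<open>
  The error terms come from the words of maximal length, from the words \<open>w\<close> shorter than \<open>k\<close>, for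
  which \<open>s\<^sub>i\<^sup>* s\<^sub>i s\<^sub>w\<close> and \<open>s\<^sub>w\<close> may differ, and from the empty word: its
  basis vector is annihilated by \<open>T\<^sub>i\<^sup>*\<close>, whereas its product in the \<open>s\<^sub>j\<close> is \<open>1\<close>.
\<close>

lemma transfer_op_adjoint_shift:
  fixes i :: 'd
  assumes n: "k \<le> n"
  defines "q \<equiv> id_blinfun - (adjoint_op (s i) o\<^sub>L s i)"
  shows "transfer_op (short_words (Suc n)) B (adjoint_op (T i) o\<^sub>L z)
      - (adjoint_op (s i) o\<^sub>L transfer_op (short_words (Suc n)) B z)
    = transfer_op (level n) B (adjoint_op (T i) o\<^sub>L z)
      + (q o\<^sub>L transfer_op (short_words k) B (adjoint_op (T i) o\<^sub>L z))
      - (adjoint_op (s i) o\<^sub>L transfer_op (level 0) B z)"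
proof (rule blinfun_eqI)
  fix x
  let ?r = "\<lambda>w. row B (adjoint_op (T i) o\<^sub>L z) x (e w)"
  let ?f = "\<lambda>w. adjoint_op (s i) (sw w (row B z x (e w)))"
  have r: "?r w = (if i # w \<in> L then row B z x (e (i # w)) else 0)" if "w \<in> L" for w
    using that by (simp add: row_compose adjoint_carrier adjoint_adjoint T_basis)
  have level0: "level 0 = {[]}" using Nil_mem by (auto simp: level_def)
  have "(\<Sum>w\<in>short_words (Suc n). ?f w) = ?f [] + (\<Sum>j\<in>UNIV. \<Sum>w\<in>short_words n. ?f (j # w))"
    by (rule sum_short_words_Suc) (simp add: s_zero)
  also have "(\<Sum>j\<in>UNIV. \<Sum>w\<in>short_words n. ?f (j # w)) = (\<Sum>j\<in>UNIV. if j = i then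
      \<Sum>w\<in>short_words n. sw w (?r w) - (if length w < k then q (sw w (?r w)) else 0)
      else 0)"
  proof (intro sum.cong refl)
    fix j
    have "?f (j # w) = (if j = i then sw w (?r w)
        - (if length w < k then q (sw w (?r w)) else 0) else 0)"
      if w: "w \<in> short_words n" for w
    proof (cases "j # w \<in> L")
      case True
      then have wL: "w \<in> L" by (rule ConsD)
      show ?thesis
      proof (cases "j = i")
        case True
        then have iw: "i # w \<in> L" using \<open>j # w \<in> L\<close> by simp
        show ?thesis
        proof (cases "length w < k")
          case True
          then show ?thesis using \<open>j = i\<close> iw wL
            by (simp add: r q_def blinfun.diff_left flip: s_sw)
        next
          case False
          then show ?thesis using \<open>j = i\<close> iw wL initial_projection_word[OF iw, of "row B z x (e (i # w))"]
            by (simp add: r flip: s_sw)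
        qed
      next
        case False
        then show ?thesis by (simp add: s_orthogonal flip: s_sw)
      qed
    next
      case False
      then show ?thesis using w by (auto simp: s_zero r short_words_def)
    qed
    then show "(\<Sum>w\<in>short_words n. ?f (j # w)) = (if j = i then
      \<Sum>w\<in>short_words n. sw w (?r w) - (if length w < k then q (sw w (?r w)) else 0)
      else 0)" by simp
  qed
  also have "\<dots> = (\<Sum>w\<in>short_words n. sw w (?r w))
      - (\<Sum>w\<in>short_words n. if length w < k then q (sw w (?r w)) else 0)"
    by (simp add: sum_subtractf)
  also have "(\<Sum>w\<in>short_words n. if length w < k then q (sw w (?r w)) else 0) =
      (\<Sum>w\<in>short_words k. q (sw w (?r w)))"
    by (rule sum.mono_neutral_cong_right[OF finite_short_words]) (use n in \<open>auto simp: short_words_def\<close>)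
  finally have "adjoint_op (s i) (transfer_op (short_words (Suc n)) B z x) =
      adjoint_op (s i) (transfer_op (level 0) B z x)
      + (transfer_op (short_words n) B (adjoint_op (T i) o\<^sub>L z) x
      - q (transfer_op (short_words k) B (adjoint_op (T i) o\<^sub>L z) x))"
    by (simp add: transfer_op_apply blinfun.sum_right level0)
  then show "(transfer_op (short_words (Suc n)) B (adjoint_op (T i) o\<^sub>L z)
      - (adjoint_op (s i) o\<^sub>L transfer_op (short_words (Suc n)) B z)) x =
    (transfer_op (level n) B (adjoint_op (T i) o\<^sub>L z)
      + (q o\<^sub>L transfer_op (short_words k) B (adjoint_op (T i) o\<^sub>L z))
      - (adjoint_op (s i) o\<^sub>L transfer_op (level 0) B z)) x"
    using short_words_level_disjoint
    by (simp add: blinfun.diff_left short_words_Suc transfer_op_union blinfun.add_left)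
qed

lemma intertwines_shift: "intertwines (T i) (s i)"
proof (rule intertwines_sqrt[of 0 _ _ "norm (s i)"])
  fix n :: nat and z :: "'f \<Rightarrow>\<^sub>L 'f" assume n: "0 < n" and z: "z \<in> ops"
  then obtain m where m: "n = Suc m" using gr0_implies_Suc by blast
  have "norm (s i o\<^sub>L transfer_op (level m) (short_words n) z)
      \<le> norm (s i) * norm (transfer_op (level m) (short_words n) z)" by (rule norm_blinfun_compose)
  also have "\<dots> \<le> norm (s i) * (sqrt (real n) * norm z)"
    by (intro mult_left_mono norm_transfer_level z) simp
  finally show "norm (transfer_op (short_words n) (short_words n) (T i o\<^sub>L z)
      - (s i o\<^sub>L transfer_op (short_words n) (short_words n) z)) \<le> norm (s i) * sqrt (real n) * norm z"
    using transfer_op_shift[of m "short_words n" i z] by (simp only: m norm_minus_cancel mult.assoc)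
qed

lemma intertwines_adjoint_shift: "intertwines (adjoint_op (T i)) (adjoint_op (s i))"
proof -
  define t where "t = norm (adjoint_op (T i))"
  define q where "q = id_blinfun - (adjoint_op (s i) o\<^sub>L s i)"
  show ?thesis
  proof (rule intertwines_sqrt[of k _ _ "t + norm q * (sqrt (real k) * t) + norm (adjoint_op (s i))"])
    fix n :: nat and z :: "'f \<Rightarrow>\<^sub>L 'f" assume n: "k < n" and z: "z \<in> ops"
    then obtain m where m: "n = Suc m" "k \<le> m" by (cases n) auto
    let ?z = "adjoint_op (T i) o\<^sub>L z"
    have Tz: "?z \<in> ops"
      using z by (simp add: adjoint_carrier ops_closed)
    have nz: "norm ?z \<le> t * norm z" unfolding t_def by (rule norm_blinfun_compose)
    have 1: "norm (transfer_op (level m) (short_words n) ?z) \<le> sqrt (real n) * (t * norm z)"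
      by (rule order_trans[OF norm_transfer_level[OF Tz] mult_left_mono[OF nz]]) simp
    have "norm (q o\<^sub>L transfer_op (short_words k) (short_words n) ?z)
        \<le> norm q * norm (transfer_op (short_words k) (short_words n) ?z)" by (rule norm_blinfun_compose)
    also have "\<dots> \<le> norm q * (sqrt (real k) * sqrt (real n) * (t * norm z))"
      by (intro mult_left_mono order_trans[OF norm_transfer_short[OF Tz] mult_left_mono[OF nz]]) simp_all
    finally have 2: "norm (q o\<^sub>L transfer_op (short_words k) (short_words n) ?z)
        \<le> norm q * (sqrt (real k) * sqrt (real n) * (t * norm z))" .
    have "norm (adjoint_op (s i) o\<^sub>L transfer_op (level 0) (short_words n) z)
        \<le> norm (adjoint_op (s i)) * norm (transfer_op (level 0) (short_words n) z)" by (rule norm_blinfun_compose)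
    also have "\<dots> \<le> norm (adjoint_op (s i)) * (sqrt (real n) * norm z)"
      by (intro mult_left_mono norm_transfer_level z) simp
    finally have 3: "norm (adjoint_op (s i) o\<^sub>L transfer_op (level 0) (short_words n) z)
        \<le> norm (adjoint_op (s i)) * (sqrt (real n) * norm z)" .
    have "norm (transfer_op (short_words n) (short_words n) ?z
        - (adjoint_op (s i) o\<^sub>L transfer_op (short_words n) (short_words n) z))
      \<le> norm (transfer_op (level m) (short_words n) ?z) + norm (q o\<^sub>L transfer_op (short_words k) (short_words n) ?z)
        + norm (adjoint_op (s i) o\<^sub>L transfer_op (level 0) (short_words n) z)"
      unfolding m(1) transfer_op_adjoint_shift[OF m(2)] q_def
      by (rule order_trans[OF norm_triangle_ineq4 add_right_mono[OF norm_triangle_ineq]])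
    also have "\<dots> \<le> (t + norm q * (sqrt (real k) * t) + norm (adjoint_op (s i))) * sqrt (real n) * norm z"
      using 1 2 3 by (simp add: algebra_simps)
    finally show "norm (transfer_op (short_words n) (short_words n) ?z
        - (adjoint_op (s i) o\<^sub>L transfer_op (short_words n) (short_words n) z))
      \<le> (t + norm q * (sqrt (real k) * t) + norm (adjoint_op (s i))) * sqrt (real n) * norm z" .
  qed
qed

lemma transfer_op_proj:
  assumes "m \<le> n"
  shows "transfer_op (short_words n) B (proj m o\<^sub>L z) = transfer_op (short_words m) B z"
proof (rule blinfun_eqI)
  fix x
  have "transfer_op (short_words n) B (proj m o\<^sub>L z) x =
      (\<Sum>v\<in>short_words n. if length v < m then sw v (row B z x (e v)) else 0)"
    unfolding transfer_op_apply
    by (intro sum.cong refl) (auto simp: row_compose proj_basis short_words_def)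
  also have "\<dots> = transfer_op (short_words m) B z x"
    unfolding transfer_op_apply
    by (rule sum.mono_neutral_cong_right[OF finite_short_words]) (use assms in \<open>auto simp: short_words_def\<close>)
  finally show "transfer_op (short_words n) B (proj m o\<^sub>L z) x =
      transfer_op (short_words m) B z x" .
qed

text \<open>
  If \<open>K\<close> has its range in the span of the basis vectors for words shorter than \<open>m\<close>, then only \<open>m\<close> of
  the \<open>n\<close> word lengths contribute on the left. Compact operators are limits of such \<open>K\<close>.
\<close>

lemma intertwines_compact:
  assumes K: "K \<in> compacts"
  shows "intertwines K 0"
proof (rule intertwines_approx)
  have c: "K \<in> ops" by (rule compact_carrier[OF K])
  then show "K \<in> ops" .
  fix \<delta> :: real assume \<delta>: "0 < \<delta>"
  obtain m where m: "norm (K - (proj m o\<^sub>L K)) < \<delta>"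
    using LIMSEQ_D[OF compact_imp_proj_tendsto[OF K] \<delta>] by auto
  have "intertwines (proj m o\<^sub>L K) 0"
  proof (rule intertwines_sqrt[of m _ _ "sqrt (real m) * norm K"])
    fix n :: nat and z :: "'f \<Rightarrow>\<^sub>L 'f" assume n: "m < n" and z: "z \<in> ops"
    have "(proj m o\<^sub>L K) o\<^sub>L z = proj m o\<^sub>L (K o\<^sub>L z)" by (rule blinfun_eqI) simp
    moreover have "0 o\<^sub>L transfer_op (short_words n) (short_words n) z = 0" by (rule blinfun_eqI) simp
    moreover have "transfer_op (short_words n) (short_words n) (proj m o\<^sub>L (K o\<^sub>L z)) =
        transfer_op (short_words m) (short_words n) (K o\<^sub>L z)"
      by (rule transfer_op_proj) (use n in simp)
    moreover have "norm (transfer_op (short_words m) (short_words n) (K o\<^sub>L z)) \<le>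
        sqrt (real m) * sqrt (real n) * (norm K * norm z)"
      by (rule order_trans[OF norm_transfer_short mult_left_mono[OF norm_blinfun_compose]])
         (simp_all add: c z ops_closed)
    ultimately show "norm (transfer_op (short_words n) (short_words n) ((proj m o\<^sub>L K) o\<^sub>L z)
        - (0 o\<^sub>L transfer_op (short_words n) (short_words n) z)) \<le> sqrt (real m) * norm K * sqrt (real n) * norm z"
      by (simp add: mult_ac)
  qed
  moreover have "proj m o\<^sub>L K \<in> ops"
    by (simp add: c ops_closed)
  ultimately show "\<exists>x'\<in>ops. \<exists>y'.
      intertwines x' y' \<and> norm (K - x') \<le> \<delta> \<and> norm (0 - y') \<le> \<delta>"
    using m \<delta> by (intro bexI[of _ "proj m o\<^sub>L K"] exI[of _ 0]) simp_all
qed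

definition represents :: "('f \<Rightarrow>\<^sub>L 'f) \<Rightarrow> ('h \<Rightarrow>\<^sub>L 'h) \<Rightarrow> bool" where
  "represents x y \<longleftrightarrow> x \<in> ops \<and> y \<in> ops \<and>
     intertwines x y \<and> intertwines (adjoint_op x) (adjoint_op y)"

lemma represents_unique: "represents x y \<Longrightarrow> represents x y' \<Longrightarrow> y = y'"
  using intertwines_unique by (auto simp: represents_def)

lemma represents_id: "represents id_blinfun id_blinfun"
  by (simp add: represents_def adjoint_id intertwines_id ops_closed)

lemma represents_add: "represents x y \<Longrightarrow> represents x' y' \<Longrightarrow> represents (x + x') (y + y')"
  by (simp add: represents_def adjoint_add intertwines_add ops_closed)

lemma represents_mult: "represents x y \<Longrightarrow> represents x' y' \<Longrightarrow> represents (x o\<^sub>L x') (y o\<^sub>L y')"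
  by (simp add: represents_def adjoint_compose intertwines_mult adjoint_carrier ops_closed)

lemma represents_smult:
  "represents x y \<Longrightarrow> represents (c \<cdot> x) (c \<cdot> y)"
  by (simp add: represents_def adjoint_smult intertwines_smult ops_closed)

lemma represents_adjoint: "represents x y \<Longrightarrow> represents (adjoint_op x) (adjoint_op y)"
  by (simp add: represents_def adjoint_carrier adjoint_adjoint)

lemma represents_shift: "represents (T i) (s i)"
  by (simp add: represents_def intertwines_shift intertwines_adjoint_shift)

lemma represents_compact: "K \<in> compacts \<Longrightarrow> represents K 0"
proof -
  have "adjoint_op (0 :: 'h \<Rightarrow>\<^sub>L 'h) = 0"
    by (rule adjoint_eqI) (simp_all add: ops_closed)
  then show "represents K 0" if "K \<in> compacts"
    using that by (simp add: represents_def compact_carrier intertwines_compact compact_adjoint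
        ops_closed)
qed

text \<open>
  Differences satisfy \<open>\<parallel>Y m - Y n\<parallel> \<le> \<parallel>X m - X n\<parallel>\<close>, so the operators \<open>Y n\<close> converge as well.
\<close>

lemma represents_limit:
  assumes X: "\<And>n::nat. represents (X n) (Y n)" and x: "x \<in> ops"
    and lim: "X \<longlonglongrightarrow> x"
  shows "\<exists>y. represents x y"
proof -
  have Xc: "X n \<in> ops" and Yc: "Y n \<in> ops" for n
    using X[of n] by (auto simp: represents_def)
  have "norm (Y m - Y n) \<le> norm (X m - X n)" for m n
    by (rule intertwines_norm_le[OF intertwines_diff])
       (use X in \<open>auto simp: represents_def ops_closed\<close>)
  moreover have "Cauchy X" by (rule LIMSEQ_imp_Cauchy[OF lim])
  ultimately have "Cauchy Y"
    unfolding Cauchy_def dist_norm by (meson le_less_trans)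
  then obtain y where y: "Y \<longlonglongrightarrow> y" using Cauchy_convergent_iff convergent_def by blast
  have yc: "y \<in> ops"
    unfolding ops_iff
  proof (intro allI)
    fix c v
    have "(\<lambda>n. Y n (c *\<^sub>C v)) \<longlonglongrightarrow> y (c *\<^sub>C v)"
      by (intro tendsto_intros y)
    moreover have "(\<lambda>n. Y n (c *\<^sub>C v)) \<longlonglongrightarrow> c *\<^sub>C y v"
      using bounded_linear.tendsto[OF bounded_linear_scaleC blinfun.tendsto[OF y tendsto_const]] Yc
      by (simp add: ops_iff)
    ultimately show "y (c *\<^sub>C v) = c *\<^sub>C y v" by (rule LIMSEQ_unique)
  qed
  have near: "\<exists>n. norm (x - X n) \<le> \<delta> \<and> norm (y - Y n) \<le> \<delta>" if \<delta>: "0 < \<delta>" for \<delta>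
  proof -
    have "\<forall>\<^sub>F n in sequentially. dist (X n) x < \<delta> \<and> dist (Y n) y < \<delta>"
      using eventually_conj[OF tendstoD[OF lim \<delta>] tendstoD[OF y \<delta>]] .
    then obtain n where "dist (X n) x < \<delta>" "dist (Y n) y < \<delta>"
      using eventually_happens'[OF sequentially_bot] by blast
    then show ?thesis by (intro exI[of _ n]) (simp add: dist_norm norm_minus_commute)
  qed
  have "intertwines x y"
  proof (rule intertwines_approx[OF x])
    fix \<delta> :: real assume "0 < \<delta>"
    then obtain n where "norm (x - X n) \<le> \<delta>" "norm (y - Y n) \<le> \<delta>" using near by blast
    moreover have "intertwines (X n) (Y n)" using X[of n] by (simp add: represents_def)
    ultimately show "\<exists>x'\<in>ops. \<exists>y'.
        intertwines x' y' \<and> norm (x - x') \<le> \<delta> \<and> norm (y - y') \<le> \<delta>" using Xc[of n] by blast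
  qed
  moreover have "intertwines (adjoint_op x) (adjoint_op y)"
  proof (rule intertwines_approx[OF adjoint_carrier[OF x]])
    fix \<delta> :: real assume "0 < \<delta>"
    then obtain n where n: "norm (x - X n) \<le> \<delta>" "norm (y - Y n) \<le> \<delta>" using near by blast
    have "norm (adjoint_op x - adjoint_op (X n)) \<le> \<delta>" "norm (adjoint_op y - adjoint_op (Y n)) \<le> \<delta>"
      using n x yc Xc[of n] Yc[of n]
      by (simp_all add: norm_adjoint ops_closed flip: adjoint_diff)
    moreover have "intertwines (adjoint_op (X n)) (adjoint_op (Y n))" using X[of n] by (simp add: represents_def)
    ultimately show "\<exists>x'\<in>ops. \<exists>y'.
        intertwines x' y' \<and> norm (adjoint_op x - x') \<le> \<delta> \<and> norm (adjoint_op y - y') \<le> \<delta>"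
      using adjoint_carrier[OF Xc[of n]] by blast
  qed
  ultimately show ?thesis using x yc by (auto simp: represents_def)
qed

lemma generated_represents:
  assumes "x \<in> cstar_generated bounded_operators (range T)"
  shows "\<exists>y. represents x y"
proof -
  let ?M = "{x. \<exists>y. represents x y}"
  have "cstar_subalgebra bounded_operators ?M"
  proof (rule cstar_subalgebraI[OF cstar_algebra_bounded_operators])
    show "?M \<subseteq> ops" by (auto simp: represents_def)
  next
    fix X :: "nat \<Rightarrow> 'f \<Rightarrow>\<^sub>L 'f" and x
    assume x: "x \<in> ops" and X: "\<And>n. X n \<in> ?M"
      and lim: "(\<lambda>n. cnorm bounded_operators (X n \<ominus>\<^bsub>bounded_operators\<^esub> x)) \<longlonglongrightarrow> 0"
    from X obtain Y where Y: "\<And>n. represents (X n) (Y n)" by simp metis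
    then have "X n \<in> ops" for n by (simp add: represents_def)
    then have "(\<lambda>n. norm (X n - x)) \<longlonglongrightarrow> 0" using lim x by simp
    then have "X \<longlonglongrightarrow> x" using LIM_zero_iff tendsto_norm_zero_iff by blast
    then show "x \<in> ?M" using represents_limit[OF Y x] by simp
  qed (unfold mem_Collect_eq bounded_operators_sel,
      (blast intro: represents_id represents_add represents_mult represents_smult represents_adjoint)+)
  moreover have "range T \<subseteq> ?M" using represents_shift by blast
  ultimately show ?thesis using assms unfolding cstar_generated_def by blast
qed

end

section \<open>Finite sums, words and polynomials in C*-algebras\<close>

lemma finsum_image_hom:
  assumes A: "ring A" and B: "ring B"
    and closed: "\<And>x. x \<in> carrier A \<Longrightarrow> \<phi> x \<in> carrier B"
    and zero: "\<phi> \<zero>\<^bsub>A\<^esub> = \<zero>\<^bsub>B\<^esub>"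
    and add: "\<And>x y. x \<in> carrier A \<Longrightarrow> y \<in> carrier A \<Longrightarrow> \<phi> (x \<oplus>\<^bsub>A\<^esub> y) = \<phi> x \<oplus>\<^bsub>B\<^esub> \<phi> y"
    and f: "\<And>i. i \<in> F \<Longrightarrow> f i \<in> carrier A"
  shows "\<phi> (\<Oplus>\<^bsub>A\<^esub> i \<in> F. f i) = (\<Oplus>\<^bsub>B\<^esub> i \<in> F. \<phi> (f i))"
proof -
  interpret A: ring A by (rule A)
  interpret B: ring B by (rule B)
  show ?thesis
    using f
  proof (induction F rule: infinite_finite_induct)
    case (insert i F)
    have 1: "(\<Oplus>\<^bsub>A\<^esub> i \<in> insert i F. f i) = f i \<oplus>\<^bsub>A\<^esub> (\<Oplus>\<^bsub>A\<^esub> i \<in> F. f i)"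
      by (rule A.finsum_insert) (use insert in auto)
    have 2: "(\<Oplus>\<^bsub>B\<^esub> i \<in> insert i F. \<phi> (f i)) = \<phi> (f i) \<oplus>\<^bsub>B\<^esub> (\<Oplus>\<^bsub>B\<^esub> i \<in> F. \<phi> (f i))"
      by (rule B.finsum_insert) (use insert closed in auto)
    have "(\<Oplus>\<^bsub>A\<^esub> i \<in> F. f i) \<in> carrier A" by (rule A.finsum_closed) (use insert in auto)
    then show ?case unfolding 1 2 using insert by (simp add: add)
  qed (simp_all add: zero A.finsum_infinite B.finsum_infinite)
qed

lemma finsum_eq_sum:
  fixes A :: "('a::comm_monoid_add, 'm) ring_scheme"
  assumes A: "ring A" and sel: "add A = (+)" "zero A = 0"
    and f: "\<And>i. i \<in> F \<Longrightarrow> f i \<in> carrier A"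
  shows "(\<Oplus>\<^bsub>A\<^esub> i \<in> F. f i) = (\<Sum>i\<in>F. f i)"
proof -
  interpret A: ring A by (rule A)
  show ?thesis
    using f
  proof (induction F rule: infinite_finite_induct)
    case (insert i F)
    have "(\<Oplus>\<^bsub>A\<^esub> i \<in> insert i F. f i) = f i \<oplus>\<^bsub>A\<^esub> (\<Oplus>\<^bsub>A\<^esub> i \<in> F. f i)"
      by (rule A.finsum_insert) (use insert in auto)
    then show ?case using insert by (simp add: sel)
  qed (simp_all add: A.finsum_infinite sel)
qed

lemmas finsum_bounded_operators =
  finsum_eq_sum[OF cstar_algebra.axioms(1)[OF cstar_algebra_bounded_operators]
    bounded_operators_sel(4,3)]

lemma poly_eval_free_monomial:
  assumes A: "cstar_algebra A" and w: "word_prod A s w \<in> carrier A"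
  shows "poly_eval A s (free_monomial w) = word_prod A s w"
proof -
  interpret A: ring A by (rule cstar_algebra.axioms(1)[OF A])
  show ?thesis
    using w cstar_smult_one[OF A w] by (simp add: poly_eval_def free_monomial_eq_single)
qed

lemma monomial_relations_imp_representation:
  fixes s :: "'d::finite \<Rightarrow> ('h::complex_hilbert_space \<Rightarrow>\<^sub>L 'h)"
  assumes L: "finite_type_language (allowed_words I) k"
    and s: "monomial_relations bounded_operators I k s"
  shows "language_representation (allowed_words I) k s"
proof -
  interpret finite_type_language "allowed_words I" k by (rule L)
  have c: "s i \<in> ops" for i
    using s by (simp add: monomial_relations_def row_contraction_def)
  have sw: "word_prod bounded_operators s w \<in> ops" for w
    by (induction w) (simp_all add: word_prod_bounded_operators_Cons ops_closed c)
  show ?thesis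
  proof unfold_locales
    show "(\<Sum>i\<in>UNIV. s i o\<^sub>L adjoint_op (s i)) = id_blinfun"
      using s finsum_bounded_operators[of UNIV "\<lambda>i. s i o\<^sub>L adjoint_op (s i)"]
      by (simp add: monomial_relations_def ops_closed adjoint_carrier c)
    show "word_prod bounded_operators s w = 0" if "w \<notin> allowed_words I" for w
    proof -
      have "poly_eval bounded_operators s (free_monomial w) = 0"
        using s that by (simp add: monomial_relations_def allowed_words_def)
      then show ?thesis
        using poly_eval_free_monomial[OF cstar_algebra_bounded_operators sw] by simp
    qed
    show "adjoint_op (s i) o\<^sub>L s i = (\<Sum>w | w \<in> allowed_words I \<and> length w = k \<and> i # w \<in> allowed_words I.
        word_prod bounded_operators s w o\<^sub>L adjoint_op (word_prod bounded_operators s w))" for i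
      using s finsum_bounded_operators[of "extendable_words I k i"
          "\<lambda>w. word_prod bounded_operators s w o\<^sub>L adjoint_op (word_prod bounded_operators s w)"]
      by (simp add: monomial_relations_def ops_closed adjoint_carrier sw
          extendable_words_def)
  qed (rule c)
qed

section \<open>The Toeplitz algebra modulo the compact operators\<close>

context language_shifts
begin

abbreviation TA :: "('f \<Rightarrow>\<^sub>L 'f) cstar" where "TA \<equiv> toeplitz_algebra T"

abbreviation TQ :: "('f \<Rightarrow>\<^sub>L 'f) set cstar" where "TQ \<equiv> toeplitz_quotient T"

lemma toeplitz_sel [simp]:
  "mult TA = (o\<^sub>L)" "one TA = id_blinfun"
  "zero TA = 0" "add TA = (+)"
  "smult TA = smult bounded_operators"
  "star TA = adjoint_op" "cnorm TA = norm"
  "carrier TA = cstar_generated bounded_operators (range T)"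
  by (simp_all add: toeplitz_algebra_def)

lemma generated_subalgebra:
  "cstar_subalgebra bounded_operators (cstar_generated bounded_operators (range T))"
  by (rule cstar_subalgebra_generated[OF cstar_algebra_bounded_operators]) auto

lemma cstar_algebra_toeplitz: "cstar_algebra TA"
  unfolding toeplitz_algebra_def
  by (rule cstar_algebra_subalgebra[OF cstar_algebra_bounded_operators generated_subalgebra])

lemma toeplitz_carrier: "x \<in> carrier TA \<Longrightarrow> x \<in> ops"
  using generated_subalgebra subringE(1) unfolding cstar_subalgebra_def by auto

lemma toeplitz_minus:
  assumes "x \<in> carrier TA" "y \<in> carrier TA"
  shows "x \<ominus>\<^bsub>TA\<^esub> y = x - y"
proof -
  have "subring (cstar_generated bounded_operators (range T)) bounded_operators"
    using generated_subalgebra unfolding cstar_subalgebra_def by blast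
  from a_minus_subring[OF cstar_algebra_bounded_operators this]
  show ?thesis using assms toeplitz_carrier unfolding toeplitz_algebra_def by simp
qed

lemma T_toeplitz: "T i \<in> carrier TA"
  by (auto simp: cstar_generated_def)

lemma compact_toeplitz: "K \<in> compacts \<Longrightarrow> K \<in> carrier TA"
  using compact_subset_generated by auto

lemma compacts_ideal: "ideal compacts TA"
proof -
  interpret A: ring "TA" by (rule cstar_algebra.axioms(1)[OF cstar_algebra_toeplitz])
  have neg: "- K \<in> compacts" if K: "K \<in> compacts" for K
  proof -
    have "K o\<^sub>L (- id_blinfun) \<in> compacts"
      by (rule compact_compose_right[OF K]) (simp add: ops_iff blinfun.minus_left)
    also have "K o\<^sub>L (- id_blinfun) = - K"
      by (rule blinfun_eqI) (simp add: blinfun.minus_left blinfun.minus_right)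
    finally show ?thesis .
  qed
  show ?thesis
  proof (rule idealI[OF A.ring_axioms])
    show "subgroup compacts (add_monoid TA)"
    proof (rule A.add.subgroupI)
      show "compacts \<noteq> {}" using compact_zero by blast
      show "compacts \<subseteq> carrier TA" using compact_toeplitz by blast
      show "\<ominus>\<^bsub>TA\<^esub> K \<in> compacts" if K: "K \<in> compacts" for K
      proof -
        have "\<ominus>\<^bsub>TA\<^esub> K = - K"
          by (rule A.minus_equality)
             (use K compact_toeplitz compact_toeplitz[OF neg[OF K]] in simp_all)
        then show ?thesis by (simp add: neg K)
      qed
    qed (simp add: compact_add)
  next
    show "x \<otimes>\<^bsub>TA\<^esub> K \<in> compacts" "K \<otimes>\<^bsub>TA\<^esub> x \<in> compacts"
      if "K \<in> compacts" "x \<in> carrier TA" for K x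
      using that toeplitz_carrier compact_compose_left compact_compose_right by simp_all
  qed
qed

text \<open>The projections \<open>proj n\<close> form an approximate unit of the compact operators.\<close>

lemma toeplitz_approximately_unital:
  "approximately_unital_ideal TA compacts (\<lambda>n. id_blinfun - proj n)"
proof -
  interpret A: ring "TA" by (rule cstar_algebra.axioms(1)[OF cstar_algebra_toeplitz])
  have one: "id_blinfun \<in> carrier TA" using A.one_closed by simp
  have p: "proj n \<in> carrier TA" for n by (rule compact_toeplitz[OF compact_proj])
  have r: "id_blinfun - proj n \<in> carrier TA" for n
    using A.minus_closed[OF one p, of n] unfolding toeplitz_minus[OF one p] .
  have "id_blinfun - (id_blinfun - proj n) \<in> compacts" for n by (simp add: compact_proj)
  then have unit: "\<one>\<^bsub>TA\<^esub> \<ominus>\<^bsub>TA\<^esub> (id_blinfun - proj n) \<in> compacts" for n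
    unfolding toeplitz_sel(2) toeplitz_minus[OF one r] .
  have lim: "(\<lambda>n. norm (x o\<^sub>L (id_blinfun - proj n))) \<longlonglongrightarrow> 0" if x: "x \<in> compacts" for x
  proof -
    have "x o\<^sub>L (id_blinfun - proj n) = x - (x o\<^sub>L proj n)" for n
      by (rule blinfun_eqI) (simp add: blinfun.diff_left blinfun.diff_right)
    then show ?thesis using compact_compose_proj_tendsto[OF x] by simp
  qed
  have closed: "x \<in> compacts" if x: "x \<in> carrier TA" and X: "\<And>n. X n \<in> compacts"
    and conv: "(\<lambda>n. cnorm TA (X n \<ominus>\<^bsub>TA\<^esub> x)) \<longlonglongrightarrow> 0"
    for X :: "nat \<Rightarrow> 'f \<Rightarrow>\<^sub>L 'f" and x
    by (rule compact_limit[OF X toeplitz_carrier[OF x]])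
       (use conv in \<open>simp only: toeplitz_minus[OF compact_toeplitz[OF X] x] toeplitz_sel\<close>)
  show ?thesis
    unfolding approximately_unital_ideal_def
  proof (intro conjI ballI allI impI)
    fix X :: "nat \<Rightarrow> 'f \<Rightarrow>\<^sub>L 'f" and x
    assume x: "x \<in> carrier TA" and X: "(\<forall>n. X n \<in> compacts) \<and>
      (\<lambda>n. cnorm TA (X n \<ominus>\<^bsub>TA\<^esub> x)) \<longlonglongrightarrow> 0"
    show "x \<in> compacts" by (rule closed[OF x spec[OF conjunct1[OF X]] conjunct2[OF X]])
  next
    show "cnorm TA (id_blinfun - proj n) \<le> 1" for n
      by (simp add: norm_id_minus_proj_le)
    show "star TA x \<in> compacts" if "x \<in> compacts" for x
      using compact_adjoint[OF that] by simp
    show "(\<lambda>n. cnorm TA (x \<otimes>\<^bsub>TA\<^esub> (id_blinfun - proj n))) \<longlonglongrightarrow> 0"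
      if "x \<in> compacts" for x
      using lim[OF that] by simp
  qed (rule compacts_ideal r unit)+
qed

abbreviation quotient_map :: "('f \<Rightarrow>\<^sub>L 'f) \<Rightarrow> ('f \<Rightarrow>\<^sub>L 'f) set" where
  "quotient_map x \<equiv> compacts +>\<^bsub>TA\<^esub> x"

lemmas quotient_lemmas = cstar_algebra_toeplitz toeplitz_approximately_unital

lemmas cstar_algebra_toeplitz_quotient =
  cstar_algebra_quotient[OF quotient_lemmas, folded toeplitz_quotient_def]

lemmas carrier_toeplitz_quotient =
  carrier_quotient[OF quotient_lemmas, folded toeplitz_quotient_def]

lemmas toeplitz_quotient_sel =
  quotient_sel[OF quotient_lemmas, folded toeplitz_quotient_def, unfolded toeplitz_sel(1-7)]

lemma quotient_map_closed: "x \<in> carrier TA \<Longrightarrow> quotient_map x \<in> carrier TQ"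
  unfolding carrier_toeplitz_quotient by (rule imageI)

lemma quotient_map_zero: "quotient_map 0 = \<zero>\<^bsub>TQ\<^esub>"
  using zero_quotient[OF quotient_lemmas] by (simp add: toeplitz_quotient_def)

lemma quotient_map_eqI:
  assumes "x \<in> carrier TA" "y \<in> carrier TA" "x - y \<in> compacts"
  shows "quotient_map x = quotient_map y"
  using coset_eq_iff[OF quotient_lemmas assms(1,2)] assms by (simp add: toeplitz_minus)

lemma mem_quotient_map:
  assumes "x \<in> carrier TA"
  shows "x' \<in> quotient_map x \<longleftrightarrow> x' \<in> carrier TA \<and> x' - x \<in> compacts"
  using mem_coset[OF quotient_lemmas assms] coset_eq_iff[OF quotient_lemmas _ assms] toeplitz_minus[OF _ assms]
  by metis

lemma ring_toeplitz: "ring TA"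
  by (rule cstar_algebra.axioms(1)[OF cstar_algebra_toeplitz])

lemma ring_toeplitz_quotient: "ring TQ"
  by (rule cstar_algebra.axioms(1)[OF cstar_algebra_toeplitz_quotient])

lemma toeplitz_closed:
  "id_blinfun \<in> carrier TA"
  "x \<in> carrier TA \<Longrightarrow> y \<in> carrier TA \<Longrightarrow> x o\<^sub>L y \<in> carrier TA"
  "x \<in> carrier TA \<Longrightarrow> y \<in> carrier TA \<Longrightarrow> x + y \<in> carrier TA"
  "x \<in> carrier TA \<Longrightarrow> adjoint_op x \<in> carrier TA"
  "x \<in> carrier TA \<Longrightarrow> c \<cdot> x \<in> carrier TA"
proof -
  interpret A: ring "TA" by (rule ring_toeplitz)
  show "id_blinfun \<in> carrier TA" using A.one_closed by simp
  show "x o\<^sub>L y \<in> carrier TA" "x + y \<in> carrier TA"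
    if "x \<in> carrier TA" "y \<in> carrier TA"
    using A.m_closed[OF that] A.a_closed[OF that] by simp_all
  show "adjoint_op x \<in> carrier TA" "c \<cdot> x \<in> carrier TA"
    if "x \<in> carrier TA"
    using cstar_algebra.star_closed[OF cstar_algebra_toeplitz that]
      cstar_smult_closed[OF cstar_algebra_toeplitz that, of c] by simp_all
qed

lemma toeplitz_sum_closed:
  "(\<And>i. i \<in> F \<Longrightarrow> f i \<in> carrier TA) \<Longrightarrow> (\<Sum>i\<in>F. f i) \<in> carrier TA"
  using compact_toeplitz[OF compact_zero]
  by (induction F rule: infinite_finite_induct)
    (simp_all add: toeplitz_closed(3)[unfolded toeplitz_sel])

lemma quotient_map_sum:
  assumes "\<And>i. i \<in> F \<Longrightarrow> f i \<in> carrier TA"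
  shows "quotient_map (\<Sum>i\<in>F. f i) = (\<Oplus>\<^bsub>TQ\<^esub> i \<in> F. quotient_map (f i))"
proof -
  have "(\<Oplus>\<^bsub>TA\<^esub> i \<in> F. f i) = (\<Sum>i\<in>F. f i)"
    by (rule finsum_eq_sum[OF ring_toeplitz toeplitz_sel(4,3) assms])
  moreover have "quotient_map (\<Oplus>\<^bsub>TA\<^esub> i \<in> F. f i) =
      (\<Oplus>\<^bsub>TQ\<^esub> i \<in> F. quotient_map (f i))"
    by (rule finsum_image_hom[OF ring_toeplitz ring_toeplitz_quotient quotient_map_closed])
       (use assms in \<open>simp_all only: toeplitz_sel(3,4) quotient_map_zero toeplitz_quotient_sel(5)\<close>)
  ultimately show ?thesis by simp
qed

lemma shift_word_toeplitz: "shift_word w \<in> carrier TA"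
  by (induction w) (simp_all only: word_prod_bounded_operators_Nil word_prod_bounded_operators_Cons toeplitz_closed T_toeplitz)

lemma word_prod_toeplitz_image:
  "word_prod TQ (toeplitz_image T) w = quotient_map (shift_word w)"
proof (induction w)
  case Nil
  show ?case using toeplitz_quotient_sel(6)[OF T_toeplitz] by (simp add: word_prod_def)
next
  case (Cons i w)
  then show ?case
    using toeplitz_quotient_sel(4)[OF T_toeplitz shift_word_toeplitz, of i w]
    by (simp add: word_prod_def toeplitz_image_def)
qed

text \<open>
  Both sides of the third relation are diagonal in the basis; they differ at the words shorter
  than \<open>k\<close> only, which is a compact perturbation.
\<close>

lemma initial_projection_mod_compacts:
  "(adjoint_op (T i) o\<^sub>L T i) - (\<Sum>w | w \<in> L \<and> length w = k \<and> i # w \<in> L.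
      shift_word w o\<^sub>L adjoint_op (shift_word w)) \<in> compacts"
proof -
  let ?E = "{w. w \<in> L \<and> length w = k \<and> i # w \<in> L}"
  let ?S = "{w \<in> short_words k. i # w \<in> L}"
  have finE: "finite ?E" by (rule finite_subset[OF _ finite_length_eq[of k]]) auto
  have "(adjoint_op (T i) o\<^sub>L T i) - (\<Sum>w\<in>?E. shift_word w o\<^sub>L adjoint_op (shift_word w)) =
      (\<Sum>w\<in>?S. rank_one (e w) (e w))"
  proof (rule basis_op_ext)
    fix v assume v: "v \<in> L"
    have "(\<Sum>w\<in>?E. shift_word w (adjoint_op (shift_word w) (e v))) =
        (\<Sum>w\<in>?E. if take k v = w then e v else 0)"
    proof (intro sum.cong refl)
      fix w assume w: "w \<in> ?E"
      show "shift_word w (adjoint_op (shift_word w) (e v)) =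
          (if take k v = w then e v else 0)"
      proof (cases "take k v = w")
        case True
        then have "w @ drop k v = v" by (metis append_take_drop_id)
        then show ?thesis using True v w appendD(2)[of w "drop k v"]
          by (simp add: adjoint_shift_word_basis shift_word_basis)
      qed (use v w in \<open>simp add: adjoint_shift_word_basis\<close>)
    qed
    also have "\<dots> = (if take k v \<in> ?E then e v else 0)" using finE by simp
    finally have 1: "(\<Sum>w\<in>?E. shift_word w (adjoint_op (shift_word w) (e v))) =
        (if take k v \<in> ?E then e v else 0)" .
    have "(\<Sum>w\<in>?S. cinner (e v) (e w) *\<^sub>C e w) = (\<Sum>w\<in>?S. if v = w then e v else 0)"
      by (intro sum.cong refl) (use v in \<open>auto simp: cinner_basis short_words_def\<close>)
    also have "\<dots> = (if v \<in> ?S then e v else 0)" by simp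
    finally have 2: "(\<Sum>w\<in>?S. cinner (e v) (e w) *\<^sub>C e w) = (if v \<in> ?S then e v else 0)" .
    have 3: "adjoint_op (T i) (T i (e v)) = (if i # v \<in> L then e v else 0)"
      using v by (simp add: T_basis adjoint_T_basis)
    have "take k v \<in> ?E \<longleftrightarrow> k \<le> length v \<and> i # v \<in> L"
      using v Cons_mem[of v i] appendD(1)[of "i # take k v" "drop k v"] ConsD[of i "take k v"]
      by auto
    moreover have "v \<in> ?S \<longleftrightarrow> length v < k \<and> i # v \<in> L" using v by (auto simp: short_words_def)
    ultimately show "((adjoint_op (T i) o\<^sub>L T i) - (\<Sum>w\<in>?E. shift_word w o\<^sub>L adjoint_op (shift_word w))) (e v) =
        (\<Sum>w\<in>?S. rank_one (e w) (e w)) (e v)"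
      by (auto simp: blinfun.diff_left blinfun.sum_left 1 2 3)
  qed (simp_all add: ops_closed adjoint_carrier)
  then show ?thesis by (simp add: compact_sum compact_rank_one)
qed

lemma toeplitz_quotient_relations:
  assumes L: "L = allowed_words I" and I: "monomial_ideal I"
  shows "monomial_relations TQ I k (toeplitz_image T)"
proof -
  let ?t = "toeplitz_image T"
  interpret Q: ring TQ by (rule ring_toeplitz_quotient)
  have t: "?t i = quotient_map (T i)" for i by (simp add: toeplitz_image_def)
  have tc: "?t i \<in> carrier TQ" for i unfolding t by (rule quotient_map_closed[OF T_toeplitz])
  note star = toeplitz_quotient_sel(2)
  note mult = toeplitz_quotient_sel(4)
  have one: "\<one>\<^bsub>TQ\<^esub> = (\<Oplus>\<^bsub>TQ\<^esub> i \<in> UNIV. ?t i \<otimes>\<^bsub>TQ\<^esub> star TQ (?t i))"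
  proof -
    have c: "T i o\<^sub>L adjoint_op (T i) \<in> carrier TA" for i
      by (intro toeplitz_closed T_toeplitz)
    have "\<one>\<^bsub>TQ\<^esub> = quotient_map id_blinfun" by (rule toeplitz_quotient_sel(6)[OF T_toeplitz])
    also have "\<dots> = quotient_map (\<Sum>i\<in>UNIV. T i o\<^sub>L adjoint_op (T i))"
      by (rule quotient_map_eqI[OF toeplitz_closed(1) toeplitz_sum_closed[OF c]])
         (simp add: vacuum_projection compact_rank_one)
    also have "\<dots> = (\<Oplus>\<^bsub>TQ\<^esub> i \<in> UNIV. quotient_map (T i o\<^sub>L adjoint_op (T i)))"
      by (rule quotient_map_sum[OF c])
    also have "(\<lambda>i. quotient_map (T i o\<^sub>L adjoint_op (T i))) = (\<lambda>i. ?t i \<otimes>\<^bsub>TQ\<^esub> star TQ (?t i))"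
      unfolding t star[OF T_toeplitz] mult[OF T_toeplitz toeplitz_closed(4)[OF T_toeplitz]] ..
    finally show ?thesis .
  qed
  have "cstar_le TQ (\<Oplus>\<^bsub>TQ\<^esub> i \<in> UNIV. ?t i \<otimes>\<^bsub>TQ\<^esub> star TQ (?t i)) \<one>\<^bsub>TQ\<^esub>"
    unfolding one[symmetric] cstar_le_def
    by (rule bexI[of _ "\<zero>\<^bsub>TQ\<^esub>"])
       (simp_all add: Q.minus_eq Q.r_neg cstar_algebra.star_closed[OF cstar_algebra_toeplitz_quotient])
  moreover have "poly_eval TQ ?t p = \<zero>\<^bsub>TQ\<^esub>" if p: "p \<in> I" for p
  proof -
    have "Poly_Mapping.lookup p w \<odot>\<^bsub>TQ\<^esub> word_prod TQ ?t w = \<zero>\<^bsub>TQ\<^esub>"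
      if w: "w \<in> Poly_Mapping.keys p" for w
    proof -
      have "w \<notin> L" unfolding L by (rule keys_monomial_ideal_not_allowed[OF I p w])
      from shift_word_not_allowed[OF this] have "word_prod TQ ?t w = quotient_map 0"
        by (simp only: word_prod_toeplitz_image)
      moreover have "c \<cdot> (0 :: 'f \<Rightarrow>\<^sub>L 'f) = 0" for c
        by (rule blinfun_eqI) simp
      ultimately show ?thesis
        using toeplitz_quotient_sel(1)[OF compact_toeplitz[OF compact_zero]]
        by (simp only: quotient_map_zero)
    qed
    then show ?thesis unfolding poly_eval_def by (rule Q.add.finprod_one_eqI)
  qed
  moreover have "star TQ (?t i) \<otimes>\<^bsub>TQ\<^esub> ?t i =
      (\<Oplus>\<^bsub>TQ\<^esub> w \<in> extendable_words I k i. word_prod TQ ?t w \<otimes>\<^bsub>TQ\<^esub> star TQ (word_prod TQ ?t w))" for i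
  proof -
    have E: "extendable_words I k i = {w. w \<in> L \<and> length w = k \<and> i # w \<in> L}"
      by (auto simp: extendable_words_def L)
    have c: "shift_word w o\<^sub>L adjoint_op (shift_word w) \<in> carrier TA" for w
      by (intro toeplitz_closed shift_word_toeplitz)
    have "star TQ (?t i) \<otimes>\<^bsub>TQ\<^esub> ?t i = quotient_map (adjoint_op (T i) o\<^sub>L T i)"
      unfolding t star[OF T_toeplitz] mult[OF toeplitz_closed(4)[OF T_toeplitz] T_toeplitz] ..
    also have "\<dots> = quotient_map (\<Sum>w\<in>extendable_words I k i. shift_word w o\<^sub>L adjoint_op (shift_word w))"
      by (rule quotient_map_eqI[OF toeplitz_closed(2)[OF toeplitz_closed(4)[OF T_toeplitz] T_toeplitz]
            toeplitz_sum_closed[OF c]])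
         (unfold E, rule initial_projection_mod_compacts)
    also have "\<dots> = (\<Oplus>\<^bsub>TQ\<^esub> w \<in> extendable_words I k i. quotient_map (shift_word w o\<^sub>L adjoint_op (shift_word w)))"
      by (rule quotient_map_sum[OF c])
    also have "(\<lambda>w. quotient_map (shift_word w o\<^sub>L adjoint_op (shift_word w))) =
        (\<lambda>w. word_prod TQ ?t w \<otimes>\<^bsub>TQ\<^esub> star TQ (word_prod TQ ?t w))"
      unfolding word_prod_toeplitz_image star[OF shift_word_toeplitz]
        mult[OF shift_word_toeplitz toeplitz_closed(4)[OF shift_word_toeplitz]] ..
    finally show ?thesis .
  qed
  ultimately show ?thesis
    unfolding monomial_relations_def row_contraction_def using one tc by blast
qed

text \<open>
  The preimage of a C*-subalgebra of the quotient is a C*-subalgebra of the bounded operators, as the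
  quotient map is contractive.
\<close>

lemma toeplitz_quotient_generated:
  "cstar_generated TQ (range (toeplitz_image T)) = carrier TQ"
proof
  have img: "toeplitz_image T i = quotient_map (T i)" for i by (simp add: toeplitz_image_def)
  have "cstar_subalgebra TQ (carrier TQ)"
    by (rule cstar_subalgebra_carrier[OF cstar_algebra_toeplitz_quotient])
  moreover have "range (toeplitz_image T) \<subseteq> carrier TQ"
    unfolding img using quotient_map_closed[OF T_toeplitz] by blast
  ultimately show "cstar_generated TQ (range (toeplitz_image T)) \<subseteq> carrier TQ"
    unfolding cstar_generated_def by blast
  show "carrier TQ \<subseteq> cstar_generated TQ (range (toeplitz_image T))"
    unfolding cstar_generated_def
  proof (rule Inter_greatest)
    fix B assume "B \<in> {B. cstar_subalgebra TQ B \<and> range (toeplitz_image T) \<subseteq> B}"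
    then have sub: "subring B TQ" and smult: "\<And>c X. X \<in> B \<Longrightarrow> c \<odot>\<^bsub>TQ\<^esub> X \<in> B"
      and star: "\<And>X. X \<in> B \<Longrightarrow> star TQ X \<in> B"
      and closed: "\<And>X L. L \<in> carrier TQ \<Longrightarrow> (\<And>n::nat. X n \<in> B) \<Longrightarrow>
         (\<lambda>n. cnorm TQ (X n \<ominus>\<^bsub>TQ\<^esub> L)) \<longlonglongrightarrow> 0 \<Longrightarrow> L \<in> B"
      and gen: "\<And>i. toeplitz_image T i \<in> B"
      unfolding cstar_subalgebra_def by blast+
    define P where "P = {x \<in> carrier TA. quotient_map x \<in> B}"
    have P: "x \<in> carrier TA" "quotient_map x \<in> B" if "x \<in> P" for x using that by (auto simp: P_def)
    have "cstar_subalgebra bounded_operators P"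
    proof (rule cstar_subalgebraI[OF cstar_algebra_bounded_operators], unfold bounded_operators_sel)
      show "P \<subseteq> ops" using P(1) toeplitz_carrier by blast
      show "id_blinfun \<in> P"
        using toeplitz_closed(1) subringE(3)[OF sub] toeplitz_quotient_sel(6)[OF T_toeplitz]
        by (simp add: P_def)
      show "x + y \<in> P" "x o\<^sub>L y \<in> P" if "x \<in> P" "y \<in> P" for x y
        using subringE(6,7)[OF sub P(2)[OF that(1)] P(2)[OF that(2)]]
          toeplitz_closed(2,3)[OF P(1)[OF that(1)] P(1)[OF that(2)]]
          toeplitz_quotient_sel(4,5)[OF P(1)[OF that(1)] P(1)[OF that(2)]]
        by (simp_all add: P_def)
      show "c \<cdot> x \<in> P" if "x \<in> P" for c x
        using smult[OF P(2)[OF that], of c] toeplitz_quotient_sel(1)[OF P(1)[OF that]]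
          toeplitz_closed(5)[OF P(1)[OF that]] by (simp add: P_def)
      show "adjoint_op x \<in> P" if "x \<in> P" for x
        using star[OF P(2)[OF that]] toeplitz_quotient_sel(2)[OF P(1)[OF that]]
          toeplitz_closed(4)[OF P(1)[OF that]] by (simp add: P_def)
    next
      fix X :: "nat \<Rightarrow> 'f \<Rightarrow>\<^sub>L 'f" and x
      assume x: "x \<in> ops" and X: "\<And>n. X n \<in> P"
        and lim: "(\<lambda>n. norm (X n \<ominus>\<^bsub>bounded_operators\<^esub> x)) \<longlonglongrightarrow> 0"
      have XA: "X n \<in> carrier TA" for n by (rule P(1)[OF X])
      have xA: "x \<in> carrier TA"
        using generated_subalgebra x XA lim unfolding cstar_subalgebra_def by fastforce
      have lim': "(\<lambda>n. norm (X n - x)) \<longlonglongrightarrow> 0"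
        using lim by (simp add: toeplitz_carrier[OF XA] x)
      have d: "X n - x \<in> carrier TA" for n
        using ring.ring_simprules(4)[OF ring_toeplitz XA xA, of n] toeplitz_minus[OF XA xA, of n] by simp
      have "(\<lambda>n. cnorm TQ (quotient_map (X n) \<ominus>\<^bsub>TQ\<^esub> quotient_map x)) \<longlonglongrightarrow> 0"
      proof (rule Lim_null_comparison[OF _ lim'])
        have "norm (cnorm TQ (quotient_map (X n) \<ominus>\<^bsub>TQ\<^esub> quotient_map x)) \<le> norm (X n - x)" for n
        proof -
          have "quotient_map (X n) \<ominus>\<^bsub>TQ\<^esub> quotient_map x = quotient_map (X n - x)"
            using quotient_minus[OF quotient_lemmas, folded toeplitz_quotient_def,
                OF ring_toeplitz_quotient XA xA, of n] by (simp only: toeplitz_minus[OF XA xA])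
          then show ?thesis
            using quotient_norm_le[OF quotient_lemmas d, folded toeplitz_quotient_def]
              quotient_norm_nonneg[OF quotient_lemmas d, folded toeplitz_quotient_def] by simp
        qed
        then show "\<forall>\<^sub>F n in sequentially.
            norm (cnorm TQ (quotient_map (X n) \<ominus>\<^bsub>TQ\<^esub> quotient_map x)) \<le> norm (X n - x)" by simp
      qed
      then have "quotient_map x \<in> B"
        using closed[of "quotient_map x" "\<lambda>n. quotient_map (X n)"] quotient_map_closed[OF xA] P(2)[OF X] by blast
      then show "x \<in> P" using xA by (simp add: P_def)
    qed
    moreover have "range T \<subseteq> P" using gen T_toeplitz by (auto simp: P_def img)
    ultimately have "carrier TA \<subseteq> P" unfolding toeplitz_sel(8) cstar_generated_def by blast
    then show "carrier TQ \<subseteq> B" unfolding carrier_toeplitz_quotient using P(2) by blast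
  qed
qed

end

section \<open>The representation of the quotient\<close>

context fock_representation
begin

text \<open>
  All representatives \<open>x\<close> of a coset give the same \<open>y\<close>, because compact operators are mapped to \<open>0\<close>.
\<close>

definition represented :: "('f \<Rightarrow>\<^sub>L 'f) set \<Rightarrow> ('h \<Rightarrow>\<^sub>L 'h)" where
  "represented X = (THE y. \<exists>x\<in>X. represents x y)"

lemma represented_quotient_map:
  assumes x: "x \<in> carrier TA" and y: "represents x y"
  shows "represented (quotient_map x) = y"
  unfolding represented_def
proof (rule the_equality)
  show "\<exists>x'\<in>quotient_map x. represents x' y"
    using y x mem_quotient_map[OF x, of x] compact_zero by (intro bexI[of _ x]) simp_all
  fix y' assume "\<exists>x'\<in>quotient_map x. represents x' y'"
  then obtain x' where x': "x' - x \<in> compacts" "represents x' y'"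
    using mem_quotient_map[OF x] by blast
  have "represents ((x' - x) + x) (0 + y)"
    by (rule represents_add[OF represents_compact[OF x'(1)] y])
  then show "y' = y" using represents_unique[OF x'(2)] by simp
qed

lemma star_hom_represented: "star_hom TQ bounded_operators represented"
proof -
  have rep: "\<exists>x y. x \<in> carrier TA \<and> X = quotient_map x \<and> represents x y"
    if X: "X \<in> carrier TQ" for X
  proof -
    obtain x where x: "x \<in> carrier TA" "X = quotient_map x"
      using X unfolding carrier_toeplitz_quotient by blast
    then show ?thesis using generated_represents[of x] by auto
  qed
  show ?thesis
    unfolding star_hom_def
  proof (intro conjI allI ballI)
    show "represented \<in> ring_hom TQ bounded_operators"
    proof (rule ring_hom_memI)
      fix X assume "X \<in> carrier TQ"
      then obtain x y where x: "x \<in> carrier TA" "X = quotient_map x" "represents x y"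
        using rep by blast
      then show "represented X \<in> ops"
        by (simp only: represented_quotient_map) (simp add: represents_def)
      fix X' assume "X' \<in> carrier TQ"
      then obtain x' y' where x': "x' \<in> carrier TA" "X' = quotient_map x'" "represents x' y'"
        using rep by blast
      show "represented (X \<otimes>\<^bsub>TQ\<^esub> X') =
          represented X \<otimes>\<^bsub>bounded_operators\<^esub> represented X'"
        unfolding x(2) x'(2) toeplitz_quotient_sel(4)[OF x(1) x'(1)] bounded_operators_sel
          represented_quotient_map[OF x(1,3)] represented_quotient_map[OF x'(1,3)]
        by (rule represented_quotient_map[OF toeplitz_closed(2)[OF x(1) x'(1)] represents_mult[OF x(3) x'(3)]])
      show "represented (X \<oplus>\<^bsub>TQ\<^esub> X') =
          represented X \<oplus>\<^bsub>bounded_operators\<^esub> represented X'"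
        unfolding x(2) x'(2) toeplitz_quotient_sel(5)[OF x(1) x'(1)] bounded_operators_sel
          represented_quotient_map[OF x(1,3)] represented_quotient_map[OF x'(1,3)]
        by (rule represented_quotient_map[OF toeplitz_closed(3)[OF x(1) x'(1)] represents_add[OF x(3) x'(3)]])
    next
      show "represented \<one>\<^bsub>TQ\<^esub> = \<one>\<^bsub>bounded_operators\<^esub>"
        unfolding toeplitz_quotient_sel(6)[OF T_toeplitz] bounded_operators_sel
        by (rule represented_quotient_map[OF toeplitz_closed(1) represents_id])
    qed
  next
    fix c X assume "X \<in> carrier TQ"
    then obtain x y where x: "x \<in> carrier TA" "X = quotient_map x" "represents x y"
      using rep by blast
    show "represented (c \<odot>\<^bsub>TQ\<^esub> X) = c \<cdot> represented X"
      unfolding x(2) toeplitz_quotient_sel(1)[OF x(1)] represented_quotient_map[OF x(1,3)]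
      by (rule represented_quotient_map[OF toeplitz_closed(5)[OF x(1)] represents_smult[OF x(3)]])
  next
    fix X assume "X \<in> carrier TQ"
    then obtain x y where x: "x \<in> carrier TA" "X = quotient_map x" "represents x y"
      using rep by blast
    show "represented (star TQ X) = star bounded_operators (represented X)"
      unfolding x(2) toeplitz_quotient_sel(2)[OF x(1)] bounded_operators_sel represented_quotient_map[OF x(1,3)]
      by (rule represented_quotient_map[OF toeplitz_closed(4)[OF x(1)] represents_adjoint[OF x(3)]])
  qed
qed

lemma represented_toeplitz_image: "represented (toeplitz_image T i) = s i"
  unfolding toeplitz_image_def by (rule represented_quotient_map[OF T_toeplitz represents_shift])

end

section \<open>The universal property of the quotient\<close>

theorem theorem7p11:
  fixes I :: "'d::finite free_algebra set"
    and k :: nat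
    and e :: "'d list \<Rightarrow> 'f::complex_hilbert_space"
    and T :: "'d \<Rightarrow> ('f \<Rightarrow>\<^sub>L 'f)"
  assumes "monomial_ideal I"
    and "finite_type I k"
    and "orthonormal_basis (allowed_words I) e"
    and "fock_shifts I e T"
  shows "cstar_algebra (toeplitz_quotient T) \<and>
    cstar_generated (toeplitz_quotient T) (range (toeplitz_image T))
      = carrier (toeplitz_quotient T) \<and>
    monomial_relations (toeplitz_quotient T) I k (toeplitz_image T) \<and>
    (\<forall>s :: 'd \<Rightarrow> ('h::complex_hilbert_space \<Rightarrow>\<^sub>L 'h).
       monomial_relations bounded_operators I k s \<longrightarrow>
       (\<exists>\<phi>. star_hom (toeplitz_quotient T) bounded_operators \<phi> \<and>
            (\<forall>i. \<phi> (toeplitz_image T i) = s i)))"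
proof -
  have L: "finite_type_language (allowed_words I) k"
    by (rule finite_type_language_allowed_words[OF assms(1,2)])
  interpret language_shifts "allowed_words I" k e T
    by (intro language_shifts.intro language_basis.intro L language_basis_axioms.intro
        language_shifts_axioms.intro)
       (use assms(3,4) in \<open>auto simp: fock_shifts_def\<close>)
  have "\<exists>\<phi>. star_hom (toeplitz_quotient T) bounded_operators \<phi> \<and> (\<forall>i. \<phi> (toeplitz_image T i) = s i)"
    if s: "monomial_relations bounded_operators I k s" for s :: "'d \<Rightarrow> ('h \<Rightarrow>\<^sub>L 'h)"
  proof -
    interpret R: fock_representation "allowed_words I" k e T s
      by (intro fock_representation.intro language_shifts_axioms
          monomial_relations_imp_representation[OF L s])
    show ?thesis using R.star_hom_represented R.represented_toeplitz_image by blast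
  qed
  then show ?thesis
    using cstar_algebra_toeplitz_quotient toeplitz_quotient_generated
      toeplitz_quotient_relations[OF refl assms(1)] by blast
qed

end
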